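(* Fix $\vartheta\in(0,1)$. Consider the map $g:\Sigma\times\mathbb T\to\Sigma\times\mathbb T$, $g(\omega,s)=(\sigma\omega,s+\beta_\omega)$, where $\omega\mapsto\beta_\omega\in\mathbb R$ is $\vartheta$-Hölder and independent of $s$. Assume the following condition: for $m=1,2,4$, the equation $e^{\mathrm i m\beta_\omega}A_{\sigma\omega}=\nu A_\omega$, with $A$ the coefficient of an element of $\mathcal E_{\vartheta,m}$ (that is, $A:\Sigma\to\mathbb C$ is $\vartheta$-Hölder), can only have one solution: the trivial solution $\nu=1$, $A_\omega=\text{constant}$. For $s_0\in\mathbb T$ and $\omega\in\Sigma$ let $s_n=s_0+\sum_{j=0}^{n-1}\beta_{\sigma^j\omega}$. Then there exist constants $r\in(0,1)$ and $C>0$ such that the following is satisfied. 1. Take $m=1,2$ and any $F,G\in\mathcal E_{\vartheta,m}$. Then, for any $s_0\in\mathbb T$, $$\big|\mathbb E_\omega\big(G(\sigma^n\omega,s_n)F(\sigma^k\omega,s_k)\big)\big|\le C\,\|G\|_{\vartheta^{1/2}}\,\|F\|_{\vartheta^{1/2}}\,r^{n-k}\qquad\text{for } n>k.$$ 2. For any $m=1,2$, any $n,k\in\mathbb N$ with $n>k$, and any two $\vartheta$-Hölder functions $P,Q:\Sigma\to\mathbb C$, $$\Big|\mathbb E_\omega\Big(P(\sigma^n\omega)\,e^{\mathrm i\sum_{j=0}^{n-1}m\beta_{\sigma^j\omega}}\,Q(\sigma^k\omega)\,e^{\mathrm i\sum_{j=0}^{k-1}m\beta_{\sigma^j\omega}}\Big)\Big|\le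 C\,\|P\|_{\vartheta^{1/2}}\,\|Q\|_{\vartheta^{1/2}}\,r^{n}.$$ 3. Consider $G(\omega,s)=A_\omega e^{\mathrm i s}+\overline{A_\omega}e^{-\mathrm i s}\in\mathcal E_{\vartheta,1}$ and assume that $\sum_{n=0}^{\infty}\mathbb E_\omega G(\sigma^n\omega,s_n)=0$ for any $s_0\in\mathbb T$. Then the normalized sum $G_N=\frac{1}{\sqrt N}\sum_{n=0}^{N-1}G(\sigma^n\omega,s_n)$ converges weakly to a normal distribution $\mathcal N(0,\boldsymbol\sigma^2)$ with $$\boldsymbol\sigma^2=2\,\mathbb E_{\omega,s}|A_\omega|^2+2\,\mathrm{Re}\Big[\mathbb E_{\omega,s}\Big(\sum_{n=1}^{+\infty}A_{\sigma^n\omega}\overline{A_\omega}\,e^{\mathrm i\sum_{j=0}^{n-1}\beta_{\sigma^j\omega}}\Big)\Big].$$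
   Context: $\Sigma=\{0,1\}^{\mathbb Z}$ and $\sigma:\Sigma\to\Sigma$ is the shift $(\sigma\omega)_k=\omega_{k+1}$ (in the general setting, $\sigma$ is an aperiodic subshift of finite type). $\Sigma$ carries the Bernoulli measure. $\mathbb E_\omega$ is the expectation for fixed initial angle $s_0\in\mathbb T$ with $\omega$ distributed according to the Bernoulli measure; $\mathbb E_{\omega,s}$ is the expectation for the product of the Bernoulli measure on $\Sigma$ and the Haar measure on $\mathbb T=\mathbb R/2\pi\mathbb Z$. Hölder norms: for continuous $f:\Sigma\to\mathbb C$, $\mathrm{var}_Nf=\sup\{|f(\omega)-f(\omega')|:\omega_i=\omega_i'\text{ for }|i|<N\}$, $|f|_\vartheta=\sup_{N\ge1}\vartheta^{-N}\mathrm{var}_Nf$, $\|f\|_\vartheta=\|f\|_{C^0}+|f|_\vartheta$; $f$ is $\vartheta$-Hölder if $\|f\|_\vartheta<\infty$. Observables: for $m\in\mathbb N$, $\mathcal E_{\vartheta,m}$ is the set of $F:\Sigma\times\mathbb T\to\mathbb R$ of the form $F(\omega,s)=A_\omega e^{\mathrm i ms}+\overline{A_\omega}e^{-\mathrm i ms}$ with $\|A\|_\vartheta<\infty$; the Hölder norm of $F$ is that of its Fourier coefficient $A$.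
   Formalization: The variance has 4 Re[...] in place of the printed 2 Re[...], which is false for coboundaries, with the sum taken over expectations; the assumption is read as excluding every nonzero solution A, also nonzero constants (where e^{imβ}=1 identically), since item 2 then fails. *)

theory Defs
  imports "HOL-Probability.Probability"
begin

type_synonym symb_seq = "int \<Rightarrow> bool"

definition shift :: "symb_seq \<Rightarrow> symb_seq" where
  "shift \<omega> = (\<lambda>k. \<omega> (k + 1))"

text \<open>The weight \<open>p\<close> of the symbol 1 is a parameter; \<open>p = 1/2\<close> is the symmetric case.\<close>

definition bernoulli_measure :: "real \<Rightarrow> symb_seq measure" where
  "bernoulli_measure p = (\<Pi>\<^sub>M i\<in>(UNIV :: int set). measure_pmf (bernoulli_pmf p))"

text \<open>
  The circle \<open>\<real>/2\<pi>\<int>\<close> is represented by its universal cover: an angle is a real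
  number, functions of an angle are \<open>2\<pi>\<close>-periodic functions on the reals, and Haar measure is
  normalised Lebesgue measure on a fundamental domain.
\<close>

definition haar_circle :: "real measure" where
  "haar_circle = uniform_measure lborel {0..<2 * pi}"


text \<open>
  The Hoelder norms take values in \<open>[0, \<infinity>]\<close>, so no boundedness has to be presupposed. For
  \<open>0 < \<theta> < 1\<close>, finiteness of \<open>hoelder_norm \<theta> f\<close> forces \<open>f\<close> to be continuous for the
  product topology.
\<close>

definition variation :: "nat \<Rightarrow> (symb_seq \<Rightarrow> 'b::real_normed_vector) \<Rightarrow> ennreal" where
  "variation N f =
     (SUP (\<omega>, \<omega>') \<in> {(\<omega>, \<omega>'). \<forall>i. \<bar>i\<bar> < int N \<longrightarrow> \<omega> i = \<omega>' i}. ennreal (norm (f \<omega> - f \<omega>')))"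

definition hoelder_seminorm :: "real \<Rightarrow> (symb_seq \<Rightarrow> 'b::real_normed_vector) \<Rightarrow> ennreal" where
  "hoelder_seminorm \<theta> f = (SUP N \<in> {1..}. ennreal (inverse (\<theta> ^ N)) * variation N f)"

definition hoelder_norm :: "real \<Rightarrow> (symb_seq \<Rightarrow> 'b::real_normed_vector) \<Rightarrow> ennreal" where
  "hoelder_norm \<theta> f = (SUP \<omega>. ennreal (norm (f \<omega>))) + hoelder_seminorm \<theta> f"

definition hoelder :: "real \<Rightarrow> (symb_seq \<Rightarrow> 'b::real_normed_vector) \<Rightarrow> bool" where
  "hoelder \<theta> f \<longleftrightarrow> hoelder_norm \<theta> f < \<infinity>"


definition has_fourier_coeff :: "nat \<Rightarrow> (symb_seq \<times> real \<Rightarrow> real) \<Rightarrow> (symb_seq \<Rightarrow> complex) \<Rightarrow> bool" where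
  "has_fourier_coeff m F A \<longleftrightarrow>
     (\<forall>\<omega> s. complex_of_real (F (\<omega>, s)) = A \<omega> * cis (real m * s) + cnj (A \<omega>) * cis (- (real m * s)))"

lemma has_fourier_coeff_unique:
  assumes "has_fourier_coeff m F A" "has_fourier_coeff m F B" "m > 0"
  shows "A = B"
proof
  fix \<omega>
  have eq: "A \<omega> * cis (real m * s) + cnj (A \<omega>) * cis (- (real m * s)) =
            B \<omega> * cis (real m * s) + cnj (B \<omega>) * cis (- (real m * s))" for s
    using assms(1,2) by (metis has_fourier_coeff_def)
  have "Re (A \<omega>) = Re (B \<omega>)"
    using arg_cong[OF eq[of 0], of Re] by simp
  moreover have "Im (A \<omega>) = Im (B \<omega>)"
    using arg_cong[OF eq[of "pi / (2 * real m)"], of Re] \<open>m > 0\<close> by (simp add: field_simps)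
  ultimately show "A \<omega> = B \<omega>"
    by (rule complex_eqI)
qed

definition fourier_coeff :: "nat \<Rightarrow> (symb_seq \<times> real \<Rightarrow> real) \<Rightarrow> symb_seq \<Rightarrow> complex" where
  "fourier_coeff m F = (THE A. has_fourier_coeff m F A)"

lemma fourier_coeff_eq: "has_fourier_coeff m F A \<Longrightarrow> m > 0 \<Longrightarrow> fourier_coeff m F = A"
  unfolding fourier_coeff_def by (blast intro: has_fourier_coeff_unique)

definition observables :: "real \<Rightarrow> nat \<Rightarrow> (symb_seq \<times> real \<Rightarrow> real) set" where
  "observables \<theta> m = {F. \<exists>A. has_fourier_coeff m F A \<and> hoelder \<theta> A}"

definition observable_norm :: "real \<Rightarrow> nat \<Rightarrow> (symb_seq \<times> real \<Rightarrow> real) \<Rightarrow> ennreal" where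
  "observable_norm \<theta> m F = hoelder_norm \<theta> (fourier_coeff m F)"


definition skew_shift :: "(symb_seq \<Rightarrow> real) \<Rightarrow> symb_seq \<times> real \<Rightarrow> symb_seq \<times> real" where
  "skew_shift \<beta> = (\<lambda>(\<omega>, s). (shift \<omega>, s + \<beta> \<omega>))"

definition birkhoff_sum :: "(symb_seq \<Rightarrow> real) \<Rightarrow> nat \<Rightarrow> symb_seq \<Rightarrow> real" where
  "birkhoff_sum \<beta> n \<omega> = (\<Sum>j<n. \<beta> ((shift ^^ j) \<omega>))"

definition angle :: "(symb_seq \<Rightarrow> real) \<Rightarrow> real \<Rightarrow> nat \<Rightarrow> symb_seq \<Rightarrow> real" where
  "angle \<beta> s\<^sub>0 n \<omega> = s\<^sub>0 + birkhoff_sum \<beta> n \<omega>"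

lemma skew_shift_funpow: "(skew_shift \<beta> ^^ n) (\<omega>, s\<^sub>0) = ((shift ^^ n) \<omega>, angle \<beta> s\<^sub>0 n \<omega>)"
  by (induction n) (simp_all add: skew_shift_def angle_def birkhoff_sum_def)

text \<open>
  The equation \<open>e\<^sup>i\<^sup>m\<^sup>\<beta> A \<circ> shift = \<nu> A\<close> is linear in \<open>A\<close>, and \<open>A = 0\<close> solves it for every
  \<open>\<nu>\<close>. Having a single, constant solution therefore means that the constant is 0. A non-zero
  constant solves it with \<open>\<nu> = 1\<close> exactly when \<open>e\<^sup>i\<^sup>m\<^sup>\<beta>\<close> is identically 1. This case has to be
  excluded as well: for \<open>\<beta> = 0\<close> all solutions with \<open>A \<noteq> 0\<close> are constant with \<open>\<nu> = 1\<close>, but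
  correlations such as those of \<open>2 cos (m s)\<close> do not decay.
\<close>

definition only_trivial_solution :: "real \<Rightarrow> (symb_seq \<Rightarrow> real) \<Rightarrow> nat \<Rightarrow> bool" where
  "only_trivial_solution \<theta> \<beta> m \<longleftrightarrow>
     (\<forall>\<nu> A. hoelder \<theta> A \<and> (\<forall>\<omega>. cis (real m * \<beta> \<omega>) * A (shift \<omega>) = \<nu> * A \<omega>)
        \<longrightarrow> (\<forall>\<omega>. A \<omega> = 0))"

definition normalized_sum ::
  "(symb_seq \<Rightarrow> real) \<Rightarrow> (symb_seq \<times> real \<Rightarrow> real) \<Rightarrow> real \<Rightarrow> nat \<Rightarrow> symb_seq \<Rightarrow> real" where
  "normalized_sum \<beta> G s\<^sub>0 N \<omega> =
     1 / sqrt (real N) * (\<Sum>n<N. G ((shift ^^ n) \<omega>, angle \<beta> s\<^sub>0 n \<omega>))"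

text \<open>
  Two conventions. The terms of the series do not tend to 0 pointwise, only their expectations do
  (exponentially fast), so the expectation of the series is the sum of the expectations.
  The factor of the correlation part is 4: with \<open>G\<^sub>n = 2 Re (A\<^sub>n e\<^sup>i\<^sup>s\<^sub>n)\<close>, the part of
  \<open>\<bbbE> (G\<^sub>n G\<^sub>k)\<close> that depends only on \<open>n - k\<close> is
  \<open>2 Re \<bbbE> (A\<^sub>n (cnj A\<^sub>k) e\<^sup>i\<^sup>(\<^sup>s\<^sub>n\<^sup>-\<^sup>s\<^sub>k\<^sup>))\<close>, and each pair \<open>k < n\<close> occurs twice in the
  square of the sum. With a factor 2 instead, the limit law would be wrong
  already for a coboundary \<open>A = B - e\<^sup>i\<^sup>\<beta> B \<circ> shift\<close> with \<open>\<bbbE> B = 0\<close> and \<open>B \<noteq> 0\<close>: the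
  sums of \<open>G\<close> then telescope and stay bounded, so the limit variance is 0, and this is the value
  given by the factor 4, whereas the factor 2 gives \<open>\<bbbE> \<bar>A\<bar>\<^sup>2 > 0\<close>.
\<close>

definition limit_variance :: "real \<Rightarrow> (symb_seq \<Rightarrow> real) \<Rightarrow> (symb_seq \<Rightarrow> complex) \<Rightarrow> real" where
  "limit_variance p \<beta> A =
     2 * (\<integral>(\<omega>, s). (norm (A \<omega>))\<^sup>2 \<partial>(bernoulli_measure p \<Otimes>\<^sub>M haar_circle))
     + 4 * Re (\<Sum>n. \<integral>(\<omega>, s). A ((shift ^^ Suc n) \<omega>) * cnj (A \<omega>) * cis (birkhoff_sum \<beta> (Suc n) \<omega>)
                    \<partial>(bernoulli_measure p \<Otimes>\<^sub>M haar_circle))"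

text \<open>The degenerate normal law of variance 0 is the Dirac measure; it does occur as a limit.\<close>

definition centered_normal :: "real \<Rightarrow> real measure" where
  "centered_normal v =
     (if v = 0 then return borel 0 else density lborel (\<lambda>x. ennreal (normal_density 0 (sqrt v) x)))"

end

theory Submission
  imports Defs "HOL-Complex_Analysis.Great_Picard" "HOL-Real_Asymp.Real_Asymp"
begin

text \<open>
  Up to a coboundary, \<open>\<beta>\<close> depends on the future only, so the correlations of \<open>e\<^sup>i\<^sup>m\<^sup>\<beta>\<close> are governed by the
  twisted transfer operator \<open>T f w = \<Sum>\<^sub>a p\<^sub>a e\<^sup>i\<^sup>m\<^sup>b\<^sup>(\<^sup>a\<^sup>w\<^sup>) f(aw)\<close> on Hoelder functions of the future. If
  the sup norm of \<open>T\<^sup>n\<close> on an invariant ball of Hoelder functions did not drop below 1, compactness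
  would give a function all of whose iterates are unimodular, and this solves
  \<open>e\<^sup>i\<^sup>m\<^sup>\<beta> A \<circ> shift = \<nu> A\<close>, against the assumption. So \<open>T\<^sup>n\<close> decays exponentially for \<open>m = 1, 2, 4\<close>, which
  gives exponential mixing between an observable of the (approximate) past and one of the
  (approximate) future, and with it parts 1 and 2.

  For part 3, let \<open>\<psi>\<^sub>n\<close> be the characteristic function of the sum of the first \<open>n\<close> terms at \<open>a = t / \<surd>N\<close>.
  A second order Taylor expansion around time \<open>n - N\<^bsup>1/8\<^esup>\<close> and the mixing estimates give
  \<open>\<psi>\<^sub>n\<^sub>+\<^sub>1 = (1 - a\<^sup>2 \<sigma>\<^sup>2 / 2) \<psi>\<^sub>n + o(1/N)\<close>, hence \<open>\<psi>\<^sub>N \<longlonglongrightarrow> exp (- t\<^sup>2 \<sigma>\<^sup>2 / 2)\<close>, and Levy's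
  continuity theorem applies.
\<close>

section \<open>The Bernoulli measure\<close>

text \<open>Regularity shapes the proof. All estimates work at the rate \<open>\<kappa>\<close>, the
  fourth root of \<open>\<theta>\<close>, whereas \<open>\<beta>\<close> has rate
  \<open>\<kappa> ^ 4\<close> and the norms of the theorem have rate
  \<open>\<kappa>\<^sup>2\<close>. Replacing \<open>\<beta>\<close> by a function of the future
  consumes regularity, so the operator argument only produces \<open>\<kappa>\<close>-Hoelder
  solutions of the twisted equation, while the assumption excludes \<open>\<theta>\<close>-Hoelder
  ones; a Livsic bootstrap closes this gap. The three frequencies arise because multiplying two
  terms of frequency \<open>m\<close> doubles the phase on the steps they share:
  \<open>m = 1, 2\<close> calls for 1, 2 and 4. In part 3 the factor \<open>cis (a * Y)\<close>
  contains every frequency, so a perturbation argument for the operators is out of reach. Instead it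
  is treated as a single observable of the past, with bounds that do not depend on the time, and at
  most two further terms of the sum are ever correlated with it. Square roots of rates appear
  wherever a time gap is split and only half of it supplies the decay.\<close>

definition mix :: "int set \<Rightarrow> symb_seq \<Rightarrow> symb_seq \<Rightarrow> symb_seq" where
  "mix S \<eta> w = (\<lambda>i. if i \<in> S then \<eta> i else w i)"

definition unshift :: "symb_seq \<Rightarrow> symb_seq" where
  "unshift w = (\<lambda>k. w (k - 1))"

text \<open>All of \<open>w\<close> moves one place to the right and the symbol that would land at
  0, namely \<open>w (-1)\<close>, is overwritten by \<open>a\<close>. So \<open>shift\<close> gives
  back \<open>w\<close> except at coordinate -1, which functions of the future do not see.\<close>

definition prepend :: "bool \<Rightarrow> symb_seq \<Rightarrow> symb_seq" where
  "prepend a w = (\<lambda>i. if i = 0 then a else w (i - 1))"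

lemma shift_funpow: "(shift ^^ n) w = (\<lambda>k. w (k + int n))"
  by (induction n arbitrary: w) (auto simp: shift_def fun_eq_iff algebra_simps)

lemma unshift_funpow: "(unshift ^^ n) w = (\<lambda>k. w (k - int n))"
  by (induction n arbitrary: w) (auto simp: unshift_def fun_eq_iff algebra_simps)

lemma shift_unshift [simp]: "shift (unshift w) = w"
  by (simp add: shift_def unshift_def)

lemma unshift_shift [simp]: "unshift (shift w) = w"
  by (simp add: shift_def unshift_def)

lemma shift_prepend [simp]: "shift (prepend a w) i = (if i = -1 then a else w i)"
  by (auto simp: shift_def prepend_def)

lemma shift_add: "(shift ^^ (m + n)) w = (shift ^^ m) ((shift ^^ n) w)"
  by (simp add: funpow_add)

abbreviation seq_borel :: "symb_seq measure" where
  "seq_borel \<equiv> \<Pi>\<^sub>M i\<in>(UNIV :: int set). count_space (UNIV :: bool set)"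

abbreviation seq_meas :: "(symb_seq \<Rightarrow> 'b::topological_space) set" where
  "seq_meas \<equiv> borel_measurable seq_borel"

lemma space_bernoulli_measure [simp]: "space (bernoulli_measure p) = UNIV"
  by (auto simp: bernoulli_measure_def space_PiM)

lemma sets_bernoulli_measure [measurable_cong, simp]: "sets (bernoulli_measure p) = sets seq_borel"
  unfolding bernoulli_measure_def by (rule sets_PiM_cong) auto

lemma prob_space_bernoulli_measure: "prob_space (bernoulli_measure p)"
  unfolding bernoulli_measure_def by (intro prob_space_PiM measure_pmf.prob_space_axioms)

interpretation bern: prob_space "bernoulli_measure p" for p
  by (rule prob_space_bernoulli_measure)

lemma measurable_seqI:
  assumes "\<And>i. (\<lambda>x. f x i) \<in> measurable M (count_space UNIV)"
  shows "f \<in> measurable M seq_borel"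
  by (rule measurable_PiM_single') (use assms in auto)

lemma measurable_coord [measurable]: "(\<lambda>w. w i) \<in> measurable seq_borel (count_space UNIV)"
  by (rule measurable_component_singleton) auto

lemma measurable_shift [measurable]: "shift \<in> measurable seq_borel seq_borel"
  by (rule measurable_seqI) (simp add: shift_def)

lemma measurable_unshift [measurable]: "unshift \<in> measurable seq_borel seq_borel"
  by (rule measurable_seqI) (simp add: unshift_def)

lemma measurable_shift_funpow [measurable]: "(shift ^^ n) \<in> measurable seq_borel seq_borel"
  by (rule measurable_seqI) (simp add: shift_funpow)

lemma measurable_unshift_funpow [measurable]: "(unshift ^^ n) \<in> measurable seq_borel seq_borel"
  by (rule measurable_seqI) (simp add: unshift_funpow)

lemma measurable_prepend [measurable]: "prepend a \<in> measurable seq_borel seq_borel"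
  by (rule measurable_seqI) (auto simp: prepend_def)

lemma measurable_upd [measurable]: "(\<lambda>w. fun_upd w i a) \<in> measurable seq_borel seq_borel"
  by (rule measurable_seqI) auto

lemma measurable_mix [measurable]:
  "(\<lambda>x. mix S (fst x) (snd x)) \<in> measurable (seq_borel \<Otimes>\<^sub>M seq_borel) seq_borel"
  by (rule measurable_seqI) (auto simp: mix_def)

lemma measurable_mix1 [measurable]: "(\<lambda>x. mix S \<eta> x) \<in> measurable seq_borel seq_borel"
  by (rule measurable_seqI) (auto simp: mix_def)

lemma distr_shift: "distr (bernoulli_measure p) (bernoulli_measure p) shift = bernoulli_measure p"
  using distr_PiM_reindex[of "UNIV::int set" "\<lambda>_. measure_pmf (bernoulli_pmf p)" "\<lambda>k. k + 1" UNIV]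
  by (simp add: bernoulli_measure_def shift_def [abs_def] measure_pmf.prob_space_axioms restrict_def)

lemma integral_shift:
  fixes f :: "symb_seq \<Rightarrow> 'b::{banach, second_countable_topology}"
  assumes [measurable]: "f \<in> seq_meas"
  shows "(\<integral>w. f (shift w) \<partial>bernoulli_measure p) = (\<integral>w. f w \<partial>bernoulli_measure p)"
proof -
  have "(\<integral>w. f w \<partial>distr (bernoulli_measure p) (bernoulli_measure p) shift)
      = (\<integral>w. f (shift w) \<partial>bernoulli_measure p)"
    by (rule integral_distr) measurable
  then show ?thesis by (simp add: distr_shift)
qed

lemma integral_unshift:
  fixes f :: "symb_seq \<Rightarrow> 'b::{banach, second_countable_topology}"
  assumes [measurable]: "f \<in> seq_meas"
  shows "(\<integral>w. f (unshift w) \<partial>bernoulli_measure p) = (\<integral>w. f w \<partial>bernoulli_measure p)"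
  using integral_shift[of "\<lambda>w. f (unshift w)" p] by simp

lemma integral_shift_funpow:
  fixes f :: "symb_seq \<Rightarrow> 'b::{banach, second_countable_topology}"
  assumes [measurable]: "f \<in> seq_meas"
  shows "(\<integral>w. f ((shift ^^ n) w) \<partial>bernoulli_measure p) = (\<integral>w. f w \<partial>bernoulli_measure p)"
proof (induction n)
  case (Suc n)
  have "(\<integral>w. f ((shift ^^ Suc n) w) \<partial>bernoulli_measure p)
      = (\<integral>w. f ((shift ^^ n) (shift w)) \<partial>bernoulli_measure p)"
    by (simp add: funpow_swap1)
  also have "\<dots> = (\<integral>w. f ((shift ^^ n) w) \<partial>bernoulli_measure p)"
    by (rule integral_shift) measurable
  finally show ?case using Suc by simp
qed simp

text \<open>Splicing two independent samples gives a sample again; this is how the independence of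
  disjoint coordinate blocks enters. The preimage of a cylinder over \<open>J\<close> is a
  rectangle: the constraints in \<open>J \<inter> S\<close> fall on the first factor, the others on
  the second.\<close>

lemma distr_mix:
  "distr (bernoulli_measure p \<Otimes>\<^sub>M bernoulli_measure p) (bernoulli_measure p)
     (\<lambda>x. mix S (fst x) (snd x)) = bernoulli_measure p" (is "?D = _")
proof -
  let ?M = "\<lambda>_::int. measure_pmf (bernoulli_pmf p)"
  let ?mu = "bernoulli_measure p"
  interpret product_prob_space ?M "UNIV :: int set"
    by unfold_locales
  show ?thesis
    unfolding bernoulli_measure_def
  proof (rule PiM_eq, fold bernoulli_measure_def)
    fix J :: "int set" and F :: "int \<Rightarrow> bool set"
    assume J: "finite J"
    let ?X = "prod_emb UNIV ?M J (Pi\<^sub>E J F)"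
    let ?A = "prod_emb UNIV ?M (J \<inter> S) (Pi\<^sub>E (J \<inter> S) F)"
    let ?B = "prod_emb UNIV ?M (J - S) (Pi\<^sub>E (J - S) F)"
    have X: "?X \<in> sets ?mu" "?A \<in> sets ?mu" "?B \<in> sets ?mu"
      unfolding bernoulli_measure_def using J by (auto intro!: sets_PiM_I)
    have "emeasure ?D ?X = emeasure (?mu \<Otimes>\<^sub>M ?mu)
        ((\<lambda>x. mix S (fst x) (snd x)) -` ?X \<inter> space (?mu \<Otimes>\<^sub>M ?mu))"
      using X by (intro emeasure_distr) auto
    also have "(\<lambda>x. mix S (fst x) (snd x)) -` ?X \<inter> space (?mu \<Otimes>\<^sub>M ?mu) = ?A \<times> ?B"
    proof -
      have "mix S a b i \<in> F i \<longleftrightarrow> (i \<in> S \<longrightarrow> a i \<in> F i) \<and> (i \<notin> S \<longrightarrow> b i \<in> F i)" for a b i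
        by (simp add: mix_def)
      then show ?thesis
        by (auto simp: prod_emb_def space_pair_measure PiE_iff)
    qed
    also have "emeasure (?mu \<Otimes>\<^sub>M ?mu) (?A \<times> ?B) = emeasure ?mu ?A * emeasure ?mu ?B"
      using X by (intro bern.emeasure_pair_measure_Times) auto
    also have "emeasure ?mu ?A = (\<Prod>j\<in>J \<inter> S. emeasure (?M j) (F j))"
      unfolding bernoulli_measure_def using J by (intro emeasure_PiM_emb) auto
    also have "emeasure ?mu ?B = (\<Prod>j\<in>J - S. emeasure (?M j) (F j))"
      unfolding bernoulli_measure_def using J by (intro emeasure_PiM_emb) auto
    also have "(\<Prod>j\<in>J \<inter> S. emeasure (?M j) (F j)) * (\<Prod>j\<in>J - S. emeasure (?M j) (F j))
        = (\<Prod>j\<in>J. emeasure (?M j) (F j))"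
      using J by (simp add: prod.Int_Diff[of J _ S])
    finally show "emeasure ?D ?X = (\<Prod>j\<in>J. emeasure (?M j) (F j))" .
  qed (simp add: bernoulli_measure_def)
qed

lemma bern_integrable:
  fixes f :: "symb_seq \<Rightarrow> 'b::{banach, second_countable_topology}"
  assumes "f \<in> seq_meas" "\<And>w. norm (f w) \<le> K"
  shows "integrable (bernoulli_measure p) f"
  by (rule bern.integrable_const_bound[of _ K]) (use assms in \<open>auto cong: measurable_cong_sets\<close>)

text \<open>This holds for every function: without integrability the Bochner integral is 0, and
  \<open>K\<close> is nonnegative because it bounds a norm.\<close>

lemma bern_integral_bound:
  fixes f :: "symb_seq \<Rightarrow> 'b::{banach, second_countable_topology}"
  assumes "\<And>w. norm (f w) \<le> K"
  shows "norm (\<integral>w. f w \<partial>bernoulli_measure p) \<le> K"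
proof (cases "integrable (bernoulli_measure p) f")
  case True
  have "norm (\<integral>w. f w \<partial>bernoulli_measure p) \<le> (\<integral>w. norm (f w) \<partial>bernoulli_measure p)"
    by (rule integral_norm_bound)
  also have "\<dots> \<le> (\<integral>w. K \<partial>bernoulli_measure p)"
    using True assms by (intro integral_mono) auto
  finally show ?thesis using bern.prob_space[of p] by simp
next
  case False
  then show ?thesis
    using assms[of undefined] norm_ge_zero[of "f undefined"]
    by (simp add: not_integrable_integral_eq del: norm_ge_zero)
qed

lemma bern_integral_diff_bound:
  fixes f g :: "symb_seq \<Rightarrow> complex"
  assumes "f \<in> seq_meas" "g \<in> seq_meas"
    and "\<And>w. norm (f w) \<le> K" "\<And>w. norm (f w - g w) \<le> e"
  shows "norm ((\<integral>w. f w \<partial>bernoulli_measure p) - (\<integral>w. g w \<partial>bernoulli_measure p)) \<le> e"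
proof -
  have "norm (g w) \<le> K + e" for w
    using assms(3,4)[of w] norm_triangle_ineq4[of "f w" "f w - g w"] by simp
  then have "integrable (bernoulli_measure p) f" "integrable (bernoulli_measure p) g"
    using assms by (auto intro!: bern_integrable)
  then have "(\<integral>w. f w \<partial>bernoulli_measure p) - (\<integral>w. g w \<partial>bernoulli_measure p)
      = (\<integral>w. f w - g w \<partial>bernoulli_measure p)"
    by simp
  then show ?thesis using bern_integral_bound[of "\<lambda>w. f w - g w" e] assms by simp
qed

lemma integral_mix:
  fixes f :: "symb_seq \<Rightarrow> complex"
  assumes [measurable]: "f \<in> seq_meas" and b: "\<And>w. norm (f w) \<le> K"
  shows "(\<integral>w. f w \<partial>bernoulli_measure p)
    = (\<integral>\<eta>. (\<integral>w. f (mix S \<eta> w) \<partial>bernoulli_measure p) \<partial>bernoulli_measure p)"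
proof -
  let ?mu = "bernoulli_measure p"
  interpret P: pair_prob_space ?mu ?mu ..
  have "(\<integral>w. f w \<partial>?mu) = (\<integral>w. f w \<partial>distr (?mu \<Otimes>\<^sub>M ?mu) ?mu (\<lambda>x. mix S (fst x) (snd x)))"
    by (simp add: distr_mix)
  also have "\<dots> = (\<integral>x. f (mix S (fst x) (snd x)) \<partial>(?mu \<Otimes>\<^sub>M ?mu))"
    by (rule integral_distr) measurable
  also have "\<dots> = (\<integral>\<eta>. (\<integral>w. f (mix S \<eta> w) \<partial>?mu) \<partial>?mu)"
  proof -
    have "integrable (?mu \<Otimes>\<^sub>M ?mu) (\<lambda>x. f (mix S (fst x) (snd x)))"
      by (rule P.P.integrable_const_bound[of _ K]) (use b in auto)
    from P.integral_fst'[OF this] show ?thesis by simp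
  qed
  finally show ?thesis .
qed

lemma integral_coord:
  fixes h :: "bool \<Rightarrow> complex"
  assumes "0 < p" "p < 1"
  shows "(\<integral>w. h (w i) \<partial>bernoulli_measure p) = of_real p * h True + of_real (1 - p) * h False"
proof -
  have "(\<integral>w. h (w i) \<partial>bernoulli_measure p)
     = (\<integral>x. h x \<partial>distr (bernoulli_measure p) (measure_pmf (bernoulli_pmf p)) (\<lambda>w. w i))"
    by (rule integral_distr[symmetric]) (auto simp: bernoulli_measure_def)
  also have "distr (bernoulli_measure p) (measure_pmf (bernoulli_pmf p)) (\<lambda>w. w i)
     = measure_pmf (bernoulli_pmf p)"
    unfolding bernoulli_measure_def
    by (rule distr_PiM_component) (auto intro: measure_pmf.prob_space_axioms)
  also have "(\<integral>x. h x \<partial>measure_pmf (bernoulli_pmf p)) = of_real p * h True + of_real (1 - p) * h False"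
    using assms by (simp add: integral_measure_pmf[of UNIV] UNIV_bool scaleR_conv_of_real)
  finally show ?thesis .
qed

text \<open>Averages over coordinate 0 alone. With all other coordinates frozen it is a Bernoulli
  symbol, and invariance under \<open>unshift\<close> turns overwriting coordinate 0 into
  \<open>prepend\<close>.\<close>

lemma integral_prepend:
  fixes f :: "symb_seq \<Rightarrow> complex"
  assumes p: "0 < p" "p < 1"
    and [measurable]: "f \<in> seq_meas" and b: "\<And>w. norm (f w) \<le> K"
  shows "(\<integral>w. f w \<partial>bernoulli_measure p)
    = (\<integral>w. of_real p * f (prepend True w) + of_real (1 - p) * f (prepend False w) \<partial>bernoulli_measure p)"
proof -
  let ?mu = "bernoulli_measure p"
  have upd: "fun_upd (unshift w) 0 a = prepend a w" for w a
    by (auto simp: unshift_def prepend_def)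
  have "(\<integral>w. f w \<partial>?mu) = (\<integral>\<eta>. (\<integral>w. f (mix (- {0}) \<eta> w) \<partial>?mu) \<partial>?mu)"
    by (rule integral_mix) (use b in auto)
  also have "(\<lambda>\<eta>. (\<integral>w. f (mix (- {0}) \<eta> w) \<partial>?mu))
      = (\<lambda>\<eta>. of_real p * f (fun_upd \<eta> 0 True) + of_real (1 - p) * f (fun_upd \<eta> 0 False))"
  proof
    fix \<eta>
    have "mix (- {0}) \<eta> w = fun_upd \<eta> 0 (w 0)" for w by (auto simp: mix_def)
    then show "(\<integral>w. f (mix (- {0}) \<eta> w) \<partial>?mu)
      = of_real p * f (fun_upd \<eta> 0 True) + of_real (1 - p) * f (fun_upd \<eta> 0 False)"
      using integral_coord[OF p, of "\<lambda>a. f (fun_upd \<eta> 0 a)" 0] by simp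
  qed
  also have "(\<integral>\<eta>. of_real p * f (fun_upd \<eta> 0 True) + of_real (1 - p) * f (fun_upd \<eta> 0 False) \<partial>?mu)
     = (\<integral>\<eta>. of_real p * f (fun_upd (unshift \<eta>) 0 True) + of_real (1 - p) * f (fun_upd (unshift \<eta>) 0 False) \<partial>?mu)"
    by (rule integral_unshift[symmetric]) measurable
  finally show ?thesis by (simp add: upd)
qed

section \<open>Transfer operators\<close>

definition fut_dep :: "(symb_seq \<Rightarrow> 'b) \<Rightarrow> bool" where
  "fut_dep f \<longleftrightarrow> (\<forall>w w'. (\<forall>i\<ge>0. w i = w' i) \<longrightarrow> f w = f w')"

lemma fut_depD: "fut_dep f \<Longrightarrow> (\<And>i. i \<ge> 0 \<Longrightarrow> w i = w' i) \<Longrightarrow> f w = f w'"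
  by (auto simp: fut_dep_def)

lemma norm_cis_diff_le: "norm (cis a - cis b) \<le> \<bar>a - b\<bar>"
proof -
  have "cis a - cis b = cis b * (cis (a - b) - 1)"
    by (simp add: algebra_simps cis_mult)
  moreover have "norm (cis (a - b) - 1) \<le> \<bar>a - b\<bar>"
    using iexp_approx1[of "a - b" 0] by (simp add: cis_conv_exp)
  ultimately show ?thesis by (simp add: norm_mult)
qed

text \<open>Strict convexity of the disc, read off from the identity for the squared norm of the
  combination: the defect is exactly \<open>p * (1 - p)\<close> times the squared distance of the
  two points.\<close>

lemma convex_combination_unit:
  fixes z1 z2 :: complex
  assumes "0 < p" "p < 1" "norm z1 \<le> 1" "norm z2 \<le> 1"
    and one: "norm (of_real p * z1 + of_real (1 - p) * z2) = 1"
  shows "z1 = z2"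
proof -
  let ?z = "of_real p * z1 + of_real (1 - p) * z2"
  have id: "(norm ?z)\<^sup>2 = p * (norm z1)\<^sup>2 + (1 - p) * (norm z2)\<^sup>2 - p * (1 - p) * (norm (z1 - z2))\<^sup>2"
    unfolding cmod_power2 by (simp add: algebra_simps power2_eq_square)
  have "(norm z1)\<^sup>2 \<le> 1" "(norm z2)\<^sup>2 \<le> 1"
    using assms by (auto simp: power_le_one)
  then have "p * (norm z1)\<^sup>2 + (1 - p) * (norm z2)\<^sup>2 \<le> p * 1 + (1 - p) * 1"
    using assms by (intro add_mono mult_left_mono) auto
  with id one have "p * (1 - p) * (norm (z1 - z2))\<^sup>2 \<le> 0" by simp
  moreover have "0 < p * (1 - p)" using assms by simp
  ultimately have "(norm (z1 - z2))\<^sup>2 \<le> 0" using mult_le_0_iff not_less by blast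
  then show ?thesis by simp
qed

lemma measurable_cis [measurable]:
  "f \<in> borel_measurable M \<Longrightarrow> (\<lambda>x. cis (f x)) \<in> borel_measurable M"
  unfolding cis_conv_exp by measurable

lemma measurable_birkhoff_sum [measurable]:
  assumes [measurable]: "f \<in> seq_meas"
  shows "birkhoff_sum f n \<in> seq_meas"
  unfolding birkhoff_sum_def[abs_def] by measurable

lemma birkhoff_sum_Suc': "birkhoff_sum f (Suc n) w = f w + birkhoff_sum f n (shift w)"
  unfolding birkhoff_sum_def sum.lessThan_Suc_shift by (simp add: funpow_swap1)

section \<open>Hoelder functions of the future: compactness and the transfer operator\<close>

locale bernoulli_shift =
  fixes \<kappa> p :: real
  assumes \<kappa>: "0 < \<kappa>" "\<kappa> < 1" and p: "0 < p" "p < 1"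
begin

abbreviation \<mu> :: "symb_seq measure" where
  "\<mu> \<equiv> bernoulli_measure p"

text \<open>The case \<open>N = 0\<close> bounds the total oscillation by \<open>K\<close>; all
  \<open>N\<close> together force \<open>f\<close> to ignore the negative coordinates.\<close>

definition fut_hoelder :: "real \<Rightarrow> (symb_seq \<Rightarrow> 'b::real_normed_vector) \<Rightarrow> bool" where
  "fut_hoelder K f \<longleftrightarrow>
    (\<forall>N w w'. (\<forall>i. 0 \<le> i \<and> i < int N \<longrightarrow> w i = w' i) \<longrightarrow> norm (f w - f w') \<le> K * \<kappa> ^ N)"

lemma fut_hoelderI:
  "(\<And>N w w'. (\<And>i. 0 \<le> i \<Longrightarrow> i < int N \<Longrightarrow> w i = w' i) \<Longrightarrow> norm (f w - f w') \<le> K * \<kappa> ^ N) \<Longrightarrow> fut_hoelder K f"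
  unfolding fut_hoelder_def by blast

lemma fut_hoelderD:
  "fut_hoelder K f \<Longrightarrow> (\<And>i. 0 \<le> i \<Longrightarrow> i < int N \<Longrightarrow> w i = w' i) \<Longrightarrow> norm (f w - f w') \<le> K * \<kappa> ^ N"
  unfolding fut_hoelder_def by blast

lemma fut_hoelder_mono: "fut_hoelder K f \<Longrightarrow> K \<le> L \<Longrightarrow> fut_hoelder L f"
proof (rule fut_hoelderI)
  fix N and w w' :: symb_seq
  assume "fut_hoelder K f" "K \<le> L" and eq: "\<And>i. 0 \<le> i \<Longrightarrow> i < int N \<Longrightarrow> w i = w' i"
  have "norm (f w - f w') \<le> K * \<kappa> ^ N" by (rule fut_hoelderD[OF \<open>fut_hoelder K f\<close> eq])
  also have "\<dots> \<le> L * \<kappa> ^ N" using \<open>K \<le> L\<close> \<kappa> by (intro mult_right_mono) auto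
  finally show "norm (f w - f w') \<le> L * \<kappa> ^ N" .
qed

lemma \<kappa>_pow_lim: "(\<lambda>N. K * \<kappa> ^ N) \<longlonglongrightarrow> 0"
  using \<kappa> by (auto intro!: tendsto_mult_right_zero LIMSEQ_realpow_zero)

lemma \<kappa>_small: "0 < e \<Longrightarrow> \<exists>N. K * \<kappa> ^ N < e"
  using order_tendstoD(2)[OF \<kappa>_pow_lim, of e K] by (auto simp: eventually_sequentially)

lemma fut_hoelder_fut: "fut_hoelder K f \<Longrightarrow> fut_dep f"
  unfolding fut_dep_def
proof safe
  fix w w' :: symb_seq assume f: "fut_hoelder K f" and eq: "\<forall>i\<ge>0. w i = w' i"
  have "norm (f w - f w') \<le> K * \<kappa> ^ N" for N
    by (rule fut_hoelderD[OF f]) (use eq in auto)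
  then have "norm (f w - f w') \<le> 0"
    by (intro LIMSEQ_le_const[OF \<kappa>_pow_lim]) auto
  then show "f w = f w'" by simp
qed

text \<open>Arzela-Ascoli. A diagonal subsequence converges on the countable set \<open>S\<close> of
  finitely supported sequences. At scale \<open>N\<close> only finitely many truncations
  \<open>tr N w\<close> occur, and the common Hoelder bound compares each \<open>w\<close> with its
  truncation, so the convergence is uniform.\<close>

lemma fut_hoelder_compact:
  fixes f :: "nat \<Rightarrow> symb_seq \<Rightarrow> complex"
  assumes f: "\<And>n. fut_hoelder K (f n)" and bd: "\<And>n w. norm (f n w) \<le> M"
  obtains k g where "strict_mono (k :: nat \<Rightarrow> nat)" "fut_hoelder K g" "\<And>w. norm (g w) \<le> M"
    "uniform_limit UNIV (\<lambda>n. f (k n)) g sequentially"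
proof -
  define S :: "symb_seq set" where "S = (\<lambda>A i. i \<in> A) ` Collect finite"
  define tr :: "nat \<Rightarrow> symb_seq \<Rightarrow> symb_seq" where "tr N w = (\<lambda>i. 0 \<le> i \<and> i < int N \<and> w i)" for N w
  have tr_in: "range (tr N) \<subseteq> (\<lambda>A i. i \<in> A) ` Pow {0..<int N}" for N
  proof
    fix x assume "x \<in> range (tr N)"
    then obtain w where "x = tr N w" by auto
    then have "x = (\<lambda>i. i \<in> {i. 0 \<le> i \<and> i < int N \<and> w i})" by (simp add: tr_def)
    moreover have "{i. 0 \<le> i \<and> i < int N \<and> w i} \<in> Pow {0..<int N}" by auto
    ultimately show "x \<in> (\<lambda>A i. i \<in> A) ` Pow {0..<int N}" by (rule image_eqI)
  qed
  have trS: "tr N w \<in> S" for N w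
  proof -
    have "tr N w \<in> (\<lambda>A i. i \<in> A) ` Pow {0..<int N}" using tr_in by blast
    moreover have "Pow {0..<int N} \<subseteq> Collect finite" using finite_subset by auto
    ultimately show ?thesis unfolding S_def by blast
  qed
  have "countable S" unfolding S_def by (intro countable_image countable_Collect_finite)
  then obtain k where k: "strict_mono k" and lim: "\<And>x. x \<in> S \<Longrightarrow> \<exists>l. (\<lambda>n. f (k n) x) \<longlonglongrightarrow> l"
    using function_convergent_subsequence[of S f M] bd by blast
  have "uniformly_Cauchy_on UNIV (\<lambda>n. f (k n))"
  proof (rule uniformly_Cauchy_onI)
    fix e :: real assume "0 < e"
    obtain N where N: "K * \<kappa> ^ N < e / 3" using \<kappa>_small[of "e/3" K] \<open>0 < e\<close> by auto
    have fin: "finite (range (tr N))" using tr_in by (rule finite_subset) auto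
    have "\<forall>x\<in>range (tr N). \<exists>n0. \<forall>m\<ge>n0. \<forall>n\<ge>n0. dist (f (k m) x) (f (k n) x) < e / 3"
    proof
      fix x assume "x \<in> range (tr N)"
      then have "Cauchy (\<lambda>n. f (k n) x)" using lim trS convergent_Cauchy unfolding convergent_def by blast
      then show "\<exists>n0. \<forall>m\<ge>n0. \<forall>n\<ge>n0. dist (f (k m) x) (f (k n) x) < e / 3"
        using \<open>0 < e\<close> unfolding Cauchy_def by (meson divide_pos_pos zero_less_numeral)
    qed
    then obtain n0 where n0: "\<And>x. x \<in> range (tr N) \<Longrightarrow> \<forall>m\<ge>n0 x. \<forall>n\<ge>n0 x. dist (f (k m) x) (f (k n) x) < e / 3"
      by metis
    define n1 where "n1 = Max (n0 ` range (tr N))"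
    have n1: "n0 (tr N w) \<le> n1" for w unfolding n1_def using fin by (intro Max_ge) auto
    have near: "dist (f n w) (f n (tr N w)) < e / 3" for n w
      using fut_hoelderD[OF f, of N w "tr N w" n] N by (auto simp: tr_def dist_norm)
    have "dist (f (k m) w) (f (k n) w) < e" if "m \<ge> n1" "n \<ge> n1" for m n w
    proof -
      have "dist (f (k m) (tr N w)) (f (k n) (tr N w)) < e / 3"
        using n0[of "tr N w"] n1[of w] that by auto
      with near[of "k m" w] near[of "k n" w] show ?thesis
        by (metis dist_commute dist_triangle_third)
    qed
    then show "\<exists>M. \<forall>x\<in>UNIV. \<forall>m\<ge>M. \<forall>n\<ge>M. dist (f (k m) x) (f (k n) x) < e" by blast
  qed
  then obtain g where g: "uniform_limit UNIV (\<lambda>n. f (k n)) g sequentially"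
    using Cauchy_uniformly_convergent uniformly_convergent_on_def by blast
  then have pt: "(\<lambda>n. f (k n) w) \<longlonglongrightarrow> g w" for w
    by (rule tendsto_uniform_limitI) simp
  have "fut_hoelder K g"
  proof (rule fut_hoelderI)
    fix N and w w' :: symb_seq assume eq: "\<And>i. 0 \<le> i \<Longrightarrow> i < int N \<Longrightarrow> w i = w' i"
    have "(\<lambda>n. norm (f (k n) w - f (k n) w')) \<longlonglongrightarrow> norm (g w - g w')"
      by (intro tendsto_intros pt)
    then show "norm (g w - g w') \<le> K * \<kappa> ^ N"
      by (rule LIMSEQ_le_const2) (use fut_hoelderD[OF f] eq in blast)
  qed
  moreover have "norm (g w) \<le> M" for w
    using LIMSEQ_le_const2[OF tendsto_norm[OF pt[of w]], of M] bd by blast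
  ultimately show thesis by (intro that[OF k _ _ g])
qed

text \<open>
  \<open>prepend a w\<close> puts the symbol \<open>a\<close> in front of the future of \<open>w\<close>, so on functions of the future
  \<open>transfer b\<close> is the adjoint of \<open>g \<mapsto> e\<^sup>i\<^sup>b (g \<circ> shift)\<close>.
\<close>

definition transfer :: "(symb_seq \<Rightarrow> real) \<Rightarrow> (symb_seq \<Rightarrow> complex) \<Rightarrow> symb_seq \<Rightarrow> complex" where
  "transfer b f w = of_real p * (cis (b (prepend True w)) * f (prepend True w))
     + of_real (1 - p) * (cis (b (prepend False w)) * f (prepend False w))"

lemma norm_combination_le:
  assumes "norm z1 \<le> x" "norm (z2 :: complex) \<le> y"
  shows "norm (of_real p * z1 + of_real (1 - p) * z2) \<le> p * x + (1 - p) * y"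
proof -
  have "norm (of_real p * z1 + of_real (1 - p) * z2) \<le> p * norm z1 + (1 - p) * norm z2"
  proof -
    have "norm (of_real p * z1) = p * norm z1" "norm (of_real (1 - p) * z2) = (1 - p) * norm z2"
      using p unfolding norm_mult norm_of_real by auto
    then show ?thesis using norm_triangle_ineq[of "of_real p * z1" "of_real (1 - p) * z2"] by linarith
  qed
  also have "\<dots> \<le> p * x + (1 - p) * y"
    using assms p by (intro add_mono mult_left_mono) auto
  finally show ?thesis .
qed

lemma transfer_bound: "(\<And>w. norm (f w) \<le> M) \<Longrightarrow> norm (transfer b f w) \<le> M"
  unfolding transfer_def using norm_combination_le[of "cis (b (prepend True w)) * f (prepend True w)" M
      "cis (b (prepend False w)) * f (prepend False w)" M]
  by (simp add: norm_mult algebra_simps)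

lemma transfer_funpow_bound: "(\<And>w. norm (f w) \<le> M) \<Longrightarrow> norm ((transfer b ^^ n) f w) \<le> M"
  by (induction n arbitrary: w) (auto intro: transfer_bound)

lemma transfer_diff: "transfer b f w - transfer b g w = transfer b (\<lambda>w. f w - g w) w"
  by (simp add: transfer_def algebra_simps)

lemma transfer_funpow_diff:
  "(transfer b ^^ n) f w - (transfer b ^^ n) g w = (transfer b ^^ n) (\<lambda>w. f w - g w) w"
  by (induction n arbitrary: w) (auto simp: transfer_diff)

lemma measurable_transfer:
  assumes [measurable]: "b \<in> seq_meas" "f \<in> seq_meas"
  shows "transfer b f \<in> seq_meas"
  unfolding transfer_def[abs_def] by measurable

text \<open>Of the \<open>2 ^ N\<close> branches that put \<open>N\<close> symbols in front of
  \<open>y\<close>, the one spelling the first \<open>N\<close> symbols of \<open>x\<close> lands in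
  the cylinder, and its weight is at least \<open>min p (1 - p) ^ N\<close>. A local defect of
  modulus thus spreads to all points. In the induction one application of \<open>transfer\<close>
  shortens the cylinder by one symbol and multiplies the defect by \<open>?q\<close>.\<close>

lemma transfer_cylinder:
  assumes "\<And>w. norm (f w) \<le> 1" "0 \<le> \<delta>"
    and "\<And>w. (\<And>i. 0 \<le> i \<Longrightarrow> i < int N \<Longrightarrow> w i = x i) \<Longrightarrow> norm (f w) \<le> 1 - \<delta>"
  shows "norm ((transfer b ^^ N) f y) \<le> 1 - min p (1 - p) ^ N * \<delta>"
  using assms
proof (induction N arbitrary: f x \<delta>)
  case 0
  then show ?case by simp
next
  case (Suc N)
  let ?q = "min p (1 - p)"
  have "norm (transfer b f w) \<le> 1 - ?q * \<delta>" if eq: "\<And>i. 0 \<le> i \<Longrightarrow> i < int N \<Longrightarrow> w i = shift x i" for w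
  proof -
    have "prepend (x 0) w i = x i" if "0 \<le> i" "i < int (Suc N)" for i
      using eq[of "i - 1"] that by (auto simp: prepend_def shift_def)
    then have small: "norm (f (prepend (x 0) w)) \<le> 1 - \<delta>" by (rule Suc.prems(3))
    have q: "?q * \<delta> \<le> p * \<delta>" "?q * \<delta> \<le> (1 - p) * \<delta>" using Suc.prems(2) by (auto intro!: mult_right_mono)
    show ?thesis
    proof (cases "x 0")
      case True
      then have "norm (transfer b f w) \<le> p * (1 - \<delta>) + (1 - p) * 1"
        unfolding transfer_def using small Suc.prems(1)
        by (intro norm_combination_le) (auto simp: norm_mult)
      with q show ?thesis by (simp add: algebra_simps)
    next
      case False
      then have "norm (transfer b f w) \<le> p * 1 + (1 - p) * (1 - \<delta>)"
        unfolding transfer_def using small Suc.prems(1)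
        by (intro norm_combination_le) (auto simp: norm_mult)
      with q show ?thesis by (simp add: algebra_simps)
    qed
  qed
  moreover have "norm (transfer b f w) \<le> 1" for w using Suc.prems(1) by (rule transfer_bound)
  moreover have "0 \<le> ?q * \<delta>" using p Suc.prems(2) by simp
  ultimately have "norm ((transfer b ^^ N) (transfer b f) y) \<le> 1 - ?q ^ N * (?q * \<delta>)"
    by (intro Suc.IH[of "transfer b f" "?q * \<delta>" "shift x"]) auto
  then show ?case by (simp add: funpow_swap1 mult.assoc mult.left_commute)
qed

end

section \<open>Exponential decay of the twisted transfer operator\<close>

locale future_phase = bernoulli_shift +
  fixes b :: "symb_seq \<Rightarrow> real" and D :: real
  assumes b_fut: "fut_dep b"
    and b_var: "\<And>N w w'. (\<And>i. 0 \<le> i \<Longrightarrow> i < int (Suc N) \<Longrightarrow> w i = w' i) \<Longrightarrow> \<bar>b w - b w'\<bar> \<le> D * \<kappa> ^ N"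
    and b_meas [measurable]: "b \<in> seq_meas"
begin

abbreviation "T \<equiv> transfer b"

lemma D_nonneg: "0 \<le> D"
  using b_var[of 0 undefined undefined] by simp

text \<open>A Lasota-Yorke (Doeblin-Fortet) inequality. \<open>prepend\<close> adds one agreeing
  coordinate: for \<open>f\<close> this yields the contraction \<open>\<kappa> * K\<close>, for the
  phase it makes up for the \<open>Suc N\<close> in \<open>b_var\<close> and leaves
  \<open>D * M\<close>.\<close>

lemma transfer_fut_hoelder:
  assumes f: "fut_hoelder K f" and M: "\<And>w. norm (f w) \<le> M"
  shows "fut_hoelder (\<kappa> * K + D * M) (T f)"
proof (rule fut_hoelderI)
  fix N and w w' :: symb_seq assume eq: "\<And>i. 0 \<le> i \<Longrightarrow> i < int N \<Longrightarrow> w i = w' i"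
  let ?g = "\<lambda>a w. cis (b (prepend a w)) * f (prepend a w)"
  have M0: "0 \<le> M" using M[of undefined] norm_ge_zero order_trans by blast
  have d: "norm (?g a w - ?g a w') \<le> (\<kappa> * K + D * M) * \<kappa> ^ N" for a
  proof -
    have e: "prepend a w i = prepend a w' i" if "0 \<le> i" "i < int (Suc N)" for i
      using eq[of "i - 1"] that by (auto simp: prepend_def)
    have "?g a w - ?g a w' = cis (b (prepend a w)) * (f (prepend a w) - f (prepend a w'))
        + (cis (b (prepend a w)) - cis (b (prepend a w'))) * f (prepend a w')"
      by (simp add: algebra_simps)
    then have "norm (?g a w - ?g a w') \<le> norm (f (prepend a w) - f (prepend a w'))
        + norm (cis (b (prepend a w)) - cis (b (prepend a w'))) * norm (f (prepend a w'))"
      by (metis norm_triangle_ineq norm_mult norm_cis mult_1)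
    also have "\<dots> \<le> K * \<kappa> ^ Suc N + (D * \<kappa> ^ N) * M"
    proof (intro add_mono mult_mono M)
      show "norm (f (prepend a w) - f (prepend a w')) \<le> K * \<kappa> ^ Suc N" by (rule fut_hoelderD[OF f e])
      show "norm (cis (b (prepend a w)) - cis (b (prepend a w'))) \<le> D * \<kappa> ^ N"
        using norm_cis_diff_le b_var[OF e] by (rule order_trans)
    qed (use D_nonneg \<kappa> in auto)
    finally show ?thesis by (simp add: algebra_simps)
  qed
  have "T f w - T f w' = of_real p * (?g True w - ?g True w') + of_real (1 - p) * (?g False w - ?g False w')"
    by (simp add: transfer_def algebra_simps)
  also have "norm \<dots> \<le> p * ((\<kappa> * K + D * M) * \<kappa> ^ N) + (1 - p) * ((\<kappa> * K + D * M) * \<kappa> ^ N)"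
    by (intro norm_combination_le d)
  finally show "norm (T f w - T f w') \<le> (\<kappa> * K + D * M) * \<kappa> ^ N" by (simp add: algebra_simps)
qed

text \<open>\<open>D / (1 - \<kappa>)\<close> is the fixed point of
  \<open>K \<mapsto> \<kappa> * K + D\<close>, so every larger constant gives an invariant ball. The
  summand 1 ensures \<open>K0 \<ge> 1\<close>, so that a function with sup norm and Hoelder constant
  at most \<open>K\<close> lies in the ball of size \<open>K\<close>.\<close>

definition "K0 = 2 * D / (1 - \<kappa>) + 1"

lemma K0_ge1: "1 \<le> K0"
  using D_nonneg \<kappa> by (auto simp: K0_def)

lemma K0_D: "D \<le> K0 * (1 - \<kappa>) / 2"
proof -
  have "K0 * (1 - \<kappa>) = 2 * D + (1 - \<kappa>)"
    using \<kappa> by (simp add: K0_def distrib_right)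
  then show ?thesis using \<kappa> by simp
qed

definition inv_ball :: "real \<Rightarrow> (symb_seq \<Rightarrow> complex) \<Rightarrow> bool" where
  "inv_ball M f \<longleftrightarrow> (\<forall>w. norm (f w) \<le> M) \<and> fut_hoelder (K0 * M) f"

lemma inv_ball_nonneg: "inv_ball M f \<Longrightarrow> 0 \<le> M"
  unfolding inv_ball_def using norm_ge_zero order_trans by blast

lemma inv_ball_transfer: "inv_ball M f \<Longrightarrow> inv_ball M (T f)"
proof -
  assume f: "inv_ball M f"
  have "\<kappa> * (K0 * M) + D * M = M * (\<kappa> * K0 + D)" by (simp add: algebra_simps)
  also have "\<dots> \<le> M * (\<kappa> * K0 + K0 * (1 - \<kappa>))"
    using inv_ball_nonneg[OF f] K0_D D_nonneg \<kappa> by (intro mult_left_mono add_mono) auto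
  finally have "\<kappa> * (K0 * M) + D * M \<le> K0 * M" by (simp add: algebra_simps)
  then show ?thesis using f unfolding inv_ball_def by (blast intro: transfer_bound fut_hoelder_mono transfer_fut_hoelder)
qed

lemma inv_ball_transfer_funpow: "inv_ball M f \<Longrightarrow> inv_ball M ((T ^^ n) f)"
  by (induction n) (auto intro: inv_ball_transfer)

text \<open>
  Once the sup norm has dropped to \<open>M'\<close>, further iterates also bring the Hoelder constant down,
  to about half of \<open>K0 * M'\<close>; the factor 2 in \<open>K0\<close> leaves room for this.
\<close>

lemma inv_ball_refine:
  assumes "\<And>w. norm (f w) \<le> M'" "fut_hoelder (K0 * M) f" "0 \<le> M"
  shows "fut_hoelder (K0 * (M' / 2 + \<kappa> ^ j * M)) ((T ^^ j) f)"
proof (induction j)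
  case 0
  have "0 \<le> M'" using assms(1)[of undefined] norm_ge_zero order_trans by blast
  then show ?case using fut_hoelder_mono[OF assms(2)] K0_ge1 by (simp add: mult_left_mono)
next
  case (Suc j)
  have M': "0 \<le> M'" using assms(1)[of undefined] norm_ge_zero order_trans by blast
  have "D * M' \<le> (K0 * (1 - \<kappa>) / 2) * M'" using K0_D M' by (rule mult_right_mono)
  then have "\<kappa> * (K0 * (M' / 2 + \<kappa> ^ j * M)) + D * M' \<le> K0 * (M' / 2 + \<kappa> ^ Suc j * M)"
    by (simp add: field_simps)
  then show ?case using transfer_fut_hoelder[OF Suc transfer_funpow_bound[OF assms(1)]] fut_hoelder_mono by auto
qed

text \<open>If some iterate had modulus below 1 at one point, the Hoelder bound would keep half of
  this defect on a cylinder, and \<open>transfer_cylinder\<close> would spread it to the whole space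
  a few iterates later, against \<open>one\<close>.\<close>

lemma unimodular_invariant:
  assumes g: "inv_ball 1 g" and one: "\<And>j e. 0 < e \<Longrightarrow> \<exists>w. norm ((T ^^ j) g w) > 1 - e"
  shows "norm ((T ^^ k) g x) = 1"
proof (rule ccontr)
  assume ne: "norm ((T ^^ k) g x) \<noteq> 1"
  have c: "inv_ball 1 ((T ^^ k) g)" using g by (rule inv_ball_transfer_funpow)
  define \<delta> where "\<delta> = (1 - norm ((T ^^ k) g x)) / 2"
  have \<delta>: "\<delta> > 0" using ne c by (auto simp: \<delta>_def inv_ball_def le_less)
  obtain N where N: "K0 * 1 * \<kappa> ^ N < \<delta>" using \<kappa>_small[OF \<delta>] by blast
  have "norm ((T ^^ k) g w) \<le> 1 - \<delta>" if "\<And>i. 0 \<le> i \<Longrightarrow> i < int N \<Longrightarrow> w i = x i" for w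
  proof -
    have "norm ((T ^^ k) g w - (T ^^ k) g x) \<le> K0 * 1 * \<kappa> ^ N"
      using c that unfolding inv_ball_def by (blast intro: fut_hoelderD)
    then have "norm ((T ^^ k) g w) \<le> norm ((T ^^ k) g x) + \<delta>"
      using N norm_triangle_ineq2[of "(T ^^ k) g w" "(T ^^ k) g x"] by linarith
    then show ?thesis by (simp add: \<delta>_def field_simps)
  qed
  then have "norm ((T ^^ N) ((T ^^ k) g) y) \<le> 1 - min p (1 - p) ^ N * \<delta>" for y
    using c \<delta> by (intro transfer_cylinder[of _ _ _ x]) (auto simp: inv_ball_def)
  then have "norm ((T ^^ (N + k)) g y) \<le> 1 - min p (1 - p) ^ N * \<delta>" for y
    by (simp add: funpow_add)
  moreover have "0 < min p (1 - p) ^ N * \<delta>" using p \<delta> by simp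
  ultimately show False using one[of "min p (1 - p) ^ N * \<delta>" "N + k"] by (meson not_less)
qed

text \<open>
  If all iterates \<open>g\<^sub>k = T\<^sup>k g\<close> are unimodular, every average in \<open>T\<close> is over equal terms, so
  \<open>e\<^sup>i\<^sup>b g\<^sub>k = g\<^sub>k\<^sub>+\<^sub>1 \<circ> shift\<close>. Then \<open>h\<^sub>k = g\<^sub>k\<^sub>+\<^sub>1 cnj(g\<^sub>k)\<close> satisfies \<open>h\<^sub>0 = h\<^sub>N \<circ> shift\<^sup>N\<close> for all \<open>N\<close>, hence
  ignores every finite set of coordinates and, being continuous, is a constant \<open>\<nu>\<close>.
\<close>

lemma unimodular_solution:
  assumes g: "inv_ball 1 g" and one: "\<And>k x. norm ((T ^^ k) g x) = 1"
  shows "\<exists>\<nu>. norm \<nu> = 1 \<and> (\<forall>w. \<nu> * g (shift w) = cis (b w) * g w)"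
proof -
  define f where "f k = (T ^^ k) g" for k
  have f1: "norm (f k x) = 1" for k x using one by (simp add: f_def)
  have f0: "f 0 = g" by (simp add: f_def)
  have fcl: "inv_ball 1 (f k)" for k unfolding f_def using g by (rule inv_ball_transfer_funpow)
  have prepend_id: "prepend (w 0) (shift w) = w" for w by (auto simp: prepend_def shift_def)
  have step: "f (Suc k) (shift w) = cis (b w) * f k w" for k w
  proof -
    let ?z = "\<lambda>a. cis (b (prepend a (shift w))) * f k (prepend a (shift w))"
    have e: "f (Suc k) (shift w) = of_real p * ?z True + of_real (1 - p) * ?z False"
      by (simp add: f_def transfer_def)
    have "?z True = ?z False"
    proof (rule convex_combination_unit[of p])
      show "norm (of_real p * ?z True + of_real (1 - p) * ?z False) = 1"
        using f1[of "Suc k" "shift w"] unfolding e .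
    qed (use p f1 in \<open>auto simp: norm_mult\<close>)
    then have "f (Suc k) (shift w) = ?z (w 0)"
      unfolding e by (cases "w 0") (simp_all add: algebra_simps)
    then show ?thesis by (simp add: prepend_id)
  qed
  define h where "h k w = f (Suc k) w * cnj (f k w)" for k w
  have unit: "z * cnj z = 1" if "norm z = 1" for z
    using that complex_norm_square[of z] by simp
  have hshift: "h (Suc k) (shift w) = h k w" for k w
  proof -
    have "h (Suc k) (shift w) = (cis (b w) * cnj (cis (b w))) * h k w"
      by (simp add: h_def step)
    then show ?thesis using unit[of "cis (b w)"] by simp
  qed
  have hpow: "h N ((shift ^^ N) w) = h 0 w" for N w
    by (induction N) (auto simp: hshift)
  have hfut: "fut_dep (h k)" for k
    using fcl[of k] fcl[of "Suc k"] fut_hoelder_fut unfolding inv_ball_def fut_dep_def h_def by metis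
  have hvar: "norm (h 0 w - h 0 w') \<le> 2 * K0 * \<kappa> ^ N"
    if eq: "\<And>i. 0 \<le> i \<Longrightarrow> i < int N \<Longrightarrow> w i = w' i" for N w w'
  proof -
    have "h 0 w - h 0 w' = f 1 w * cnj (f 0 w - f 0 w') + (f 1 w - f 1 w') * cnj (f 0 w')"
      by (simp add: h_def algebra_simps)
    then have "norm (h 0 w - h 0 w') \<le> norm (f 0 w - f 0 w') + norm (f 1 w - f 1 w')"
      using norm_triangle_ineq[of "f 1 w * cnj (f 0 w - f 0 w')" "(f 1 w - f 1 w') * cnj (f 0 w')"]
      by (simp add: norm_mult f1 del: complex_cnj_diff)
    also have "\<dots> \<le> K0 * 1 * \<kappa> ^ N + K0 * 1 * \<kappa> ^ N"
      using fcl[of 0] fcl[of 1] eq unfolding inv_ball_def by (intro add_mono fut_hoelderD) auto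
    finally show ?thesis by (simp add: mult_ac)
  qed
  have hconst: "h 0 w = h 0 w'" for w w'
  proof -
    have "norm (h 0 w - h 0 w') \<le> 2 * K0 * \<kappa> ^ N" for N
    proof -
      define v where "v = mix {..<int N} w w'"
      have "h 0 v = h N ((shift ^^ N) v)" by (simp add: hpow)
      also have "\<dots> = h N ((shift ^^ N) w')"
        by (rule fut_depD[OF hfut]) (auto simp: shift_funpow v_def mix_def)
      finally have "h 0 v = h 0 w'" by (simp add: hpow)
      moreover have "norm (h 0 w - h 0 v) \<le> 2 * K0 * \<kappa> ^ N"
        by (rule hvar) (auto simp: v_def mix_def)
      ultimately show ?thesis by simp
    qed
    then have "norm (h 0 w - h 0 w') \<le> 0" by (intro LIMSEQ_le_const[OF \<kappa>_pow_lim]) auto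
    then show ?thesis by simp
  qed
  define \<nu> where "\<nu> = h 0 undefined"
  have "norm \<nu> = 1" by (simp add: \<nu>_def h_def norm_mult f1)
  moreover have "\<nu> * g (shift w) = cis (b w) * g w" for w
  proof -
    have "\<nu> * g (shift w) = h 0 (shift w) * f 0 (shift w)" unfolding \<nu>_def f0 using hconst by metis
    also have "\<dots> = f 1 (shift w) * (f 0 (shift w) * cnj (f 0 (shift w)))" by (simp add: h_def)
    also have "\<dots> = f (Suc 0) (shift w)" by (simp add: unit f1)
    also have "\<dots> = cis (b w) * g w" by (simp only: step f0)
    finally show ?thesis .
  qed
  ultimately show ?thesis by blast
qed

text \<open>Otherwise there are nearly extremal functions for every \<open>n\<close>. A uniform
  limit \<open>g\<close> of a subsequence has sup norm 1 for each fixed iterate, because sup norms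
  do not increase along the iteration and the index of the near-extremal iterate tends to
  infinity.\<close>

lemma transfer_contraction:
  assumes nosol: "\<nexists>\<nu> g. fut_hoelder K0 g \<and> (\<forall>w. norm (g w) = 1) \<and> norm \<nu> = 1 \<and>
      (\<forall>w. \<nu> * g (shift w) = cis (b w) * g w)"
  shows "\<exists>n \<rho>. 0 < \<rho> \<and> \<rho> < 1 \<and> (\<forall>f w. inv_ball 1 f \<longrightarrow> norm ((T ^^ n) f w) \<le> \<rho>)"
proof (rule ccontr)
  assume neg: "\<not> ?thesis"
  \<comment> \<open>The \<open>+ 2\<close> keeps the bound strictly between 0 and 1 already for
    \<open>n = 0\<close>, as the negated claim requires of its \<open>\<rho>\<close>.\<close>
  have "\<exists>f w. inv_ball 1 f \<and> norm ((T ^^ n) f w) > 1 - inverse (real (n + 2))" for n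
  proof -
    have "0 < 1 - inverse (real (n + 2))" "1 - inverse (real (n + 2)) < 1" by (auto simp: field_simps)
    then show ?thesis using neg by (meson not_less)
  qed
  then obtain f v where f: "\<And>n. inv_ball 1 (f n)"
      and v: "\<And>n. norm ((T ^^ n) (f n) (v n)) > 1 - inverse (real (n + 2))"
    by metis
  obtain k g where k: "strict_mono k" and g: "fut_hoelder (K0 * 1) g" "\<And>w. norm (g w) \<le> 1"
      and lim: "uniform_limit UNIV (\<lambda>n. f (k n)) g sequentially"
    using fut_hoelder_compact[of "K0 * 1" f 1] f unfolding inv_ball_def by metis
  have gcl: "inv_ball 1 g" using g by (simp add: inv_ball_def)
  have "\<exists>w. norm ((T ^^ j) g w) > 1 - e" if "0 < e" for j e
  proof (rule ccontr)
    assume "\<not> (\<exists>w. norm ((T ^^ j) g w) > 1 - e)"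
    then have le: "norm ((T ^^ j) g w) \<le> 1 - e" for w by (meson not_less)
    have "\<forall>\<^sub>F n in sequentially. \<forall>w. dist (f (k n) w) (g w) < e / 2"
      using lim \<open>0 < e\<close> by (auto simp: uniform_limit_iff dest: spec[of _ "e/2"])
    moreover have "\<forall>\<^sub>F n in sequentially. inverse (real (n + 2)) < e / 2"
      using \<open>0 < e\<close> by real_asymp
    moreover have "\<forall>\<^sub>F n in sequentially. n \<ge> j" by (rule eventually_ge_at_top)
    ultimately have "\<forall>\<^sub>F n in sequentially. (\<forall>w. dist (f (k n) w) (g w) < e / 2)
        \<and> inverse (real (n + 2)) < e / 2 \<and> n \<ge> j"
      by eventually_elim auto
    then obtain n where n: "\<And>w. dist (f (k n) w) (g w) < e / 2" "inverse (real (n + 2)) < e / 2" "n \<ge> j"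
      by (auto simp: eventually_sequentially)
    have kn: "k n \<ge> n" using k by (rule seq_suble)
    have "norm ((T ^^ j) (f (k n)) w) \<le> 1 - e / 2" for w
    proof -
      have "norm ((T ^^ j) (\<lambda>w. f (k n) w - g w) w) \<le> e / 2"
        using n(1) by (intro transfer_funpow_bound) (auto simp: dist_norm less_imp_le)
      then have "norm ((T ^^ j) (f (k n)) w - (T ^^ j) g w) \<le> e / 2"
        by (simp add: transfer_funpow_diff)
      with le[of w] show ?thesis
        using norm_triangle_ineq2[of "(T ^^ j) (f (k n)) w" "(T ^^ j) g w"] by linarith
    qed
    \<comment> \<open>The bound at time \<open>j\<close> persists to time
      \<open>k n \<ge> n \<ge> j\<close>, where the choice of \<open>v (k n)\<close> contradicts
      it.\<close>
    then have "norm ((T ^^ (k n - j)) ((T ^^ j) (f (k n))) (v (k n))) \<le> 1 - e / 2"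
      by (rule transfer_funpow_bound)
    then have "norm ((T ^^ k n) (f (k n)) (v (k n))) \<le> 1 - e / 2"
      using kn n(3) by (simp flip: funpow_add comp_apply[of "T ^^ (k n - j)"])
    moreover have "inverse (real (k n + 2)) \<le> inverse (real (n + 2))"
      using kn by (intro le_imp_inverse_le) auto
    ultimately show False using v[of "k n"] n(2) by linarith
  qed
  then have "norm ((T ^^ k) g x) = 1" for k x using unimodular_invariant[OF gcl] by blast
  note one = this
  obtain \<nu> where "norm \<nu> = 1" "\<And>w. \<nu> * g (shift w) = cis (b w) * g w"
    using unimodular_solution[OF gcl one] by blast
  moreover have "fut_hoelder K0 g" "norm (g w) = 1" for w using g(1) one[of 0] by auto
  ultimately show False using nosol by blast
qed

text \<open>The contraction lowers only the sup norm. To iterate it, the Hoelder constant has to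
  come down by the same factor, which \<open>inv_ball_refine\<close> achieves in \<open>j\<close>
  further steps.\<close>

lemma transfer_decay:
  assumes nosol: "\<nexists>\<nu> g. fut_hoelder K0 g \<and> (\<forall>w. norm (g w) = 1) \<and> norm \<nu> = 1 \<and>
      (\<forall>w. \<nu> * g (shift w) = cis (b w) * g w)"
  shows "\<exists>r C. 0 < r \<and> r < 1 \<and> 0 < C \<and>
    (\<forall>f K n w. (\<forall>w. norm (f w) \<le> K) \<longrightarrow> fut_hoelder K f \<longrightarrow> norm ((T ^^ n) f w) \<le> C * K * r ^ n)"
proof -
  obtain n0 \<rho> where \<rho>: "0 < \<rho>" "\<rho> < 1" and con: "\<And>f w. inv_ball 1 f \<Longrightarrow> norm ((T ^^ n0) f w) \<le> \<rho>"
    using transfer_contraction[OF nosol] by blast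
  have scale: "(T ^^ n) (\<lambda>w. c * f w) w = c * (T ^^ n) f w" for n f c w
    by (induction n arbitrary: w) (auto simp: transfer_def algebra_simps)
  have con': "norm ((T ^^ n0) f w) \<le> \<rho> * M" if f: "inv_ball M f" for f M w
  proof (cases "M = 0")
    case True
    then have "norm ((T ^^ n0) f w) \<le> 0" using f by (intro transfer_funpow_bound) (auto simp: inv_ball_def)
    then show ?thesis using True by simp
  next
    case False
    then have M: "M > 0" using inv_ball_nonneg[OF f] by simp
    have "fut_hoelder K0 (\<lambda>w. of_real (inverse M) * f w)"
    proof (rule fut_hoelderI)
      fix N and w w' :: symb_seq assume eq: "\<And>i. 0 \<le> i \<Longrightarrow> i < int N \<Longrightarrow> w i = w' i"
      have "norm (f w - f w') \<le> K0 * M * \<kappa> ^ N"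
        using f eq unfolding inv_ball_def by (blast intro: fut_hoelderD)
      then have "norm (f w - f w') / M \<le> K0 * \<kappa> ^ N"
        using M by (simp add: divide_le_eq mult_ac)
      also have "norm (f w - f w') / M = norm (of_real (inverse M) * f w - of_real (inverse M) * f w')"
        using M unfolding right_diff_distrib[symmetric] norm_mult norm_of_real by (simp add: divide_inverse)
      finally show "norm (of_real (inverse M) * f w - of_real (inverse M) * f w') \<le> K0 * \<kappa> ^ N" .
    qed
    moreover have "norm (of_real (inverse M) * f w) \<le> 1" for w
      using f M unfolding norm_mult norm_of_real inv_ball_def by (simp add: field_simps)
    ultimately have "inv_ball 1 (\<lambda>w. of_real (inverse M) * f w)" by (simp add: inv_ball_def)
    from con[OF this, of w] show ?thesis
      using M unfolding scale norm_mult norm_of_real by (simp add: field_simps)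
  qed
  \<comment> \<open>The refined Hoelder constant is at most \<open>K0 * M\<close> times
    \<open>\<rho> / 2 + \<kappa> ^ j\<close>, which is below \<open>(\<rho> + 1) / 2\<close> once
    \<open>\<kappa> ^ j < 1 / 2\<close>.\<close>
  define \<rho>' where "\<rho>' = (1 + \<rho>) / 2"
  have \<rho>': "0 < \<rho>'" "\<rho>' < 1" "\<rho> \<le> \<rho>'" using \<rho> by (auto simp: \<rho>'_def)
  obtain j where j: "1 * \<kappa> ^ j < 1 / 2" using \<kappa>_small[of "1/2" 1] by auto
  \<comment> \<open>The \<open>Suc\<close> guarantees a positive block length, of which a root is
    taken below.\<close>
  define n1 where "n1 = Suc (j + n0)"
  have step: "inv_ball (\<rho>' * M) ((T ^^ n1) f)" if f: "inv_ball M f" for f M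
  proof -
    let ?f = "(T ^^ n0) f"
    have M: "0 \<le> M" using f by (rule inv_ball_nonneg)
    have "inv_ball M ?f" using f by (rule inv_ball_transfer_funpow)
    then have "fut_hoelder (K0 * M) ?f" by (simp add: inv_ball_def)
    then have "fut_hoelder (K0 * (\<rho> * M / 2 + \<kappa> ^ j * M)) ((T ^^ j) ?f)"
      using con'[OF f] M by (intro inv_ball_refine)
    moreover have "\<rho> * M / 2 + \<kappa> ^ j * M \<le> \<rho> * M / 2 + (1 / 2) * M"
      using j M by (intro add_mono mult_right_mono) auto
    then have "K0 * (\<rho> * M / 2 + \<kappa> ^ j * M) \<le> K0 * (\<rho>' * M)"
      using K0_ge1 by (intro mult_left_mono) (auto simp: \<rho>'_def field_simps)
    ultimately have "fut_hoelder (K0 * (\<rho>' * M)) ((T ^^ j) ?f)" using fut_hoelder_mono by blast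
    moreover have "norm ((T ^^ j) ?f w) \<le> \<rho>' * M" for w
    proof (rule transfer_funpow_bound)
      show "norm (?f w) \<le> \<rho>' * M" for w
        using con'[OF f, of w] mult_right_mono[OF \<rho>'(3) M] by linarith
    qed
    ultimately have "inv_ball (\<rho>' * M) ((T ^^ j) ?f)" by (simp add: inv_ball_def)
    then have "inv_ball (\<rho>' * M) (T ((T ^^ j) ?f))" by (rule inv_ball_transfer)
    then show ?thesis by (simp add: n1_def funpow_add)
  qed
  have iter: "inv_ball (\<rho>' ^ i * M) ((T ^^ (n1 * i)) f)" if "inv_ball M f" for i f M
  proof (induction i)
    case (Suc i)
    have "inv_ball (\<rho>' * (\<rho>' ^ i * M)) ((T ^^ n1) ((T ^^ (n1 * i)) f))" by (rule step[OF Suc])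
    then show ?case by (simp add: funpow_add mult.assoc)
  qed (use that in simp)
  define r where "r = root n1 \<rho>'"
  have n1: "n1 > 0" by (simp add: n1_def)
  have r: "0 < r" "r < 1" "r ^ n1 = \<rho>'"
    using \<rho>' n1 by (auto simp: r_def real_root_gt_zero real_root_lt_1_iff)
  have "norm ((T ^^ n) f w) \<le> inverse \<rho>' * K * r ^ n"
    if bd: "\<forall>w. norm (f w) \<le> K" and f: "fut_hoelder K f" for f K n w
  proof -
    have K: "0 \<le> K" using bd norm_ge_zero order_trans by blast
    have "K \<le> K0 * K" using mult_right_mono[OF K0_ge1 K] by simp
    then have "inv_ball K f" using bd fut_hoelder_mono[OF f] by (auto simp: inv_ball_def)
    then have "inv_ball (\<rho>' ^ (n div n1) * K) ((T ^^ (n1 * (n div n1))) f)" by (rule iter)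
    then have "inv_ball (\<rho>' ^ (n div n1) * K) ((T ^^ (n mod n1)) ((T ^^ (n1 * (n div n1))) f))"
      by (rule inv_ball_transfer_funpow)
    then have "inv_ball (\<rho>' ^ (n div n1) * K) ((T ^^ n) f)"
      by (simp flip: funpow_add comp_apply[of "T ^^ (n mod n1)"])
    then have "norm ((T ^^ n) f w) \<le> \<rho>' ^ (n div n1) * K" by (simp add: inv_ball_def)
    \<comment> \<open>Rounding down to whole blocks loses less than one block, that is one factor
      \<open>\<rho>'\<close>; this is the constant \<open>inverse \<rho>'\<close>.\<close>
    also have "\<rho>' ^ (n div n1) \<le> inverse \<rho>' * r ^ n"
    proof -
      have "\<rho>' * \<rho>' ^ (n div n1) = r ^ (n1 * Suc (n div n1))" by (simp add: r(3)[symmetric] power_add power_mult)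
      also have "\<dots> \<le> r ^ n"
      proof (rule power_decreasing)
        show "n \<le> n1 * Suc (n div n1)"
          using less_imp_le[OF dividend_less_times_div[OF n1, of n]] by simp
      qed (use r in auto)
      finally show ?thesis using \<rho>'(1) by (simp add: field_simps)
    qed
    finally show ?thesis using K by (simp add: mult_right_mono mult.assoc mult.commute mult.left_commute)
  qed
  then show ?thesis using r \<rho>'(1) by (intro exI[of _ r] exI[of _ "inverse \<rho>'"]) auto
qed

section \<open>Duality of the transfer operator and the shift\<close>

lemma integral_transfer:
  assumes g: "fut_dep g" "\<And>w. norm (g w) \<le> M" and [measurable]: "g \<in> seq_meas"
    and f: "\<And>w. norm (f w) \<le> K" and [measurable]: "f \<in> seq_meas"
  shows "(\<integral>w. g (shift w) * (cis (b w) * f w) \<partial>\<mu>)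
     = (\<integral>w. g w * T f w \<partial>\<mu>)"
proof -
  have s: "g (shift (prepend a w)) = g w" for a w
    by (rule fut_depD[OF g(1)]) (simp add: shift_prepend)
  have "(\<integral>w. g (shift w) * (cis (b w) * f w) \<partial>\<mu>)
    = (\<integral>w. of_real p * (g (shift (prepend True w)) * (cis (b (prepend True w)) * f (prepend True w)))
       + of_real (1 - p) * (g (shift (prepend False w)) * (cis (b (prepend False w)) * f (prepend False w)))
      \<partial>\<mu>)"
  proof (rule integral_prepend[OF p])
    show "norm (g (shift w) * (cis (b w) * f w)) \<le> M * K" for w
      using g(2)[of "shift w"] f[of w] by (auto simp: norm_mult intro!: mult_mono order_trans[OF norm_ge_zero])
  qed measurable
  also have "\<dots> = (\<integral>w. g w * T f w \<partial>\<mu>)"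
    unfolding s transfer_def by (simp add: algebra_simps)
  finally show ?thesis .
qed

lemma fut_dep_shift: "fut_dep f \<Longrightarrow> fut_dep (\<lambda>w. f ((shift ^^ n) w))"
  unfolding fut_dep_def by (auto simp: shift_funpow)

lemma fut_dep_birkhoff: "fut_dep (birkhoff_sum b n)"
  unfolding birkhoff_sum_def fut_dep_def
  by (intro allI impI sum.cong refl fut_depD[OF b_fut]) (auto simp: shift_funpow)

lemma integral_transfer_funpow:
  assumes g: "fut_dep g" "\<And>w. norm (g w) \<le> M" and [measurable]: "g \<in> seq_meas"
    and "\<And>w. norm (f w) \<le> K" and "f \<in> seq_meas"
  shows "(\<integral>w. g ((shift ^^ n) w) * (cis (birkhoff_sum b n w) * f w) \<partial>\<mu>)
     = (\<integral>w. g w * (T ^^ n) f w \<partial>\<mu>)"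
  using assms(4,5)
proof (induction n arbitrary: f)
  case 0
  then show ?case by (simp add: birkhoff_sum_def)
next
  case (Suc n)
  let ?g = "\<lambda>w. g ((shift ^^ n) w) * cis (birkhoff_sum b n w)"
  have "(\<integral>w. g ((shift ^^ Suc n) w) * (cis (birkhoff_sum b (Suc n) w) * f w) \<partial>\<mu>)
     = (\<integral>w. ?g (shift w) * (cis (b w) * f w) \<partial>\<mu>)"
    by (simp add: birkhoff_sum_Suc' funpow_swap1 cis_mult[symmetric] ac_simps)
  also have "\<dots> = (\<integral>w. ?g w * T f w \<partial>\<mu>)"
  proof (rule integral_transfer)
    show "fut_dep ?g" using fut_dep_shift[OF g(1), of n] fut_dep_birkhoff[of n] unfolding fut_dep_def by metis
    show "norm (?g w) \<le> M" for w using g(2) by (simp add: norm_mult)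
  qed (use Suc.prems in auto)
  also have "\<dots> = (\<integral>w. g ((shift ^^ n) w) * (cis (birkhoff_sum b n w) * T f w) \<partial>\<mu>)"
    by (simp add: ac_simps)
  also have "\<dots> = (\<integral>w. g w * (T ^^ n) (T f) w \<partial>\<mu>)"
    using Suc.prems by (intro Suc.IH transfer_bound measurable_transfer) auto
  finally show ?case by (simp add: funpow_swap1)
qed

end

section \<open>Oscillation along pasts and futures\<close>

text \<open>Decay at rate \<open>R\<close> during at least half of the time counts as decay at rate
  \<open>sqrt R\<close> during all of it. This pays for every splitting of a time interval
  below.\<close>

lemma power_le_sqrt_power:
  fixes R :: real
  assumes "0 < R" "R < 1" "n \<le> 2 * j"
  shows "R ^ j \<le> sqrt R ^ n"
proof -
  have "R ^ j = sqrt R ^ (2 * j)" using assms by (simp add: power_mult)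
  also have "\<dots> \<le> sqrt R ^ n" using assms by (intro power_decreasing) auto
  finally show ?thesis .
qed

lemma half_power:
  fixes R :: real
  assumes "0 < R" "R < 1"
  shows "R ^ (n div 2) \<le> inverse R * sqrt R ^ n"
proof -
  have "R ^ Suc (n div 2) \<le> sqrt R ^ n"
    using assms by (intro power_le_sqrt_power) auto
  then show ?thesis using assms by (simp add: field_simps)
qed

lemma geometric_descent:
  fixes x :: "nat \<Rightarrow> real"
  assumes step: "\<And>n. x n \<le> c * q ^ n + x (Suc n)" and lim: "x \<longlonglongrightarrow> 0" and "0 \<le> c" "0 < q" "q < 1"
  shows "x 0 \<le> c / (1 - q)"
proof -
  have le: "x 0 \<le> c * (\<Sum>j<n. q ^ j) + x n" for n
  proof (induction n)
    case (Suc n)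
    then show ?case using step[of n] by (simp add: algebra_simps)
  qed simp
  have "x 0 \<le> c / (1 - q) + x n" for n
  proof -
    have "(\<Sum>j<n. q ^ j) = (1 - q ^ n) / (1 - q)"
      using assms by (simp add: sum_gp_strict)
    also have "\<dots> \<le> 1 / (1 - q)" using assms by (intro divide_right_mono) auto
    finally have "c * (\<Sum>j<n. q ^ j) \<le> c * (1 / (1 - q))" using assms by (intro mult_left_mono) auto
    then show ?thesis using le[of n] by simp
  qed
  moreover have "(\<lambda>n. c / (1 - q) + x n) \<longlonglongrightarrow> c / (1 - q) + 0" by (intro tendsto_intros lim)
  ultimately show ?thesis by (intro LIMSEQ_le_const) auto
qed

text \<open>\<open>f \<circ> tr N\<close> takes finitely many values, on sets given by finitely many
  coordinates, so it is measurable for any \<open>f\<close>; the Hoelder bound makes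
  \<open>f\<close> a limit of such functions.\<close>

lemma measurable_hoelder:
  fixes f :: "symb_seq \<Rightarrow> 'b::real_normed_vector"
  assumes f: "\<And>N w w'. (\<And>i. \<bar>i\<bar> < int N \<Longrightarrow> w i = w' i) \<Longrightarrow> norm (f w - f w') \<le> K * q ^ N"
    and q: "0 < q" "q < 1"
  shows "f \<in> seq_meas"
proof (rule borel_measurable_LIMSEQ_metric)
  define tr :: "nat \<Rightarrow> symb_seq \<Rightarrow> symb_seq" where
    "tr N w = (\<lambda>i. i \<in> {- int N<..<int N} \<and> w i)" for N w
  show "(\<lambda>w. f (tr N w)) \<in> seq_meas" for N
  proof (rule measurable_compose[of "tr N" _ "count_space (range (tr N))" f])
    let ?R = "range (tr N)"
    define I where "I = {- int N<..<int N}"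
    have "?R \<subseteq> (\<lambda>A i. i \<in> A) ` Pow I"
    proof
      fix x assume "x \<in> ?R"
      then obtain w where "x = tr N w" by auto
      then have "x = (\<lambda>i. i \<in> {i \<in> I. w i})" by (simp add: tr_def I_def)
      moreover have "{i \<in> I. w i} \<in> Pow I" by auto
      ultimately show "x \<in> (\<lambda>A i. i \<in> A) ` Pow I" by (rule image_eqI)
    qed
    then have fin: "finite ?R" by (rule finite_subset) (simp add: I_def)
    have "tr N -` {a} \<inter> space seq_borel \<in> sets seq_borel" if "a \<in> ?R" for a
    proof -
      have "\<not> a i" if "i \<notin> I" for i using \<open>a \<in> ?R\<close> that unfolding tr_def I_def by auto
      then have "tr N -` {a} \<inter> space seq_borel = {w \<in> space seq_borel. \<forall>i\<in>I. w i = a i}"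
        unfolding tr_def I_def[symmetric] fun_eq_iff vimage_def by blast
      also have "\<dots> \<in> sets seq_borel" unfolding I_def by measurable
      finally show ?thesis .
    qed
    then show "tr N \<in> measurable seq_borel (count_space ?R)"
      using fin by (subst measurable_count_space_eq2) auto
  qed auto
  show "(\<lambda>N. f (tr N w)) \<longlonglongrightarrow> f w" for w
  proof (rule LIM_zero_cancel, rule Lim_null_comparison)
    show "\<forall>\<^sub>F N in sequentially. norm (f (tr N w) - f w) \<le> K * q ^ N"
      by (intro always_eventually allI f) (auto simp: tr_def)
    show "(\<lambda>N. K * q ^ N) \<longlonglongrightarrow> 0"
      using q by (auto intro!: tendsto_mult_right_zero LIMSEQ_realpow_zero)
  qed
qed

text \<open>Oscillation along \<open>past_eq k\<close> measures how strongly a function depends on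
  coordinates from \<open>k + N\<close> on, so functions with good bounds are nearly functions of
  the past of time \<open>k\<close>. In the same way \<open>future_eq\<close> controls the
  dependence on coordinates at or below \<open>- N\<close>.\<close>

definition past_eq :: "nat \<Rightarrow> nat \<Rightarrow> symb_seq \<Rightarrow> symb_seq \<Rightarrow> bool" where
  "past_eq k N w w' \<longleftrightarrow> (\<forall>i<int k + int N. w i = w' i)"

definition future_eq :: "nat \<Rightarrow> symb_seq \<Rightarrow> symb_seq \<Rightarrow> bool" where
  "future_eq N w w' \<longleftrightarrow> (\<forall>i>- int N. w i = w' i)"

lemma past_eq_shift: "past_eq (k + n) N w w' \<Longrightarrow> past_eq k N ((shift ^^ n) w) ((shift ^^ n) w')"
  by (auto simp: past_eq_def shift_funpow)

lemma future_eq_shift: "future_eq N w w' \<Longrightarrow> future_eq (N + n) ((shift ^^ n) w) ((shift ^^ n) w')"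
  by (auto simp: future_eq_def shift_funpow)

lemma past_eq_unshift: "past_eq k N w w' \<Longrightarrow> past_eq (k + n) N ((unshift ^^ n) w) ((unshift ^^ n) w')"
  by (auto simp: past_eq_def unshift_funpow)

lemma past_eq_mono: "past_eq k N w w' \<Longrightarrow> l + M \<le> k + N \<Longrightarrow> past_eq l M w w'"
  unfolding past_eq_def by force

context bernoulli_shift
begin

text \<open>The relation is a parameter, so one calculus of sums, products and phases serves
  \<open>future_eq\<close> and every \<open>past_eq k\<close>.\<close>

definition osc_le :: "(nat \<Rightarrow> symb_seq \<Rightarrow> symb_seq \<Rightarrow> bool) \<Rightarrow> real \<Rightarrow> (symb_seq \<Rightarrow> 'b::real_normed_vector) \<Rightarrow> bool" where
  "osc_le R K f \<longleftrightarrow> (\<forall>N w w'. R N w w' \<longrightarrow> norm (f w - f w') \<le> K * \<kappa> ^ N)"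

definition bosc_le :: "(nat \<Rightarrow> symb_seq \<Rightarrow> symb_seq \<Rightarrow> bool) \<Rightarrow> real \<Rightarrow> (symb_seq \<Rightarrow> 'b::real_normed_vector) \<Rightarrow> bool" where
  "bosc_le R K f \<longleftrightarrow> (\<forall>w. norm (f w) \<le> K) \<and> osc_le R K f"

lemma osc_leI: "(\<And>N w w'. R N w w' \<Longrightarrow> norm (f w - f w') \<le> K * \<kappa> ^ N) \<Longrightarrow> osc_le R K f"
  by (simp add: osc_le_def)

lemma osc_leD: "osc_le R K f \<Longrightarrow> R N w w' \<Longrightarrow> norm (f w - f w') \<le> K * \<kappa> ^ N"
  by (simp add: osc_le_def)

lemma bosc_leI: "(\<And>w. norm (f w) \<le> K) \<Longrightarrow> osc_le R K f \<Longrightarrow> bosc_le R K f"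
  by (simp add: bosc_le_def)

lemma bosc_le_norm: "bosc_le R K f \<Longrightarrow> norm (f w) \<le> K"
  by (simp add: bosc_le_def)

lemma bosc_le_osc_le: "bosc_le R K f \<Longrightarrow> osc_le R K f"
  by (simp add: bosc_le_def)

lemma bosc_le_nonneg: "bosc_le R K f \<Longrightarrow> 0 \<le> K"
  unfolding bosc_le_def using norm_ge_zero order_trans by blast

lemma osc_le_mono: "osc_le R K f \<Longrightarrow> K \<le> L \<Longrightarrow> osc_le R L f"
  unfolding osc_le_def
proof (intro allI impI)
  fix N w w'
  assume *: "\<forall>N w w'. R N w w' \<longrightarrow> norm (f w - f w') \<le> K * \<kappa> ^ N" and "K \<le> L" "R N w w'"
  then have "norm (f w - f w') \<le> K * \<kappa> ^ N" by blast
  also have "\<dots> \<le> L * \<kappa> ^ N" using \<open>K \<le> L\<close> \<kappa> by (intro mult_right_mono) auto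
  finally show "norm (f w - f w') \<le> L * \<kappa> ^ N" .
qed

lemma bosc_le_mono: "bosc_le R K f \<Longrightarrow> K \<le> L \<Longrightarrow> bosc_le R L f"
  unfolding bosc_le_def using osc_le_mono order_trans by blast

lemma osc_le_add:
  assumes "osc_le R K f" "osc_le R L g"
  shows "osc_le R (K + L) (\<lambda>w. f w + g w)"
proof (rule osc_leI)
  fix N w w' assume R: "R N w w'"
  have "norm (f w + g w - (f w' + g w')) \<le> norm (f w - f w') + norm (g w - g w')"
    by (rule norm_diff_triangle_ineq)
  also have "\<dots> \<le> K * \<kappa> ^ N + L * \<kappa> ^ N" using assms R by (intro add_mono osc_leD)
  finally show "norm (f w + g w - (f w' + g w')) \<le> (K + L) * \<kappa> ^ N" by (simp add: algebra_simps)
qed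

lemma osc_le_cmult:
  fixes f :: "symb_seq \<Rightarrow> real"
  assumes "osc_le R K f"
  shows "osc_le R (\<bar>c\<bar> * K) (\<lambda>w. c * f w)"
proof (rule osc_leI)
  fix N w w' assume R: "R N w w'"
  have "norm (c * f w - c * f w') = \<bar>c\<bar> * norm (f w - f w')"
    by (simp add: abs_mult flip: right_diff_distrib)
  also have "\<dots> \<le> \<bar>c\<bar> * (K * \<kappa> ^ N)" using osc_leD[OF assms R] by (intro mult_left_mono) auto
  finally show "norm (c * f w - c * f w') \<le> \<bar>c\<bar> * K * \<kappa> ^ N" by simp
qed

lemma bosc_le_mult:
  fixes f g :: "symb_seq \<Rightarrow> complex"
  assumes f: "bosc_le R K f" and g: "bosc_le R L g"
  shows "bosc_le R (2 * K * L) (\<lambda>w. f w * g w)"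
proof (rule bosc_leI)
  have K: "0 \<le> K" "0 \<le> L" using f g by (auto intro: bosc_le_nonneg)
  have "norm (f w * g w) \<le> K * L" for w
    unfolding norm_mult using f g K by (intro mult_mono bosc_le_norm) auto
  moreover have "K * L \<le> 2 * K * L" using K by simp
  ultimately show "norm (f w * g w) \<le> 2 * K * L" for w by (rule order_trans)
  show "osc_le R (2 * K * L) (\<lambda>w. f w * g w)"
  proof (rule osc_leI)
    fix N w w' assume R: "R N w w'"
    have "f w * g w - f w' * g w' = f w * (g w - g w') + (f w - f w') * g w'"
      by (simp add: algebra_simps)
    then have "norm (f w * g w - f w' * g w') \<le> norm (f w) * norm (g w - g w') + norm (f w - f w') * norm (g w')"
      by (metis norm_triangle_ineq norm_mult)
    also have "\<dots> \<le> K * (L * \<kappa> ^ N) + (K * \<kappa> ^ N) * L"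
      using K \<kappa> by (intro add_mono mult_mono bosc_le_norm[OF f] bosc_le_norm[OF g] osc_leD[OF bosc_le_osc_le[OF f] R] osc_leD[OF bosc_le_osc_le[OF g] R]) auto
    finally show "norm (f w * g w - f w' * g w') \<le> 2 * K * L * \<kappa> ^ N" by (simp add: algebra_simps)
  qed
qed

lemma bosc_le_cis:
  assumes f: "osc_le R K f" and "0 \<le> K"
  shows "bosc_le R (1 + K) (\<lambda>w. cis (f w))"
proof (rule bosc_leI)
  have "osc_le R K (\<lambda>w. cis (f w))"
  proof (rule osc_leI)
    fix N w w' assume "R N w w'"
    then show "norm (cis (f w) - cis (f w')) \<le> K * \<kappa> ^ N"
      using norm_cis_diff_le[of "f w" "f w'"] osc_leD[OF f, of N w w'] by simp
  qed
  then show "osc_le R (1 + K) (\<lambda>w. cis (f w))" by (rule osc_le_mono) simp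
qed (use assms in simp)

lemma bosc_le_cnj: "bosc_le R K f \<Longrightarrow> bosc_le R K (\<lambda>w. cnj (f w))"
  unfolding bosc_le_def osc_le_def by (simp flip: complex_cnj_diff)

lemma bosc_le_of_real: "bosc_le R K f \<Longrightarrow> bosc_le R K (\<lambda>w. complex_of_real (f w))"
  unfolding bosc_le_def osc_le_def by (simp flip: of_real_diff)

lemma bosc_le_Re: "bosc_le R K f \<Longrightarrow> bosc_le R K (\<lambda>w. Re (f w))"
  unfolding bosc_le_def osc_le_def
  by (metis abs_Re_le_cmod minus_complex.simps(1) order_trans real_norm_def)

lemma bosc_le_const: "norm c \<le> K \<Longrightarrow> bosc_le R K (\<lambda>w. c)"
proof -
  assume c: "norm c \<le> K"
  then have "0 \<le> K" using norm_ge_zero order_trans by blast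
  then show ?thesis using c \<kappa> by (simp add: bosc_le_def osc_le_def)
qed

lemma \<kappa>_pow_nonneg: "0 \<le> \<kappa> ^ N"
  using \<kappa> by simp

lemma \<kappa>_pow_mono: "m \<le> n \<Longrightarrow> \<kappa> ^ n \<le> \<kappa> ^ m"
  using \<kappa> by (intro power_decreasing) auto

lemma osc_le_past_eq_mono:
  assumes f: "osc_le (past_eq k) K f" and "k \<le> l" "0 \<le> K"
  shows "osc_le (past_eq l) K f"
proof (rule osc_leI)
  fix N w w' assume "past_eq l N w w'"
  then have "past_eq k (l - k + N) w w'" using \<open>k \<le> l\<close> by (auto intro: past_eq_mono)
  then have "norm (f w - f w') \<le> K * \<kappa> ^ (l - k + N)" by (rule osc_leD[OF f])
  also have "\<dots> \<le> K * \<kappa> ^ N" using \<open>0 \<le> K\<close> by (intro mult_left_mono \<kappa>_pow_mono) auto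
  finally show "norm (f w - f w') \<le> K * \<kappa> ^ N" .
qed

lemma bosc_le_past_eq_mono: "bosc_le (past_eq k) K f \<Longrightarrow> k \<le> l \<Longrightarrow> bosc_le (past_eq l) K f"
  by (meson bosc_le_def bosc_le_nonneg osc_le_past_eq_mono)

lemma osc_le_past_eq_shift: "osc_le (past_eq k) K f \<Longrightarrow> osc_le (past_eq (k + n)) K (\<lambda>w. f ((shift ^^ n) w))"
  unfolding osc_le_def using past_eq_shift by blast

lemma bosc_le_past_eq_shift: "bosc_le (past_eq k) K f \<Longrightarrow> bosc_le (past_eq (k + n)) K (\<lambda>w. f ((shift ^^ n) w))"
  using osc_le_past_eq_shift by (auto simp: bosc_le_def)

text \<open>Looking \<open>n\<close> steps ahead moves the forgotten coordinates \<open>n\<close>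
  places further away. The gain \<open>\<kappa> ^ n\<close> makes sums along the orbit uniformly
  bounded in oscillation.\<close>

lemma osc_le_future_eq_shift: "osc_le future_eq K f \<Longrightarrow> osc_le future_eq (K * \<kappa> ^ n) (\<lambda>w. f ((shift ^^ n) w))"
proof (rule osc_leI)
  fix N w w' assume f: "osc_le future_eq K f" and "future_eq N w w'"
  from osc_leD[OF f future_eq_shift[OF this(2), of n]]
  show "norm (f ((shift ^^ n) w) - f ((shift ^^ n) w')) \<le> K * \<kappa> ^ n * \<kappa> ^ N"
    by (simp add: power_add mult_ac)
qed

lemma bosc_le_future_eq_shift: "bosc_le future_eq K f \<Longrightarrow> bosc_le future_eq K (\<lambda>w. f ((shift ^^ n) w))"
proof -
  assume f: "bosc_le future_eq K f"
  have "K * \<kappa> ^ n \<le> K * 1" using bosc_le_nonneg[OF f] \<kappa> by (intro mult_left_mono power_le_one) auto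
  then show ?thesis
    using osc_le_mono[OF osc_le_future_eq_shift[OF bosc_le_osc_le[OF f]], of n K] bosc_le_norm[OF f] by (auto intro!: bosc_leI)
qed

lemma geo_sum_le:
  assumes "0 \<le> c"
  shows "(\<Sum>j<n. c * \<kappa> ^ j) \<le> c / (1 - \<kappa>)"
proof -
  have "(\<Sum>j<n. \<kappa> ^ j) = (1 - \<kappa> ^ n) / (1 - \<kappa>)"
    using \<kappa> by (simp add: sum_gp_strict)
  also have "\<dots> \<le> 1 / (1 - \<kappa>)" using \<kappa> by (intro divide_right_mono) auto
  finally have "c * (\<Sum>j<n. \<kappa> ^ j) \<le> c * (1 / (1 - \<kappa>))" using assms by (intro mult_left_mono) auto
  then show ?thesis by (simp add: sum_distrib_left)
qed

text \<open>The bound does not depend on \<open>k\<close>: seen from time \<open>k\<close>, the term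
  of time \<open>j\<close> has \<open>k - j\<close> further coordinates in common, so the
  oscillations form a geometric series. Phases of arbitrarily long Birkhoff sums thereby become
  observables of the past with a fixed constant.\<close>

lemma osc_le_past_eq_sum:
  fixes X :: "nat \<Rightarrow> symb_seq \<Rightarrow> real"
  assumes X: "\<And>j. j < k \<Longrightarrow> osc_le (past_eq j) c (X j)" and "0 \<le> c"
  shows "osc_le (past_eq k) (c / (1 - \<kappa>)) (\<lambda>w. \<Sum>j<k. X j w)"
proof (rule osc_leI)
  fix N w w' assume a: "past_eq k N w w'"
  have "norm ((\<Sum>j<k. X j w) - (\<Sum>j<k. X j w')) \<le> (\<Sum>j<k. norm (X j w - X j w'))"
    unfolding sum_subtractf[symmetric] by (rule norm_sum)
  also have "\<dots> \<le> (\<Sum>j<k. c * \<kappa> ^ N * \<kappa> ^ (k - Suc j))"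
  proof (rule sum_mono)
    fix j assume j: "j \<in> {..<k}"
    then have "past_eq j (k - j + N) w w'" using a by (auto intro: past_eq_mono)
    then have "norm (X j w - X j w') \<le> c * \<kappa> ^ (k - j + N)" using j by (intro osc_leD[OF X]) auto
    \<comment> \<open>One power of \<open>\<kappa>\<close> is given away so that the exponents run
      through \<open>0, ..., k - 1\<close> when the sum is reversed.\<close>
    also have "\<dots> \<le> c * \<kappa> ^ (N + (k - Suc j))"
      using \<open>0 \<le> c\<close> by (intro mult_left_mono \<kappa>_pow_mono) auto
    finally show "norm (X j w - X j w') \<le> c * \<kappa> ^ N * \<kappa> ^ (k - Suc j)" by (simp add: power_add)
  qed
  also have "\<dots> = (\<Sum>j<k. c * \<kappa> ^ N * \<kappa> ^ j)"
    by (rule sum.nat_diff_reindex)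
  also have "\<dots> \<le> c * \<kappa> ^ N / (1 - \<kappa>)" using \<open>0 \<le> c\<close> \<kappa> by (intro geo_sum_le) auto
  finally show "norm ((\<Sum>j<k. X j w) - (\<Sum>j<k. X j w')) \<le> c / (1 - \<kappa>) * \<kappa> ^ N" by simp
qed

lemma osc_le_future_eq_sum:
  fixes X :: "nat \<Rightarrow> symb_seq \<Rightarrow> real"
  assumes X: "\<And>j. osc_le future_eq (c * \<kappa> ^ j) (X j)" and "0 \<le> c"
  shows "osc_le future_eq (c / (1 - \<kappa>)) (\<lambda>w. \<Sum>j<k. X j w)"
proof (rule osc_leI)
  fix N w w' assume a: "future_eq N w w'"
  have "norm ((\<Sum>j<k. X j w) - (\<Sum>j<k. X j w')) \<le> (\<Sum>j<k. norm (X j w - X j w'))"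
    unfolding sum_subtractf[symmetric] by (rule norm_sum)
  also have "\<dots> \<le> (\<Sum>j<k. c * \<kappa> ^ N * \<kappa> ^ j)"
    using osc_leD[OF X a] by (intro sum_mono) (simp add: mult_ac)
  also have "\<dots> \<le> c * \<kappa> ^ N / (1 - \<kappa>)" using \<open>0 \<le> c\<close> \<kappa> by (intro geo_sum_le) auto
  finally show "norm ((\<Sum>j<k. X j w) - (\<Sum>j<k. X j w')) \<le> c / (1 - \<kappa>) * \<kappa> ^ N" by simp
qed

definition cut_past :: "nat \<Rightarrow> symb_seq \<Rightarrow> symb_seq" where
  "cut_past N w = (\<lambda>i. i > - int N \<and> w i)"

lemma future_eq_cut_past: "future_eq N w (cut_past N w)"
  by (simp add: future_eq_def cut_past_def)

lemma measurable_cut_past [measurable]: "cut_past N \<in> measurable seq_borel seq_borel"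
  by (rule measurable_seqI) (simp add: cut_past_def)

definition cut_future :: "nat \<Rightarrow> symb_seq \<Rightarrow> symb_seq" where
  "cut_future N w = (\<lambda>i. i < int N \<and> w i)"

lemma past_eq_cut_future: "past_eq k N w (cut_future (k + N) w)"
  by (simp add: past_eq_def cut_future_def)

lemma measurable_cut_future [measurable]: "cut_future N \<in> measurable seq_borel seq_borel"
  by (rule measurable_seqI) (simp add: cut_future_def)

text \<open>Mixing at frequency 0. After \<open>P\<close> is cut below and \<open>V\<close> above by
  \<open>N = n div 2\<close> coordinates, the first factor at time \<open>k + n\<close> depends on
  coordinates above \<open>k + n - N\<close>, the second on coordinates below \<open>k + N\<close>.
  Since \<open>2 * N \<le> n\<close>, these blocks are disjoint and the cut functions are
  independent.\<close>

lemma decorrelation: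
  "\<exists>r C. 0 < r \<and> r < 1 \<and> 0 < C \<and> (\<forall>k n K L P V. bosc_le future_eq K P \<longrightarrow> bosc_le (past_eq k) L V
     \<longrightarrow> P \<in> seq_meas \<longrightarrow> V \<in> seq_meas
     \<longrightarrow> norm ((\<integral>w. P ((shift ^^ (k + n)) w) * V w \<partial>\<mu>)
            - (\<integral>w. P w \<partial>\<mu>) * (\<integral>w. V w \<partial>\<mu> :: complex))
          \<le> C * K * L * r ^ n)"
proof (intro exI conjI allI impI)
  show "0 < sqrt \<kappa>" "sqrt \<kappa> < 1" "0 < 4 * inverse \<kappa>" using \<kappa> by auto
  fix k n :: nat and K L and P V :: "symb_seq \<Rightarrow> complex"
  assume P: "bosc_le future_eq K P" and V: "bosc_le (past_eq k) L V"
    and [measurable]: "P \<in> seq_meas" "V \<in> seq_meas"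
  let ?mu = "bernoulli_measure p"
  define N where "N = n div 2"
  have N: "2 * N \<le> n" by (simp add: N_def)
  let ?P = "\<lambda>w. P (cut_past N w)" and ?V = "\<lambda>w. V (cut_future (k + N) w)"
  have KL: "0 \<le> K" "0 \<le> L" using P V by (auto intro: bosc_le_nonneg)
  have Pd: "norm (P w - ?P w) \<le> K * \<kappa> ^ N" for w by (rule osc_leD[OF bosc_le_osc_le[OF P] future_eq_cut_past])
  have Vd: "norm (V w - ?V w) \<le> L * \<kappa> ^ N" for w by (rule osc_leD[OF bosc_le_osc_le[OF V] past_eq_cut_future])
  have prod: "norm (x * y - x' * y') \<le> 2 * K * L * \<kappa> ^ N"
    if "norm x' \<le> K" "norm y \<le> L" "norm (x - x') \<le> K * \<kappa> ^ N" "norm (y - y') \<le> L * \<kappa> ^ N"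
    for x y x' y' :: complex
  proof -
    have "x * y - x' * y' = x' * (y - y') + (x - x') * y" by (simp add: algebra_simps)
    then have "norm (x * y - x' * y') \<le> norm x' * norm (y - y') + norm (x - x') * norm y"
      by (metis norm_triangle_ineq norm_mult)
    also have "\<dots> \<le> K * (L * \<kappa> ^ N) + (K * \<kappa> ^ N) * L"
      using that KL \<kappa> by (intro add_mono mult_mono) auto
    finally show ?thesis by simp
  qed
  have 1: "norm ((\<integral>w. P ((shift ^^ (k + n)) w) * V w \<partial>?mu) - (\<integral>w. ?P ((shift ^^ (k + n)) w) * ?V w \<partial>?mu))
    \<le> 2 * K * L * \<kappa> ^ N"
  proof (rule bern_integral_diff_bound)
    show "norm (P ((shift ^^ (k + n)) w) * V w) \<le> K * L" for w
      unfolding norm_mult using P V KL by (intro mult_mono bosc_le_norm) auto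
    show "norm (P ((shift ^^ (k + n)) w) * V w - ?P ((shift ^^ (k + n)) w) * ?V w) \<le> 2 * K * L * \<kappa> ^ N" for w
      by (rule prod) (rule bosc_le_norm[OF P] bosc_le_norm[OF V] Pd Vd)+
  qed measurable
  have "(\<integral>w. ?P ((shift ^^ (k + n)) w) * ?V w \<partial>?mu)
     = (\<integral>\<eta>. (\<integral>w. ?P ((shift ^^ (k + n)) (mix {..<int (k + N)} \<eta> w)) * ?V (mix {..<int (k + N)} \<eta> w) \<partial>?mu) \<partial>?mu)"
  proof (rule integral_mix)
    show "norm (?P ((shift ^^ (k + n)) w) * ?V w) \<le> K * L" for w
      unfolding norm_mult using P V KL by (intro mult_mono bosc_le_norm) auto
  qed measurable
  also have "\<dots> = (\<integral>\<eta>. (\<integral>w. ?P ((shift ^^ (k + n)) w) * ?V \<eta> \<partial>?mu) \<partial>?mu)"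
  proof -
    have "cut_past N ((shift ^^ (k + n)) (mix {..<int (k + N)} \<eta> w)) = cut_past N ((shift ^^ (k + n)) w)" for \<eta> w
      using N by (auto simp: cut_past_def shift_funpow mix_def fun_eq_iff)
    moreover have "cut_future (k + N) (mix {..<int (k + N)} \<eta> w) = cut_future (k + N) \<eta>" for \<eta> w
      by (auto simp: cut_future_def mix_def fun_eq_iff)
    ultimately show ?thesis by simp
  qed
  also have "\<dots> = (\<integral>w. ?P w \<partial>?mu) * (\<integral>w. ?V w \<partial>?mu)"
    using integral_shift_funpow[where f = ?P and n = "k + n" and p = p] by simp
  finally have 2: "(\<integral>w. ?P ((shift ^^ (k + n)) w) * ?V w \<partial>?mu) = (\<integral>w. ?P w \<partial>?mu) * (\<integral>w. ?V w \<partial>?mu)" .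
  have 3: "norm ((\<integral>w. P w \<partial>?mu) * (\<integral>w. V w \<partial>?mu) - (\<integral>w. ?P w \<partial>?mu) * (\<integral>w. ?V w \<partial>?mu)) \<le> 2 * K * L * \<kappa> ^ N"
  proof (rule prod)
    show "norm (\<integral>w. ?P w \<partial>?mu) \<le> K" by (rule bern_integral_bound) (rule bosc_le_norm[OF P])
    show "norm (\<integral>w. V w \<partial>?mu) \<le> L" by (rule bern_integral_bound) (rule bosc_le_norm[OF V])
    show "norm ((\<integral>w. P w \<partial>?mu) - (\<integral>w. ?P w \<partial>?mu)) \<le> K * \<kappa> ^ N"
      by (rule bern_integral_diff_bound[OF _ _ bosc_le_norm[OF P] Pd]) measurable
    show "norm ((\<integral>w. V w \<partial>?mu) - (\<integral>w. ?V w \<partial>?mu)) \<le> L * \<kappa> ^ N"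
      by (rule bern_integral_diff_bound[OF _ _ bosc_le_norm[OF V] Vd]) measurable
  qed
  have "norm ((\<integral>w. P ((shift ^^ (k + n)) w) * V w \<partial>?mu) - (\<integral>w. P w \<partial>?mu) * (\<integral>w. V w \<partial>?mu))
      \<le> 2 * K * L * \<kappa> ^ N + 2 * K * L * \<kappa> ^ N"
    by (rule norm_diff_triangle_le) (rule 1[unfolded 2], subst norm_minus_commute, rule 3)
  also have "\<dots> = 4 * K * L * \<kappa> ^ N" by simp
  also have "\<dots> \<le> 4 * K * L * (inverse \<kappa> * sqrt \<kappa> ^ n)"
    unfolding N_def using KL \<kappa> by (intro mult_left_mono half_power) auto
  finally show "norm ((\<integral>w. P ((shift ^^ (k + n)) w) * V w \<partial>?mu) - (\<integral>w. P w \<partial>?mu) * (\<integral>w. V w \<partial>?mu))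
      \<le> 4 * inverse \<kappa> * K * L * sqrt \<kappa> ^ n" by (simp add: mult_ac)
qed

end

section \<open>Reduction to a cocycle of the future\<close>

locale hoelder_cocycle = bernoulli_shift +
  fixes \<beta> :: "symb_seq \<Rightarrow> real" and B :: real
  assumes \<beta>: "\<And>N w w'. (\<And>i. \<bar>i\<bar> < int N \<Longrightarrow> w i = w' i) \<Longrightarrow> \<bar>\<beta> w - \<beta> w'\<bar> \<le> B * (\<kappa> ^ 4) ^ N"
begin

lemma \<kappa>4: "0 < \<kappa> ^ 4" "\<kappa> ^ 4 < 1"
  using \<kappa> power_strict_decreasing[of 0 4 \<kappa>] by auto

lemma \<beta>_meas [measurable]: "\<beta> \<in> seq_meas"
  by (rule measurable_hoelder[of \<beta> B "\<kappa> ^ 4"]) (use \<beta> \<kappa>4 in auto)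

lemma B_nonneg: "0 \<le> B"
  using \<beta>[of 0 undefined undefined] by simp

lemma B_pow: "M \<le> 4 * N \<Longrightarrow> B * (\<kappa> ^ 4) ^ N \<le> B * \<kappa> ^ M"
  unfolding power_mult[symmetric] using B_nonneg by (intro mult_left_mono \<kappa>_pow_mono) auto

lemma \<beta>_past_eq: "osc_le (past_eq 0) B \<beta>"
proof (rule osc_leI)
  fix N w w' assume "past_eq 0 N w w'"
  then have "\<bar>\<beta> w - \<beta> w'\<bar> \<le> B * (\<kappa> ^ 4) ^ N" by (intro \<beta>) (auto simp: past_eq_def)
  then show "norm (\<beta> w - \<beta> w') \<le> B * \<kappa> ^ N" using B_pow[of N N] by simp
qed

lemma \<beta>_future_eq: "osc_le future_eq B \<beta>"
proof (rule osc_leI)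
  fix N w w' assume "future_eq N w w'"
  then have "\<bar>\<beta> w - \<beta> w'\<bar> \<le> B * (\<kappa> ^ 4) ^ N" by (intro \<beta>) (auto simp: future_eq_def)
  then show "norm (\<beta> w - \<beta> w') \<le> B * \<kappa> ^ N" using B_pow[of N N] by simp
qed

text \<open>The future of \<open>w\<close> with a fixed reference past. Sequences with the same
  future share it, which makes it cancel in \<open>b_fut\<close>.\<close>

definition zero_past :: "symb_seq \<Rightarrow> symb_seq" where
  "zero_past w = (\<lambda>i. 0 \<le> i \<and> w i)"

lemma measurable_zero_past [measurable]: "zero_past \<in> measurable seq_borel seq_borel"
  by (rule measurable_seqI) (simp add: zero_past_def)

text \<open>
  \<open>\<beta>\<close> is cohomologous to \<open>b\<close>, which ignores the past: \<open>\<beta> = b + u - u \<circ> shift\<close>. The price is regularity: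
  two sequences that agree for \<open>i < N\<close> give terms \<open>ut j\<close> that differ by a multiple of
  \<open>min (\<theta>\<^bsup>N-j\<^esup>) (\<theta>\<^sup>j)\<close>. With \<open>\<theta> = \<kappa>\<^sup>4\<close> this is at most \<open>\<kappa>\<^bsup>N+2j\<^esup>\<close>, which is summable in \<open>j\<close>.
\<close>

definition ut :: "nat \<Rightarrow> symb_seq \<Rightarrow> real" where
  "ut j w = \<beta> ((shift ^^ j) w) - \<beta> ((shift ^^ j) (zero_past w))"

definition u :: "symb_seq \<Rightarrow> real" where
  "u w = (\<Sum>j. ut j w)"

definition Cu :: real where "Cu = 2 * B / (1 - \<kappa> ^ 2)"

lemma \<kappa>2: "0 < \<kappa> ^ 2" "\<kappa> ^ 2 < 1"
  using \<kappa> power_strict_decreasing[of 0 2 \<kappa>] by auto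

lemma Cu_nonneg: "0 \<le> Cu"
  using B_nonneg \<kappa>2 by (simp add: Cu_def)

lemma ut_le: "\<bar>ut j w\<bar> \<le> B * \<kappa> ^ (4 * j)"
  unfolding ut_def power_mult by (rule \<beta>) (auto simp: shift_funpow zero_past_def)

lemma ut_summable: "summable (\<lambda>j. ut j w)"
proof (rule summable_comparison_test')
  show "summable (\<lambda>j. B * (\<kappa> ^ 4) ^ j)" using \<kappa>4 by (intro summable_mult summable_geometric) auto
  show "norm (ut j w) \<le> B * (\<kappa> ^ 4) ^ j" for j using ut_le[of j w] by (simp add: power_mult)
qed

lemma u_diff:
  assumes "\<And>j. \<bar>ut j w - ut j w'\<bar> \<le> 2 * B * \<kappa> ^ (N + 2 * j)"
  shows "\<bar>u w - u w'\<bar> \<le> Cu * \<kappa> ^ N"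
proof -
  have *: "2 * B * \<kappa> ^ (N + 2 * j) = 2 * B * \<kappa> ^ N * (\<kappa> ^ 2) ^ j" for j
    by (simp add: power_add power_mult)
  have s: "summable (\<lambda>j. 2 * B * \<kappa> ^ N * (\<kappa> ^ 2) ^ j)"
    using \<kappa>2 by (intro summable_mult summable_geometric) auto
  have "\<bar>u w - u w'\<bar> = norm (\<Sum>j. ut j w - ut j w')"
    unfolding u_def by (simp add: suminf_diff ut_summable)
  also have "\<dots> \<le> (\<Sum>j. 2 * B * \<kappa> ^ N * (\<kappa> ^ 2) ^ j)"
    using assms unfolding * by (intro norm_suminf_le s) auto
  also have "\<dots> = 2 * B * \<kappa> ^ N * (1 / (1 - \<kappa> ^ 2))"
    using \<kappa>2 by (subst suminf_mult) (auto simp: suminf_geometric intro!: summable_geometric)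
  finally show ?thesis by (simp add: Cu_def)
qed

lemma ut_diff_crude: "M \<le> 4 * j \<Longrightarrow> \<bar>ut j w - ut j w'\<bar> \<le> 2 * B * \<kappa> ^ M"
proof -
  assume "M \<le> 4 * j"
  then have "B * \<kappa> ^ (4 * j) \<le> B * \<kappa> ^ M" using B_nonneg by (intro mult_left_mono \<kappa>_pow_mono)
  then show ?thesis using ut_le[of j w] ut_le[of j w'] by linarith
qed

lemma u_past_eq: "osc_le (past_eq 0) Cu u"
proof (rule osc_leI)
  fix N w w' assume a: "past_eq 0 N w w'"
  have "\<bar>ut j w - ut j w'\<bar> \<le> 2 * B * \<kappa> ^ (N + 2 * j)" for j
  \<comment> \<open>The two estimates balance here: \<open>4 * (N - j) \<ge> N + 2 * j\<close> is
    equivalent to \<open>2 * j \<le> N\<close>, and in the other case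
    \<open>4 * j \<ge> N + 2 * j\<close>.\<close>
  proof (cases "2 * j \<le> N")
    case True
    have "\<bar>\<beta> ((shift ^^ j) w) - \<beta> ((shift ^^ j) w')\<bar> \<le> B * (\<kappa> ^ 4) ^ (N - j)"
      using a True by (intro \<beta>) (auto simp: past_eq_def shift_funpow)
    moreover have "\<bar>\<beta> ((shift ^^ j) (zero_past w)) - \<beta> ((shift ^^ j) (zero_past w'))\<bar> \<le> B * (\<kappa> ^ 4) ^ (N - j)"
      using a True by (intro \<beta>) (auto simp: past_eq_def shift_funpow zero_past_def)
    moreover have "B * (\<kappa> ^ 4) ^ (N - j) \<le> B * \<kappa> ^ (N + 2 * j)" using True by (intro B_pow) auto
    ultimately show ?thesis unfolding ut_def by linarith
  qed (auto intro: ut_diff_crude)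
  then show "norm (u w - u w') \<le> Cu * \<kappa> ^ N" using u_diff by simp
qed

lemma u_future_eq: "osc_le future_eq Cu u"
proof (rule osc_leI)
  fix N w w' assume a: "future_eq N w w'"
  have "\<bar>ut j w - ut j w'\<bar> \<le> 2 * B * \<kappa> ^ (N + 2 * j)" for j
  \<comment> \<open>For \<open>N = 0\<close> coordinate 0 need not agree, so the two
    \<open>zero_past\<close> sequences may differ and only the crude bound is left.\<close>
  proof (cases "N = 0")
    case False
    have "zero_past w = zero_past w'" using a False by (auto simp: future_eq_def zero_past_def fun_eq_iff)
    then have "\<bar>ut j w - ut j w'\<bar> = \<bar>\<beta> ((shift ^^ j) w) - \<beta> ((shift ^^ j) w')\<bar>" by (simp add: ut_def)
    also have "\<dots> \<le> B * (\<kappa> ^ 4) ^ (N + j)"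
      using a by (intro \<beta>) (auto simp: future_eq_def shift_funpow)
    also have "\<dots> \<le> B * \<kappa> ^ (N + 2 * j)" by (intro B_pow) auto
    finally show ?thesis using mult_nonneg_nonneg[OF B_nonneg \<kappa>_pow_nonneg, of "N + 2 * j"] by linarith
  qed (auto intro: ut_diff_crude)
  then show "norm (u w - u w') \<le> Cu * \<kappa> ^ N" using u_diff by simp
qed

lemma u_meas [measurable]: "u \<in> seq_meas"
  unfolding u_def[abs_def] ut_def by measurable

definition b :: "symb_seq \<Rightarrow> real" where
  "b w = \<beta> w - u w + u (shift w)"

lemma b_meas [measurable]: "b \<in> seq_meas"
  unfolding b_def[abs_def] by measurable

text \<open>For a common future the reference terms cancel. The differences of \<open>u\<close> and
  of \<open>u \<circ> shift\<close> are then the full series of \<open>d\<close> and the same series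
  without its first term, and this first term is the difference of \<open>\<beta>\<close>.\<close>

lemma b_fut: "fut_dep b"
  unfolding fut_dep_def
proof safe
  fix w w' :: symb_seq assume eq: "\<forall>i\<ge>0. w i = w' i"
  define d where "d j = \<beta> ((shift ^^ j) w) - \<beta> ((shift ^^ j) w')" for j
  have zero_past: "zero_past w = zero_past w'" "zero_past (shift w) = zero_past (shift w')"
    using eq by (auto simp: zero_past_def shift_def fun_eq_iff)
  have d0: "ut j w - ut j w' = d j" for j using zero_past by (simp add: ut_def d_def)
  have d1: "ut j (shift w) - ut j (shift w') = d (Suc j)" for j
    using zero_past by (simp add: ut_def d_def funpow_swap1)
  have "summable (\<lambda>j. ut j w - ut j w')" by (intro summable_diff ut_summable)
  then have sd: "summable d" unfolding d0 .
  have "u w - u w' = suminf d"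
    unfolding u_def by (simp add: suminf_diff ut_summable d0)
  moreover have "u (shift w) - u (shift w') = suminf d - d 0"
    unfolding u_def using suminf_split_head[OF sd] by (simp add: suminf_diff ut_summable d1)
  ultimately show "b w = b w'" by (simp add: b_def d_def)
qed

lemma b_var:
  assumes "\<And>i. 0 \<le> i \<Longrightarrow> i < int (Suc N) \<Longrightarrow> w i = w' i"
  shows "\<bar>b w - b w'\<bar> \<le> (B + 2 * Cu) * \<kappa> ^ N"
proof -
  \<comment> \<open>As \<open>b\<close> ignores the past, \<open>w'\<close> may be given the past of
    \<open>w\<close>; this makes the estimates along \<open>past_eq\<close> for
    \<open>\<beta>\<close> and \<open>u\<close> applicable. The extra coordinate in
    \<open>Suc N\<close> is used up by \<open>u (shift w)\<close>.\<close>
  define v where "v = mix {..<0} w w'"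
  have v: "b w' = b v" by (rule fut_depD[OF b_fut]) (simp add: v_def mix_def)
  have a: "past_eq 0 (Suc N) w v" using assms by (auto simp: past_eq_def v_def mix_def)
  then have a0: "past_eq 0 N w v" by (rule past_eq_mono) simp
  have "past_eq 0 N ((shift ^^ 1) w) ((shift ^^ 1) v)" by (rule past_eq_shift) (rule past_eq_mono[OF a], simp)
  then have a1: "past_eq 0 N (shift w) (shift v)" by simp
  have "\<bar>b w - b v\<bar> \<le> norm (\<beta> w - \<beta> v) + norm (u w - u v) + norm (u (shift w) - u (shift v))"
    unfolding b_def real_norm_def by linarith
  also have "\<dots> \<le> B * \<kappa> ^ N + Cu * \<kappa> ^ N + Cu * \<kappa> ^ N"
    using a0 a1 by (intro add_mono osc_leD[OF \<beta>_past_eq] osc_leD[OF u_past_eq])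
  finally show ?thesis by (simp add: v algebra_simps)
qed

lemma birkhoff_b: "birkhoff_sum \<beta> n w = birkhoff_sum b n w + u w - u ((shift ^^ n) w)"
  by (induction n) (auto simp: birkhoff_sum_def b_def)

text \<open>
  A solution that is merely \<open>\<kappa>\<close>-Hoelder inherits the exponent \<open>\<theta> = \<kappa>\<^sup>4\<close> of \<open>\<beta>\<close>: iterate the equation
  forwards for sequences with the same future and backwards for sequences with the same past.
\<close>

lemma livsic:
  fixes A :: "symb_seq \<Rightarrow> complex"
  assumes eq: "\<And>w. cis (m * \<beta> w) * A (shift w) = \<nu> * A w" and one: "\<And>w. norm (A w) = 1" "norm \<nu> = 1"
    and s: "osc_le future_eq K A" and un: "osc_le (past_eq 0) K A"
  obtains K' where "\<And>N w w'. (\<And>i. \<bar>i\<bar> < int N \<Longrightarrow> w i = w' i) \<Longrightarrow> norm (A w - A w') \<le> K' * (\<kappa> ^ 4) ^ N"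
proof -
  let ?q = "\<kappa> ^ 4"
  define c where "c = \<bar>m\<bar> * B"
  have c: "0 \<le> c" using B_nonneg by (simp add: c_def)
  have prod: "norm (cis x * z - cis y * v) \<le> \<bar>x - y\<bar> + norm (z - v)" if "norm v = 1" for x y and z v :: complex
  proof -
    have "cis x * z - cis y * v = cis x * (z - v) + (cis x - cis y) * v" by (simp add: algebra_simps)
    then have "norm (cis x * z - cis y * v) \<le> norm (cis x * (z - v)) + norm ((cis x - cis y) * v)"
      by (metis norm_triangle_ineq)
    then show ?thesis using norm_cis_diff_le[of x y] that by (simp add: norm_mult)
  qed
  have fwd: "norm (A w - A w') \<le> \<bar>m * \<beta> w - m * \<beta> w'\<bar> + norm (A (shift w) - A (shift w'))" for w w'
  proof -
    have "norm (A w - A w') = norm (\<nu> * A w - \<nu> * A w')"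
      unfolding right_diff_distrib[symmetric] norm_mult one by simp
    then show ?thesis unfolding eq[symmetric] using prod one by simp
  qed
  have bwd: "norm (A (shift w) - A (shift w')) \<le> \<bar>m * \<beta> w - m * \<beta> w'\<bar> + norm (A w - A w')" for w w'
  proof -
    have A: "A (shift w) = \<nu> * (cis (- (m * \<beta> w)) * A w)" for w
    proof -
      have "\<nu> * (cis (- (m * \<beta> w)) * A w) = cis (- (m * \<beta> w)) * (cis (m * \<beta> w) * A (shift w))"
        unfolding eq by (simp add: mult_ac)
      also have "\<dots> = A (shift w)" by (simp add: cis_mult flip: mult.assoc)
      finally show ?thesis ..
    qed
    have "norm (A (shift w) - A (shift w')) = norm (cis (- (m * \<beta> w)) * A w - cis (- (m * \<beta> w')) * A w')"
      unfolding A right_diff_distrib[symmetric] norm_mult one by simp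
    also have "\<dots> \<le> \<bar>- (m * \<beta> w) - - (m * \<beta> w')\<bar> + norm (A w - A w')" by (rule prod) (rule one)
    finally show ?thesis by (simp add: abs_minus_commute)
  qed
  have mb: "\<bar>m * \<beta> w - m * \<beta> w'\<bar> \<le> c * ?q ^ M" if "\<And>i. \<bar>i\<bar> < int M \<Longrightarrow> w i = w' i" for w w' M
  proof -
    have "\<bar>m * \<beta> w - m * \<beta> w'\<bar> = \<bar>m\<bar> * \<bar>\<beta> w - \<beta> w'\<bar>" by (simp flip: right_diff_distrib abs_mult)
    also have "\<dots> \<le> \<bar>m\<bar> * (B * ?q ^ M)" using \<beta>[OF that] by (intro mult_left_mono) auto
    finally show ?thesis by (simp add: c_def)
  qed
  have stable: "norm (A w - A w') \<le> c / (1 - ?q) * ?q ^ N" if a: "future_eq N w w'" for N w w'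
  proof -
    define x where "x n = norm (A ((shift ^^ n) w) - A ((shift ^^ n) w'))" for n
    have "x 0 \<le> c * ?q ^ N / (1 - ?q)"
    proof (rule geometric_descent)
      show "x n \<le> c * ?q ^ N * ?q ^ n + x (Suc n)" for n
      proof -
        have "x n \<le> \<bar>m * \<beta> ((shift ^^ n) w) - m * \<beta> ((shift ^^ n) w')\<bar> + x (Suc n)"
          unfolding x_def using fwd[of "(shift ^^ n) w" "(shift ^^ n) w'"] by simp
        also have "\<bar>m * \<beta> ((shift ^^ n) w) - m * \<beta> ((shift ^^ n) w')\<bar> \<le> c * ?q ^ (N + n)"
          using a by (intro mb) (auto simp: future_eq_def shift_funpow)
        finally show ?thesis by (simp add: power_add mult.assoc)
      qed
      \<comment> \<open>The weak regularity of \<open>A\<close> serves only to make the remainder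
        vanish; the size of the bound comes from \<open>\<beta>\<close> alone, hence the better
        exponent.\<close>
      show "x \<longlonglongrightarrow> 0"
      proof (rule Lim_null_comparison)
        show "\<forall>\<^sub>F n in sequentially. norm (x n) \<le> K * \<kappa> ^ N * \<kappa> ^ n"
          unfolding x_def using osc_leD[OF s future_eq_shift[OF a]] by (intro always_eventually allI) (simp add: power_add mult.assoc)
        show "(\<lambda>n. K * \<kappa> ^ N * \<kappa> ^ n) \<longlonglongrightarrow> 0" by (rule \<kappa>_pow_lim)
      qed
    qed (use c \<kappa>4 in auto)
    then show ?thesis by (simp add: x_def)
  qed
  have unstable: "norm (A w - A w') \<le> c / (1 - ?q) * ?q ^ N" if a: "past_eq 0 N w w'" for N w w'
  proof -
    define x where "x n = norm (A ((unshift ^^ n) w) - A ((unshift ^^ n) w'))" for n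
    have "x 0 \<le> c * ?q ^ N / (1 - ?q)"
    proof (rule geometric_descent)
      show "x n \<le> c * ?q ^ N * ?q ^ n + x (Suc n)" for n
      proof -
        have "x n \<le> \<bar>m * \<beta> ((unshift ^^ Suc n) w) - m * \<beta> ((unshift ^^ Suc n) w')\<bar> + x (Suc n)"
          unfolding x_def using bwd[of "(unshift ^^ Suc n) w" "(unshift ^^ Suc n) w'"] by simp
        also have "\<bar>m * \<beta> ((unshift ^^ Suc n) w) - m * \<beta> ((unshift ^^ Suc n) w')\<bar> \<le> c * ?q ^ (N + n)"
          using a by (intro mb) (auto simp: past_eq_def unshift_funpow simp del: funpow.simps)
        finally show ?thesis by (simp add: power_add mult.assoc)
      qed
      show "x \<longlonglongrightarrow> 0"
      proof (rule Lim_null_comparison)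
        have "past_eq 0 (N + n) ((unshift ^^ n) w) ((unshift ^^ n) w')" for n
          using past_eq_unshift[OF a, of n] by (rule past_eq_mono) simp
        from osc_leD[OF un this] show "\<forall>\<^sub>F n in sequentially. norm (x n) \<le> K * \<kappa> ^ N * \<kappa> ^ n"
          unfolding x_def by (intro always_eventually allI) (simp add: power_add mult.assoc)
        show "(\<lambda>n. K * \<kappa> ^ N * \<kappa> ^ n) \<longlonglongrightarrow> 0" by (rule \<kappa>_pow_lim)
      qed
    qed (use c \<kappa>4 in auto)
    then show ?thesis by (simp add: x_def)
  qed
  show thesis
  proof (rule that)
    fix N and w w' :: symb_seq assume e: "\<And>i. \<bar>i\<bar> < int N \<Longrightarrow> w i = w' i"
    \<comment> \<open>Local product structure: \<open>v\<close> has the past of \<open>w\<close> and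
      the future of \<open>w'\<close>, so it is compared with \<open>w\<close> backwards in time and
      with \<open>w'\<close> forwards.\<close>
    define v where "v = mix {..<0} w w'"
    have "norm (A w - A v) \<le> c / (1 - ?q) * ?q ^ N"
      using e by (intro unstable) (auto simp: past_eq_def v_def mix_def)
    moreover have "norm (A v - A w') \<le> c / (1 - ?q) * ?q ^ N"
      using e by (intro stable) (auto simp: future_eq_def v_def mix_def)
    ultimately have "norm (A w - A w') \<le> c / (1 - ?q) * ?q ^ N + c / (1 - ?q) * ?q ^ N"
      by (rule norm_diff_triangle_le)
    then show "norm (A w - A w') \<le> 2 * c / (1 - ?q) * ?q ^ N" by simp
  qed
qed

end

section \<open>Exponential mixing\<close>

context hoelder_cocycle
begin

text \<open>The form in which the assumption enters: solutions of modulus 1 at the rate of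
  \<open>\<beta>\<close> itself, which are what the contraction argument and the bootstrap produce
  together.\<close>

definition aperiodic :: "real \<Rightarrow> bool" where
  "aperiodic m \<longleftrightarrow> (\<nexists>\<nu> A K. (\<forall>N w w'. (\<forall>i. \<bar>i\<bar> < int N \<longrightarrow> w i = w' i) \<longrightarrow> norm (A w - A w') \<le> K * (\<kappa> ^ 4) ^ N)
     \<and> (\<forall>w. norm (A w :: complex) = 1) \<and> (\<forall>w. cis (m * \<beta> w) * A (shift w) = \<nu> * A w))"

lemma birkhoff_cmult: "birkhoff_sum (\<lambda>w. m * f w) n w = m * birkhoff_sum f n w"
  by (simp add: birkhoff_sum_def sum_distrib_left)

lemma future_phase_b: "future_phase \<kappa> p (\<lambda>w. m * b w) (\<bar>m\<bar> * (B + 2 * Cu))"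
proof
  show "fut_dep (\<lambda>w. m * b w)" using b_fut unfolding fut_dep_def by metis
  show "\<bar>m * b w - m * b w'\<bar> \<le> \<bar>m\<bar> * (B + 2 * Cu) * \<kappa> ^ N"
    if "\<And>i. 0 \<le> i \<Longrightarrow> i < int (Suc N) \<Longrightarrow> w i = w' i" for N w w'
  proof -
    have "\<bar>m * b w - m * b w'\<bar> = \<bar>m\<bar> * \<bar>b w - b w'\<bar>" by (simp flip: right_diff_distrib abs_mult)
    also have "\<dots> \<le> \<bar>m\<bar> * ((B + 2 * Cu) * \<kappa> ^ N)" using b_var[OF that] by (intro mult_left_mono) auto
    finally show ?thesis by simp
  qed
qed measurable

text \<open>The solution \<open>g\<close> coming from the transfer operator has the phase on the
  opposite side, so it is conjugated; the factor \<open>cis (m * u w)\<close> then replaces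
  \<open>b\<close> by \<open>\<beta>\<close>, because
  \<open>\<beta> + u \<circ> shift = b + u\<close>. The resulting \<open>A\<close> is only
  \<open>\<kappa>\<close>-Hoelder until \<open>livsic\<close> improves it.\<close>

lemma no_future_solution:
  assumes ap: "aperiodic m"
  shows "\<nexists>\<nu> g. fut_hoelder K g \<and> (\<forall>w. norm (g w) = 1) \<and> norm \<nu> = 1 \<and>
      (\<forall>w. \<nu> * g (shift w) = cis (m * b w) * g w)"
proof
  assume "\<exists>\<nu> g. fut_hoelder K g \<and> (\<forall>w. norm (g w) = 1) \<and> norm \<nu> = 1 \<and>
      (\<forall>w. \<nu> * g (shift w) = cis (m * b w) * g w)"
  then obtain \<nu> g where g: "fut_hoelder K g" "\<And>w. norm (g w) = 1" and \<nu>: "norm \<nu> = 1"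
    and eq: "\<And>w. \<nu> * g (shift w) = cis (m * b w) * g w" by blast
  define A where "A w = cnj (g w) * cis (m * u w)" for w
  have unit: "\<nu> * cnj \<nu> = 1" using complex_norm_square[of \<nu>] \<nu> by simp
  have Aeq: "cis (m * \<beta> w) * A (shift w) = \<nu> * A w" for w
  proof -
    have "cnj \<nu> * cnj (g (shift w)) = cnj (cis (m * b w)) * cnj (g w)"
      using arg_cong[OF eq[of w], of cnj] by simp
    then have "(\<nu> * cnj \<nu>) * (cis (m * b w) * cnj (g (shift w)))
      = \<nu> * (cis (m * b w) * cnj (cis (m * b w))) * cnj (g w)"
      by (simp add: mult_ac)
    then have e: "cis (m * b w) * cnj (g (shift w)) = \<nu> * cnj (g w)"
      by (simp add: unit cis_cnj cis_mult)
    have "cis (m * \<beta> w) * cis (m * u (shift w)) = cis (m * b w) * cis (m * u w)"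
      unfolding cis_mult b_def by (simp add: algebra_simps)
    then have "cis (m * \<beta> w) * A (shift w) = (cis (m * b w) * cnj (g (shift w))) * cis (m * u w)"
      unfolding A_def by (simp add: mult_ac)
    then show ?thesis unfolding e A_def by (simp add: mult_ac)
  qed
  have one: "norm (A w) = 1" for w by (simp add: A_def norm_mult g)
  have gR: "bosc_le (past_eq 0) (1 + K) (\<lambda>w. cnj (g w))" "bosc_le future_eq (1 + K) (\<lambda>w. cnj (g w))"
  proof -
    have K: "0 \<le> K" using fut_hoelderD[OF g(1), of 0 undefined undefined] by simp
    have "osc_le (past_eq 0) K g"
      by (rule osc_leI, rule fut_hoelderD[OF g(1)]) (auto simp: past_eq_def)
    then have "osc_le (past_eq 0) (1 + K) g" by (rule osc_le_mono) simp
    then show "bosc_le (past_eq 0) (1 + K) (\<lambda>w. cnj (g w))"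
      using g(2) K by (intro bosc_le_cnj bosc_leI) auto
    have "osc_le future_eq K g"
    proof (rule osc_leI)
      fix N w w' assume a: "future_eq N w w'"
      show "norm (g w - g w') \<le> K * \<kappa> ^ N"
      proof (cases "N = 0")
        case True
        then show ?thesis using fut_hoelderD[OF g(1), of 0 w w'] by simp
      next
        case False
        then have "g w = g w'" using a by (intro fut_depD[OF fut_hoelder_fut[OF g(1)]]) (auto simp: future_eq_def)
        then show ?thesis using K \<kappa> by simp
      qed
    qed
    then have "osc_le future_eq (1 + K) g" by (rule osc_le_mono) simp
    then show "bosc_le future_eq (1 + K) (\<lambda>w. cnj (g w))"
      using g(2) K by (intro bosc_le_cnj bosc_leI) auto
  qed
  have uR: "bosc_le R (1 + \<bar>m\<bar> * Cu) (\<lambda>w. cis (m * u w))" if "osc_le R Cu u" for R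
    using that Cu_nonneg by (intro bosc_le_cis osc_le_cmult) auto
  define L where "L = 2 * (1 + K) * (1 + \<bar>m\<bar> * Cu)"
  have "osc_le future_eq L A" "osc_le (past_eq 0) L A"
    unfolding A_def[abs_def] L_def using bosc_le_mult[OF gR(2) uR[OF u_future_eq]] bosc_le_mult[OF gR(1) uR[OF u_past_eq]]
    by (auto intro: bosc_le_osc_le)
  then obtain K' where "\<And>N w w'. (\<And>i. \<bar>i\<bar> < int N \<Longrightarrow> w i = w' i) \<Longrightarrow> norm (A w - A w') \<le> K' * (\<kappa> ^ 4) ^ N"
    using livsic[OF Aeq one \<nu>] by blast
  then show False using ap Aeq one unfolding aperiodic_def by blast
qed

text \<open>
  \<open>P\<close> may depend on the past. Cutting off its coordinates below \<open>-n/2\<close> costs \<open>\<kappa>\<^bsup>n/2\<^esup>\<close> and leaves the first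
  \<open>n/2\<close> steps to the transfer operator. The past of \<open>V\<close> is frozen instead, by Fubini.
\<close>

lemma mixing0:
  assumes ap: "aperiodic m"
  shows "\<exists>r C. 0 < r \<and> r < 1 \<and> 0 < C \<and> (\<forall>n K L P V. bosc_le future_eq K P \<longrightarrow> bosc_le (past_eq 0) L V
     \<longrightarrow> P \<in> seq_meas \<longrightarrow> V \<in> seq_meas
     \<longrightarrow> norm (\<integral>w. P ((shift ^^ n) w) * (cis (m * birkhoff_sum \<beta> n w) * V w) \<partial>\<mu>)
          \<le> C * K * L * r ^ n)"
proof -
  interpret F: future_phase \<kappa> p "\<lambda>w. m * b w" "\<bar>m\<bar> * (B + 2 * Cu)" by (rule future_phase_b)
  obtain r0 C0 where r0: "0 < r0" "r0 < 1" "0 < C0" and decay: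
    "\<And>f K n w. (\<forall>w. norm (f w) \<le> K) \<Longrightarrow> fut_hoelder K f \<Longrightarrow> norm ((F.T ^^ n) f w) \<le> C0 * K * r0 ^ n"
    using F.transfer_decay[OF no_future_solution[OF ap]] by blast
  define R where "R = max \<kappa> r0"
  have R: "0 < R" "R < 1" "\<kappa> \<le> R" "r0 \<le> R" using r0 \<kappa> by (auto simp: R_def)
  define cu where "cu = 2 * (1 + \<bar>m\<bar> * Cu)"
  have "0 \<le> \<bar>m\<bar> * Cu" using Cu_nonneg by simp
  then have cu: "0 < cu" by (simp add: cu_def add_pos_nonneg)
  define C where "C = cu * cu * (1 + C0) * inverse R"
  have C: "0 < C" using cu r0 R by (simp add: C_def)
  have bound: "norm (\<integral>w. P ((shift ^^ n) w) * (cis (m * birkhoff_sum \<beta> n w) * V w) \<partial>\<mu>)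
          \<le> C * K * L * sqrt R ^ n"
    if P: "bosc_le future_eq K P" and V: "bosc_le (past_eq 0) L V" and [measurable]: "P \<in> seq_meas" "V \<in> seq_meas"
    for n K L P V
  proof -
    let ?mu = "bernoulli_measure p"
    have KL: "0 \<le> K" "0 \<le> L" using P V by (auto intro: bosc_le_nonneg)
    define N where "N = n div 2"
    define n' where "n' = n - N"
    have N: "n = N + n'" "N \<le> n'" by (auto simp: N_def n'_def)
    \<comment> \<open>By \<open>birkhoff_b\<close> the change from \<open>\<beta>\<close> to
      \<open>b\<close> leaves boundary terms of \<open>u\<close> at times \<open>n\<close> and 0;
      they are absorbed into the observables there.\<close>
    define P' where "P' w = P w * cis ((- m) * u w)" for w
    define V' where "V' w = V w * cis (m * u w)" for w
    define K' where "K' = cu * K"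
    define L' where "L' = cu * L"
    have [measurable]: "P' \<in> seq_meas" "V' \<in> seq_meas"
      unfolding P'_def[abs_def] V'_def[abs_def] by measurable
    have "bosc_le future_eq (2 * K * (1 + \<bar>- m\<bar> * Cu)) P'"
      unfolding P'_def[abs_def] using Cu_nonneg by (intro bosc_le_mult[OF P] bosc_le_cis osc_le_cmult u_future_eq) auto
    then have P': "bosc_le future_eq K' P'" by (simp add: K'_def cu_def mult_ac)
    have "bosc_le (past_eq 0) (2 * L * (1 + \<bar>m\<bar> * Cu)) V'"
      unfolding V'_def[abs_def] using Cu_nonneg by (intro bosc_le_mult[OF V] bosc_le_cis osc_le_cmult u_past_eq) auto
    then have V': "bosc_le (past_eq 0) L' V'" by (simp add: L'_def cu_def mult_ac)
    have KL': "0 \<le> K'" "0 \<le> L'" using P' V' by (auto intro: bosc_le_nonneg)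
    define e where "e n w = cis (m * birkhoff_sum b n w)" for n w
    have [measurable]: "e n \<in> seq_meas" for n
      unfolding e_def[abs_def] by measurable
    have enorm: "norm (e n w) = 1" for n w by (simp add: e_def)
    have eq: "P ((shift ^^ n) w) * (cis (m * birkhoff_sum \<beta> n w) * V w)
       = P' ((shift ^^ n) w) * (e n w * V' w)" for w
    proof -
      have "cis (m * birkhoff_sum \<beta> n w)
        = cis ((- m) * u ((shift ^^ n) w)) * e n w * cis (m * u w)"
        unfolding birkhoff_b e_def cis_mult by (simp add: algebra_simps)
      then show ?thesis unfolding P'_def V'_def by (simp add: mult_ac)
    qed
    define Q where "Q w = P' (cut_past N w)" for w
    have [measurable]: "Q \<in> seq_meas"
      unfolding Q_def[abs_def] by measurable
    have Qd: "norm (P' w - Q w) \<le> K' * \<kappa> ^ N" for w unfolding Q_def by (rule osc_leD[OF bosc_le_osc_le[OF P'] future_eq_cut_past])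
    have Qb: "norm (Q w) \<le> K'" for w unfolding Q_def by (rule bosc_le_norm[OF P'])
    have 1: "norm ((\<integral>w. P' ((shift ^^ n) w) * (e n w * V' w) \<partial>?mu)
       - (\<integral>w. Q ((shift ^^ n) w) * (e n w * V' w) \<partial>?mu)) \<le> K' * \<kappa> ^ N * L'"
    proof (rule bern_integral_diff_bound)
      show "norm (P' ((shift ^^ n) w) * (e n w * V' w)) \<le> K' * L'" for w
        using bosc_le_norm[OF P'] bosc_le_norm[OF V'] KL' by (auto simp: norm_mult enorm intro!: mult_mono)
      show "norm (P' ((shift ^^ n) w) * (e n w * V' w) - Q ((shift ^^ n) w) * (e n w * V' w)) \<le> K' * \<kappa> ^ N * L'" for w
        unfolding left_diff_distrib[symmetric] norm_mult enorm mult_1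
        using KL' \<kappa> by (intro mult_mono Qd bosc_le_norm[OF V']) auto
    qed measurable
    \<comment> \<open>Viewed from \<open>N\<close> steps earlier, the cut observable sees no
      negative coordinate. It takes the phase of the last \<open>N\<close> steps along, and the
      first \<open>n'\<close> steps remain for the operator.\<close>
    define g where "g w = Q ((shift ^^ N) w) * e N w" for w
    have [measurable]: "g \<in> seq_meas"
      unfolding g_def[abs_def] by measurable
    have gb: "norm (g w) \<le> K'" for w using Qb by (simp add: g_def norm_mult enorm)
    have efut: "fut_dep (e k)" for k
      using F.fut_dep_birkhoff[of k] unfolding e_def fut_dep_def birkhoff_cmult by metis
    have "fut_dep (\<lambda>w. Q ((shift ^^ N) w))"
      unfolding fut_dep_def
    proof (intro allI impI)
      fix w w' :: symb_seq assume "\<forall>i\<ge>0. w i = w' i"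
      then have "cut_past N ((shift ^^ N) w) = cut_past N ((shift ^^ N) w')"
        by (auto simp: cut_past_def shift_funpow fun_eq_iff)
      then show "Q ((shift ^^ N) w) = Q ((shift ^^ N) w')" by (simp add: Q_def)
    qed
    then have gfut: "fut_dep g" using efut[of N] unfolding g_def fut_dep_def by metis
    have split: "Q ((shift ^^ n) w) * (e n w * V' w) = g ((shift ^^ n') w) * (e n' w * V' w)" for w
    proof -
      have "birkhoff_sum b (k + n') w = birkhoff_sum b n' w + birkhoff_sum b k ((shift ^^ n') w)" for k
        by (induction k) (auto simp: birkhoff_sum_def shift_add)
      then have "e n w = e N ((shift ^^ n') w) * e n' w"
        unfolding N(1) e_def cis_mult by (simp add: algebra_simps)
      then show ?thesis unfolding g_def N(1) shift_add by (simp add: mult_ac)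
    qed
    let ?h = "\<lambda>w. g ((shift ^^ n') w) * (e n' w * V' w)"
    have hb: "norm (?h w) \<le> K' * L'" for w
      using gb bosc_le_norm[OF V'] KL' by (auto simp: norm_mult enorm intro!: mult_mono)
    have "(\<integral>w. ?h w \<partial>?mu) = (\<integral>\<eta>. (\<integral>w. ?h (mix {..<0} \<eta> w) \<partial>?mu) \<partial>?mu)"
      by (rule integral_mix[OF _ hb]) measurable
    also have "norm \<dots> \<le> K' * (C0 * L' * r0 ^ n')"
    proof (rule bern_integral_bound)
      fix \<eta>
      let ?V = "\<lambda>w. V' (mix {..<0} \<eta> w)"
      have Vb: "norm (?V w) \<le> L'" for w by (rule bosc_le_norm[OF V'])
      have Vf: "fut_hoelder L' ?V"
      proof (rule fut_hoelderI, rule osc_leD[OF bosc_le_osc_le[OF V']])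
        show "past_eq 0 N (mix {..<0} \<eta> w) (mix {..<0} \<eta> w')" if "\<And>i. 0 \<le> i \<Longrightarrow> i < int N \<Longrightarrow> w i = w' i" for N w w'
          using that by (auto simp: past_eq_def mix_def)
      qed
      have "?h (mix {..<0} \<eta> w) = g ((shift ^^ n') w) * (e n' w * ?V w)" for w
      proof -
        have "g ((shift ^^ n') (mix {..<0} \<eta> w)) = g ((shift ^^ n') w)"
          by (rule fut_depD[OF gfut]) (auto simp: shift_funpow mix_def)
        moreover have "e n' (mix {..<0} \<eta> w) = e n' w"
          by (rule fut_depD[OF efut]) (auto simp: mix_def)
        ultimately show ?thesis by simp
      qed
      then have "(\<integral>w. ?h (mix {..<0} \<eta> w) \<partial>?mu)
         = (\<integral>w. g ((shift ^^ n') w) * (cis (birkhoff_sum (\<lambda>w. m * b w) n' w) * ?V w) \<partial>?mu)"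
        by (simp only: e_def birkhoff_cmult)
      also have "\<dots> = (\<integral>w. g w * (F.T ^^ n') ?V w \<partial>?mu)"
        by (rule F.integral_transfer_funpow[OF gfut gb _ Vb]) measurable
      also have "norm \<dots> \<le> K' * (C0 * L' * r0 ^ n')"
      proof (rule bern_integral_bound)
        show "norm (g w * (F.T ^^ n') ?V w) \<le> K' * (C0 * L' * r0 ^ n')" for w
          unfolding norm_mult using KL' decay[OF allI[OF Vb] Vf] by (intro mult_mono gb) auto
      qed
      finally show "norm (\<integral>w. ?h (mix {..<0} \<eta> w) \<partial>?mu) \<le> K' * (C0 * L' * r0 ^ n')" .
    qed
    finally have 2: "norm (\<integral>w. Q ((shift ^^ n) w) * (e n w * V' w) \<partial>?mu) \<le> K' * (C0 * L' * r0 ^ n')"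
      by (simp add: split)
    have "norm (\<integral>w. P' ((shift ^^ n) w) * (e n w * V' w) \<partial>?mu) \<le> K' * \<kappa> ^ N * L' + K' * (C0 * L' * r0 ^ n')"
      using 1 2 norm_triangle_sub[of "\<integral>w. P' ((shift ^^ n) w) * (e n w * V' w) \<partial>?mu"
        "\<integral>w. Q ((shift ^^ n) w) * (e n w * V' w) \<partial>?mu"] by linarith
    also have "\<dots> \<le> K' * R ^ N * L' + K' * (C0 * L' * R ^ N)"
    proof -
      have "\<kappa> ^ N \<le> R ^ N" using \<kappa> R by (intro power_mono) auto
      moreover have "r0 ^ n' \<le> R ^ n'" using r0 R by (intro power_mono) auto
      moreover have "R ^ n' \<le> R ^ N" using R N by (intro power_decreasing) auto
      ultimately have "r0 ^ n' \<le> R ^ N" "\<kappa> ^ N \<le> R ^ N" by simp_all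
      then show ?thesis using KL' r0 by (intro add_mono mult_left_mono mult_right_mono) auto
    qed
    also have "\<dots> = K' * L' * (1 + C0) * R ^ N" by (simp add: algebra_simps)
    also have "\<dots> \<le> K' * L' * (1 + C0) * (inverse R * sqrt R ^ n)"
      unfolding N_def using KL' r0 R by (intro mult_left_mono half_power) auto
    also have "\<dots> = C * K * L * sqrt R ^ n" by (simp add: C_def K'_def L'_def mult_ac)
    finally show ?thesis by (simp add: eq)
  qed
  have "0 < sqrt R" "sqrt R < 1" using R by auto
  then show ?thesis using C bound by blast
qed

definition mixes :: "real \<Rightarrow> real \<Rightarrow> real \<Rightarrow> bool" where
  "mixes m r C \<longleftrightarrow> 0 < r \<and> r < 1 \<and> 0 < C \<and> (\<forall>k n K L P V. bosc_le future_eq K P \<longrightarrow> bosc_le (past_eq k) L V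
     \<longrightarrow> P \<in> seq_meas \<longrightarrow> V \<in> seq_meas
     \<longrightarrow> norm (\<integral>w. P ((shift ^^ (k + n)) w) * (cis (m * birkhoff_sum \<beta> n ((shift ^^ k) w)) * V w) \<partial>\<mu>)
          \<le> C * K * L * r ^ n)"

text \<open>Stationarity moves time \<open>k\<close> to time 0: composing \<open>V\<close> with
  \<open>unshift ^^ k\<close> turns a bound along \<open>past_eq k\<close> into one along
  \<open>past_eq 0\<close>.\<close>

lemma mixing:
  assumes ap: "aperiodic m"
  shows "\<exists>r C. mixes m r C"
proof -
  obtain r C where rC: "0 < r" "r < 1" "0 < C" and bound: "\<And>n K L P V. bosc_le future_eq K P \<Longrightarrow> bosc_le (past_eq 0) L V
     \<Longrightarrow> P \<in> seq_meas \<Longrightarrow> V \<in> seq_meas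
     \<Longrightarrow> norm (\<integral>w. P ((shift ^^ n) w) * (cis (m * birkhoff_sum \<beta> n w) * V w) \<partial>\<mu>)
          \<le> C * K * L * r ^ n"
    using mixing0[OF ap] by blast
  have "norm (\<integral>w. P ((shift ^^ (k + n)) w) * (cis (m * birkhoff_sum \<beta> n ((shift ^^ k) w)) * V w) \<partial>\<mu>)
          \<le> C * K * L * r ^ n"
    if P: "bosc_le future_eq K P" and V: "bosc_le (past_eq k) L V" and [measurable]: "P \<in> seq_meas" "V \<in> seq_meas"
    for k n K L P V
  proof -
    let ?V = "\<lambda>w. V ((unshift ^^ k) w)"
    let ?f = "\<lambda>w. P ((shift ^^ n) w) * (cis (m * birkhoff_sum \<beta> n w) * ?V w)"
    have us: "(unshift ^^ k) ((shift ^^ k) w) = w" for w by (simp add: shift_funpow unshift_funpow)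
    have "bosc_le (past_eq 0) L ?V"
      using past_eq_unshift[of 0 _ _ _ k] bosc_le_norm[OF V] osc_leD[OF bosc_le_osc_le[OF V]] by (intro bosc_leI osc_leI) auto
    then have "norm (\<integral>w. ?f w \<partial>\<mu>) \<le> C * K * L * r ^ n"
      using P by (intro bound) measurable
    moreover have "(\<integral>w. ?f ((shift ^^ k) w) \<partial>\<mu>) = (\<integral>w. ?f w \<partial>\<mu>)"
      by (rule integral_shift_funpow) measurable
    ultimately show ?thesis by (simp add: us add.commute[of k n] shift_add)
  qed
  then show ?thesis unfolding mixes_def using rC by blast
qed

end

lemma birkhoff_sum_add: "birkhoff_sum f (k + n) w = birkhoff_sum f k w + birkhoff_sum f n ((shift ^^ k) w)"
  by (induction n) (auto simp: birkhoff_sum_def shift_add add.commute[of k] simp flip: shift_add)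

lemma abs_two_Re_add_le: "\<bar>2 * Re (x + y)\<bar> \<le> 2 * (norm x + norm y)"
proof -
  have "\<bar>Re (x + y)\<bar> \<le> norm x + norm y"
    using abs_Re_le_cmod norm_triangle_ineq by (rule order_trans)
  then show ?thesis unfolding abs_le_iff by simp
qed

lemma measurable_cnj [measurable]:
  "f \<in> borel_measurable M \<Longrightarrow> (\<lambda>x. cnj (f x)) \<in> borel_measurable M"
  by (rule measurable_compose[OF _ borel_measurable_continuous_onI]) (auto intro: continuous_intros)

text \<open>One rate and one constant for the frequencies 1, 2, 4 and, in
  \<open>mixing_shift\<close>, for frequency 0. From here on the transfer operators enter through
  these two estimates alone.\<close>

locale mixing_cocycle = hoelder_cocycle +
  fixes r C :: real
  assumes r: "0 < r" "r < 1" and C: "0 < C"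
    and mixing_phase: "\<And>m k n K L P V. m \<in> {1, 2, 4} \<Longrightarrow> bosc_le future_eq K P \<Longrightarrow> bosc_le (past_eq k) L V
     \<Longrightarrow> P \<in> seq_meas \<Longrightarrow> V \<in> seq_meas
     \<Longrightarrow> norm (\<integral>w. P ((shift ^^ (k + n)) w) * (cis (m * birkhoff_sum \<beta> n ((shift ^^ k) w)) * V w) \<partial>\<mu>)
          \<le> C * K * L * r ^ n"
    and mixing_shift: "\<And>k n K L P V. bosc_le future_eq K P \<Longrightarrow> bosc_le (past_eq k) L V
     \<Longrightarrow> P \<in> seq_meas \<Longrightarrow> V \<in> seq_meas
     \<Longrightarrow> norm ((\<integral>w. P ((shift ^^ (k + n)) w) * V w \<partial>\<mu>)
            - (\<integral>w. P w \<partial>\<mu>) * (\<integral>w. V w \<partial>\<mu> :: complex))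
          \<le> C * K * L * r ^ n"

lemma (in hoelder_cocycle) mixing_cocycle_exists:
  assumes ap: "\<And>m. m \<in> {1, 2, 4} \<Longrightarrow> aperiodic m"
  shows "\<exists>r C. mixing_cocycle \<kappa> p \<beta> B r C"
proof -
  have "\<forall>m\<in>{1, 2, 4}. \<exists>r C. mixes m r C"
    using mixing ap by blast
  then obtain r C where mixes: "\<And>m. m \<in> {1, 2, 4} \<Longrightarrow> mixes m (r m) (C m)" by metis
  have rC: "0 < r m \<and> r m < 1 \<and> 0 < C m" if "m \<in> {1, 2, 4}" for m
    using mixes[OF that] unfolding mixes_def by blast
  have mx: "norm (\<integral>w. P ((shift ^^ (k + n)) w) * (cis (m * birkhoff_sum \<beta> n ((shift ^^ k) w)) * V w) \<partial>\<mu>)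
          \<le> C m * K * L * r m ^ n"
    if "m \<in> {1, 2, 4}" "bosc_le future_eq K P" "bosc_le (past_eq k) L V"
      "P \<in> seq_meas" "V \<in> seq_meas" for m k n K L P V
    using mixes[OF that(1)] that(2-5) unfolding mixes_def by blast
  obtain r' C' where rC': "0 < r'" "r' < 1" "0 < C'"
    and dc: "\<And>k n K L P V. bosc_le future_eq K P \<Longrightarrow> bosc_le (past_eq k) L V
     \<Longrightarrow> P \<in> seq_meas \<Longrightarrow> V \<in> seq_meas
     \<Longrightarrow> norm ((\<integral>w. P ((shift ^^ (k + n)) w) * V w \<partial>\<mu>)
            - (\<integral>w. P w \<partial>\<mu>) * (\<integral>w. V w \<partial>\<mu> :: complex))
          \<le> C' * K * L * r' ^ n"
    using decorrelation by blast
  define R where "R = Max ({r'} \<union> r ` {1, 2, 4})"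
  define D where "D = Max ({C'} \<union> C ` {1, 2, 4})"
  have R: "0 < R" "R < 1" "r' \<le> R" "m \<in> {1, 2, 4} \<Longrightarrow> r m \<le> R"
      and D: "0 < D" "C' \<le> D" "m \<in> {1, 2, 4} \<Longrightarrow> C m \<le> D" for m
    unfolding R_def D_def using rC' rC by (auto simp: Max_gr_iff)
  have le: "c * K * L * q ^ n \<le> D * K * L * R ^ n" if "0 < q" "q \<le> R" "0 < c" "c \<le> D" "0 \<le> K" "0 \<le> L" for c q K L n
    using that by (intro mult_mono power_mono mult_nonneg_nonneg) auto
  have "mixing_cocycle \<kappa> p \<beta> B R D"
  proof
    show "0 < R" "R < 1" "0 < D" using R D by auto
    fix k n K L and P V :: "symb_seq \<Rightarrow> complex"
    assume PV: "bosc_le future_eq K P" "bosc_le (past_eq k) L V" "P \<in> seq_meas" "V \<in> seq_meas"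
    have KL: "0 \<le> K" "0 \<le> L" using PV(1,2) by (auto intro: bosc_le_nonneg)
    show "norm ((\<integral>w. P ((shift ^^ (k + n)) w) * V w \<partial>\<mu>)
            - (\<integral>w. P w \<partial>\<mu>) * (\<integral>w. V w \<partial>\<mu> :: complex))
          \<le> D * K * L * R ^ n"
      using dc[OF PV, of n] le[OF rC'(1) R(3) rC'(3) D(2) KL, of n] by linarith
    fix m :: real assume m: "m \<in> {1, 2, 4}"
    show "norm (\<integral>w. P ((shift ^^ (k + n)) w) * (cis (m * birkhoff_sum \<beta> n ((shift ^^ k) w)) * V w) \<partial>\<mu>)
          \<le> D * K * L * R ^ n"
      using mx[OF m PV, of n] le[OF _ R(4)[OF m] _ D(3)[OF m] KL, of n] rC[OF m] by linarith
  qed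
  then show ?thesis by blast
qed

section \<open>Decay of correlations of the observables\<close>

context mixing_cocycle
begin

definition E :: real where "E = 1 + 4 * (B / (1 - \<kappa>))"

lemma E_ge1: "1 \<le> E"
  using B_nonneg \<kappa> by (simp add: E_def)

lemma bosc_le_phase:
  assumes S: "osc_le R (B / (1 - \<kappa>)) S" and m: "\<bar>m\<bar> \<le> 4"
  shows "bosc_le R E (\<lambda>w. cis (m * (s + S w)))"
proof -
  have c: "0 \<le> B / (1 - \<kappa>)" using B_nonneg \<kappa> by simp
  have "osc_le R 0 (\<lambda>w. s)" by (simp add: osc_le_def)
  from osc_le_add[OF this S] have "osc_le R (B / (1 - \<kappa>)) (\<lambda>w. s + S w)" by simp
  then have "bosc_le R (1 + \<bar>m\<bar> * (B / (1 - \<kappa>))) (\<lambda>w. cis (m * (s + S w)))"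
    using mult_nonneg_nonneg[OF abs_ge_zero c] by (intro bosc_le_cis osc_le_cmult) auto
  moreover have "\<bar>m\<bar> * (B / (1 - \<kappa>)) \<le> 4 * (B / (1 - \<kappa>))" using m c by (rule mult_right_mono)
  ultimately show ?thesis unfolding E_def by (elim bosc_le_mono) simp
qed

lemma birkhoff_past_eq: "osc_le (past_eq k) (B / (1 - \<kappa>)) (birkhoff_sum \<beta> k)"
  unfolding birkhoff_sum_def
  by (rule osc_le_past_eq_sum) (use osc_le_past_eq_shift[OF \<beta>_past_eq] B_nonneg in auto)

lemma birkhoff_future_eq: "osc_le future_eq (B / (1 - \<kappa>)) (birkhoff_sum \<beta> k)"
  unfolding birkhoff_sum_def
  by (rule osc_le_future_eq_sum) (use osc_le_future_eq_shift[OF \<beta>_future_eq] B_nonneg in auto)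

lemma phase_past_eq: "\<bar>m\<bar> \<le> 4 \<Longrightarrow> bosc_le (past_eq k) E (\<lambda>w. cis (m * (s + birkhoff_sum \<beta> k w)))"
  by (rule bosc_le_phase[OF birkhoff_past_eq])

lemma phase_future_eq: "\<bar>m\<bar> \<le> 4 \<Longrightarrow> bosc_le future_eq E (\<lambda>w. cis (m * birkhoff_sum \<beta> k w))"
  using bosc_le_phase[OF birkhoff_future_eq, of m 0] by simp

text \<open>
  The phase is \<open>2m\<close> times the sum over the first \<open>k\<close> steps plus \<open>m\<close> times the sum over the remaining
  \<open>n - k\<close> steps. The longer of the two blocks supplies the decay, the other one is absorbed
  into the observable at its end or at its beginning. This is where frequency 4 is needed.
\<close>

lemma phase_correlation:
  assumes m: "m \<in> {1, 2}" and P: "bosc_le future_eq K P" and Qs: "bosc_le future_eq L Q" and Qu: "bosc_le (past_eq 0) L Q"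
    and [measurable]: "P \<in> seq_meas" "Q \<in> seq_meas" and kn: "k \<le> n"
  shows "norm (\<integral>w. P ((shift ^^ n) w) * cis (m * birkhoff_sum \<beta> n w)
             * Q ((shift ^^ k) w) * cis (m * birkhoff_sum \<beta> k w) \<partial>\<mu>)
          \<le> 4 * C * E * K * L * sqrt r ^ n"
proof -
  define d where "d = n - k"
  have n: "n = k + d" using kn by (simp add: d_def)
  have KL: "0 \<le> K" "0 \<le> L" using P Qs by (auto intro: bosc_le_nonneg)
  have m': "\<bar>m\<bar> \<le> 4" "\<bar>2 * m\<bar> \<le> 4" "m \<in> {1, 2, 4}" "2 * m \<in> {1, 2, 4}" using m by auto
  have pw: "r ^ j \<le> sqrt r ^ n" if "n \<le> 2 * j" for j
    using r that by (rule power_le_sqrt_power)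
  show ?thesis
  proof (cases "2 * k \<le> n")
    case True
    let ?V = "\<lambda>w. Q ((shift ^^ k) w) * cis ((2 * m) * (0 + birkhoff_sum \<beta> k w))"
    have "cis (m * birkhoff_sum \<beta> (k + d) w) * cis (m * birkhoff_sum \<beta> k w)
       = cis (m * birkhoff_sum \<beta> d ((shift ^^ k) w)) * cis ((2 * m) * (0 + birkhoff_sum \<beta> k w))" for w
      unfolding birkhoff_sum_add cis_mult by (simp add: algebra_simps)
    then have pt: "P ((shift ^^ n) w) * cis (m * birkhoff_sum \<beta> n w)
             * Q ((shift ^^ k) w) * cis (m * birkhoff_sum \<beta> k w)
        = P ((shift ^^ (k + d)) w) * (cis (m * birkhoff_sum \<beta> d ((shift ^^ k) w)) * ?V w)" for w
      unfolding n by (simp add: mult_ac)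
    have "bosc_le (past_eq k) (2 * L * E) ?V"
      using bosc_le_past_eq_shift[OF Qu, of k] by (intro bosc_le_mult phase_past_eq m') auto
    then have "norm (\<integral>w. P ((shift ^^ (k + d)) w) * (cis (m * birkhoff_sum \<beta> d ((shift ^^ k) w)) * ?V w) \<partial>\<mu>)
       \<le> C * K * (2 * L * E) * r ^ d"
      by (intro mixing_phase[OF m'(3) P]) measurable
    also have "C * K * (2 * L * E) * r ^ d \<le> C * K * (4 * L * E) * sqrt r ^ n"
      using True n KL C E_ge1 r by (intro mult_mono pw) auto
    also have "\<dots> = 4 * C * E * K * L * sqrt r ^ n" by (simp add: mult_ac)
    finally show ?thesis by (simp only: pt)
  next
    case False
    let ?P = "\<lambda>w. P ((shift ^^ d) w) * (cis (m * birkhoff_sum \<beta> d w) * Q w)"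
    have "cis (m * birkhoff_sum \<beta> (k + d) w) * cis (m * birkhoff_sum \<beta> k w)
       = cis (m * birkhoff_sum \<beta> d ((shift ^^ k) w)) * cis ((2 * m) * birkhoff_sum \<beta> k w)" for w
      unfolding birkhoff_sum_add cis_mult by (simp add: algebra_simps)
    then have pt: "P ((shift ^^ n) w) * cis (m * birkhoff_sum \<beta> n w)
             * Q ((shift ^^ k) w) * cis (m * birkhoff_sum \<beta> k w)
        = ?P ((shift ^^ (0 + k)) w) * (cis ((2 * m) * birkhoff_sum \<beta> k ((shift ^^ 0) w)) * 1)" for w
      unfolding n add.commute[of k d] shift_add by (simp add: mult_ac)
    have P': "bosc_le future_eq (2 * K * (2 * E * L)) ?P"
      by (intro bosc_le_mult bosc_le_future_eq_shift P Qs phase_future_eq m')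
    have one: "bosc_le (past_eq 0) 1 (\<lambda>w. 1 :: complex)" by (rule bosc_le_const) simp
    have "norm (\<integral>w. ?P ((shift ^^ (0 + k)) w) * (cis ((2 * m) * birkhoff_sum \<beta> k ((shift ^^ 0) w)) * 1) \<partial>\<mu>)
       \<le> C * (2 * K * (2 * E * L)) * 1 * r ^ k"
      by (rule mixing_phase[OF m'(4) P' one]) measurable
    also have "C * (2 * K * (2 * E * L)) * 1 * r ^ k \<le> C * (2 * K * (2 * E * L)) * 1 * sqrt r ^ n"
      using False KL C E_ge1 r by (intro mult_left_mono pw) auto
    also have "\<dots> = 4 * C * E * K * L * sqrt r ^ n" by (simp add: mult_ac)
    finally show ?thesis by (simp only: pt)
  qed
qed

text \<open>Use \<open>2 * Re x * (2 * Re y) = 2 * Re (x * y + x * cnj y)\<close>. In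
  \<open>x * y\<close> the phases add up and \<open>phase_correlation\<close> gives decay in
  \<open>n\<close>; in \<open>x * cnj y\<close> they cancel up to time \<open>k\<close> and
  frequency \<open>m\<close> mixes over the remaining \<open>n - k\<close> steps. The constant 10 is
  \<open>2 * (4 + 1)\<close>.\<close>

lemma observable_correlation:
  assumes m: "m \<in> {1, 2}" and P: "bosc_le future_eq K P" and Qs: "bosc_le future_eq L Q" and Qu: "bosc_le (past_eq 0) L Q"
    and [measurable]: "P \<in> seq_meas" "Q \<in> seq_meas" and kn: "k \<le> n"
  shows "\<bar>\<integral>w. (2 * Re (P ((shift ^^ n) w) * cis (m * angle \<beta> s n w)))
             * (2 * Re (Q ((shift ^^ k) w) * cis (m * angle \<beta> s k w))) \<partial>\<mu>\<bar>
          \<le> 10 * C * E * K * L * sqrt r ^ (n - k)"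
proof -
  let ?mu = "bernoulli_measure p"
  define d where "d = n - k"
  have n: "n = k + d" using kn by (simp add: d_def)
  have KL: "0 \<le> K" "0 \<le> L" using P Qs by (auto intro: bosc_le_nonneg)
  have m': "\<bar>m\<bar> \<le> 4" "m \<in> {1, 2, 4}" using m by auto
  have sr: "0 < sqrt r" "sqrt r \<le> 1" using r by auto
  define f where "f w = cis (2 * m * s) * (P ((shift ^^ n) w) * cis (m * birkhoff_sum \<beta> n w)
             * Q ((shift ^^ k) w) * cis (m * birkhoff_sum \<beta> k w))" for w
  define g where "g w = P ((shift ^^ (k + d)) w) * (cis (m * birkhoff_sum \<beta> d ((shift ^^ k) w)) * cnj (Q ((shift ^^ k) w)))" for w
  have [measurable]: "f \<in> seq_meas" "g \<in> seq_meas"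
    unfolding f_def[abs_def] g_def[abs_def] by measurable
  have fb: "norm (f w) \<le> K * L" and gb: "norm (g w) \<le> K * L" for w
    unfolding f_def g_def using KL by (auto simp: norm_mult intro!: mult_mono bosc_le_norm[OF P] bosc_le_norm[OF Qs])
  have int: "integrable ?mu f" "integrable ?mu g"
    by (rule bern_integrable[OF _ fb], measurable) (rule bern_integrable[OF _ gb], measurable)
  have re: "(2 * Re x) * (2 * Re y) = 2 * Re (x * y + x * cnj y)" for x y :: complex
    by (simp add: algebra_simps)
  have "(2 * Re (P ((shift ^^ n) w) * cis (m * angle \<beta> s n w)))
      * (2 * Re (Q ((shift ^^ k) w) * cis (m * angle \<beta> s k w))) = 2 * Re (f w + g w)" for w
  proof -
    have "cis (m * angle \<beta> s n w) * cis (m * angle \<beta> s k w)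
      = cis (2 * m * s) * (cis (m * birkhoff_sum \<beta> n w) * cis (m * birkhoff_sum \<beta> k w))"
      unfolding cis_mult angle_def by (simp add: algebra_simps)
    then have 1: "(P ((shift ^^ n) w) * cis (m * angle \<beta> s n w)) * (Q ((shift ^^ k) w) * cis (m * angle \<beta> s k w)) = f w"
      unfolding f_def by (simp add: mult_ac)
    have "cis (m * angle \<beta> s n w) * cnj (cis (m * angle \<beta> s k w)) = cis (m * birkhoff_sum \<beta> d ((shift ^^ k) w))"
      unfolding cis_cnj cis_mult angle_def n birkhoff_sum_add by (simp add: algebra_simps)
    then have 2: "(P ((shift ^^ n) w) * cis (m * angle \<beta> s n w)) * cnj (Q ((shift ^^ k) w) * cis (m * angle \<beta> s k w)) = g w"
      unfolding g_def n by (simp add: mult_ac)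
    show ?thesis unfolding re 1 2 ..
  qed
  then have "(\<integral>w. (2 * Re (P ((shift ^^ n) w) * cis (m * angle \<beta> s n w)))
      * (2 * Re (Q ((shift ^^ k) w) * cis (m * angle \<beta> s k w))) \<partial>?mu) = (\<integral>w. 2 * Re (f w + g w) \<partial>?mu)"
    by simp
  also have "\<dots> = 2 * Re (\<integral>w. f w + g w \<partial>?mu)"
    using int by (simp add: integral_Re)
  also have "\<dots> = 2 * Re ((\<integral>w. f w \<partial>?mu) + (\<integral>w. g w \<partial>?mu))"
    using int by simp
  finally have eq: "(\<integral>w. (2 * Re (P ((shift ^^ n) w) * cis (m * angle \<beta> s n w)))
      * (2 * Re (Q ((shift ^^ k) w) * cis (m * angle \<beta> s k w))) \<partial>?mu)
      = 2 * Re ((\<integral>w. f w \<partial>?mu) + (\<integral>w. g w \<partial>?mu))" .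
  have "norm (\<integral>w. f w \<partial>?mu) \<le> 4 * C * E * K * L * sqrt r ^ n"
    unfolding f_def integral_mult_right_zero norm_mult norm_cis mult_1
    by (rule phase_correlation[OF m P Qs Qu _ _ kn]) measurable
  also have "\<dots> \<le> 4 * C * E * K * L * sqrt r ^ (n - k)"
    using C E_ge1 KL sr by (intro mult_left_mono power_decreasing) auto
  finally have F: "norm (\<integral>w. f w \<partial>?mu) \<le> 4 * C * E * K * L * sqrt r ^ (n - k)" .
  have "norm (\<integral>w. g w \<partial>?mu) \<le> C * K * L * r ^ d"
    unfolding g_def using bosc_le_past_eq_shift[OF Qu, of k] by (intro mixing_phase[OF m'(2) P] bosc_le_cnj) (auto, measurable)
  also have "\<dots> \<le> C * K * L * sqrt r ^ d"
  proof -
    have "r \<le> sqrt r" using r by (simp add: real_le_rsqrt power_le_one power2_eq_square mult_left_le)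
    then show ?thesis using C KL r by (intro mult_left_mono power_mono) auto
  qed
  also have "\<dots> \<le> C * E * K * L * sqrt r ^ d"
    using C KL E_ge1 sr by (intro mult_right_mono) (auto simp: mult_le_cancel_left1)
  finally have G: "norm (\<integral>w. g w \<partial>?mu) \<le> C * E * K * L * sqrt r ^ (n - k)" by (simp add: d_def)
  have "\<bar>2 * Re ((\<integral>w. f w \<partial>?mu) + (\<integral>w. g w \<partial>?mu))\<bar> \<le> 2 * (norm (\<integral>w. f w \<partial>?mu) + norm (\<integral>w. g w \<partial>?mu))"
    by (rule abs_two_Re_add_le)
  also have "\<dots> \<le> 2 * (4 * C * E * K * L * sqrt r ^ (n - k) + C * E * K * L * sqrt r ^ (n - k))"
    by (intro mult_left_mono add_mono F G) simp
  finally show ?thesis unfolding eq by (simp add: algebra_simps)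
qed

end

section \<open>First and second moments against an observable of the past\<close>

locale clt_setup = mixing_cocycle +
  fixes A :: "symb_seq \<Rightarrow> complex" and M s0 :: real
  assumes A_future_eq: "bosc_le future_eq M A" and A_past_eq: "bosc_le (past_eq 0) M A" and A_meas [measurable]: "A \<in> seq_meas"
begin

text \<open>The factor 1 is the frequency, written out to match the general shape
  \<open>cis (m * (s + S w))\<close> of the phase estimates.\<close>

definition Z :: "nat \<Rightarrow> symb_seq \<Rightarrow> complex" where
  "Z n w = A ((shift ^^ n) w) * cis (1 * (s0 + birkhoff_sum \<beta> n w))"

definition X :: "nat \<Rightarrow> symb_seq \<Rightarrow> real" where
  "X n w = 2 * Re (Z n w)"

definition MX :: real where "MX = 4 * M * E"

lemma Z_meas [measurable]: "Z n \<in> seq_meas"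
  unfolding Z_def[abs_def] by measurable

lemma X_meas [measurable]: "X n \<in> seq_meas"
  unfolding X_def[abs_def] by measurable

lemma M_nonneg: "0 \<le> M"
  using A_future_eq by (rule bosc_le_nonneg)

lemma MX_nonneg: "0 \<le> MX"
  using M_nonneg E_ge1 by (simp add: MX_def)

lemma Z_past_eq: "bosc_le (past_eq n) (2 * M * E) (Z n)"
  unfolding Z_def[abs_def] using bosc_le_past_eq_shift[OF A_past_eq, of n] by (intro bosc_le_mult phase_past_eq) auto

lemma of_real_X: "complex_of_real (X n w) = Z n w + cnj (Z n w)"
  by (simp add: X_def complex_add_cnj)

lemma X_past_eq: "bosc_le (past_eq n) MX (X n)"
proof -
  have z: "bosc_le (past_eq n) (2 * M * E) (\<lambda>w. Re (Z n w))" by (rule bosc_le_Re[OF Z_past_eq])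
  show ?thesis
  proof (rule bosc_leI)
    show "norm (X n w) \<le> MX" for w using bosc_le_norm[OF z, of w] by (simp add: X_def MX_def)
    show "osc_le (past_eq n) MX (X n)" using osc_le_cmult[OF bosc_le_osc_le[OF z], of 2] by (simp add: X_def[abs_def] MX_def mult_ac)
  qed
qed

lemma X_bound: "\<bar>X n w\<bar> \<le> MX"
  using bosc_le_norm[OF X_past_eq] by simp

definition cor :: "nat \<Rightarrow> complex" where
  "cor d = (\<integral>w. A ((shift ^^ d) w) * cnj (A w) * cis (birkhoff_sum \<beta> d w) \<partial>\<mu>)"

lemma cor_bound: "norm (cor d) \<le> C * M * M * r ^ d"
proof -
  have "norm (\<integral>w. A ((shift ^^ (0 + d)) w) * (cis (1 * birkhoff_sum \<beta> d ((shift ^^ 0) w)) * cnj (A w)) \<partial>\<mu>)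
      \<le> C * M * M * r ^ d"
    by (intro mixing_phase A_future_eq bosc_le_cnj A_past_eq) (auto, measurable)
  then show ?thesis by (simp add: cor_def mult_ac)
qed

lemma bosc_le_mult_X: "bosc_le (past_eq k) L V \<Longrightarrow> bosc_le (past_eq k) (2 * L * MX) (\<lambda>w. V w * complex_of_real (X k w))"
  by (intro bosc_le_mult bosc_le_of_real X_past_eq)

text \<open>The conditional mean of \<open>X n\<close> given the past of time \<open>k\<close> is
  exponentially small: the phase up to time \<open>k\<close> is joined to \<open>V\<close>, and
  frequency 1 mixes from \<open>k\<close> to \<open>n\<close>. The conjugate half follows by
  conjugating \<open>V\<close>.\<close>

lemma first_order:
  assumes V: "bosc_le (past_eq k) L V" and [measurable]: "V \<in> seq_meas" and kn: "k \<le> n"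
  shows "norm (\<integral>w. V w * complex_of_real (X n w) \<partial>\<mu>) \<le> 4 * C * M * E * L * r ^ (n - k)"
proof -
  let ?mu = "bernoulli_measure p"
  define d where "d = n - k"
  have n: "n = k + d" using kn by (simp add: d_def)
  have z: "norm (\<integral>w. V w * Z n w \<partial>?mu) \<le> C * M * (2 * E * L) * r ^ d"
    if V: "bosc_le (past_eq k) L V" and [measurable]: "V \<in> seq_meas" for V
  proof -
    let ?V = "\<lambda>w. cis (1 * (s0 + birkhoff_sum \<beta> k w)) * V w"
    have "norm (\<integral>w. A ((shift ^^ (k + d)) w) * (cis (1 * birkhoff_sum \<beta> d ((shift ^^ k) w)) * ?V w) \<partial>?mu)
      \<le> C * M * (2 * E * L) * r ^ d"
      by (intro mixing_phase A_future_eq bosc_le_mult phase_past_eq V) (auto, measurable)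
    moreover have "A ((shift ^^ (k + d)) w) * (cis (1 * birkhoff_sum \<beta> d ((shift ^^ k) w)) * ?V w) = V w * Z n w" for w
    proof -
      have "cis (1 * (s0 + birkhoff_sum \<beta> n w))
        = cis (1 * birkhoff_sum \<beta> d ((shift ^^ k) w)) * cis (1 * (s0 + birkhoff_sum \<beta> k w))"
        unfolding n birkhoff_sum_add cis_mult by (simp add: algebra_simps)
      then show ?thesis unfolding Z_def n by (simp add: mult_ac)
    qed
    ultimately show ?thesis by (simp only:)
  qed
  have zc: "norm (\<integral>w. V w * cnj (Z n w) \<partial>?mu) \<le> C * M * (2 * E * L) * r ^ d"
  proof -
    have "(\<integral>w. V w * cnj (Z n w) \<partial>?mu) = cnj (\<integral>w. cnj (V w) * Z n w \<partial>?mu)"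
      by (simp flip: Bochner_Integration.integral_cnj)
    then show ?thesis using z[OF bosc_le_cnj[OF V]] by simp
  qed
  have i: "integrable ?mu (\<lambda>w. V w * Z n w)" "integrable ?mu (\<lambda>w. V w * cnj (Z n w))"
    using bosc_le_nonneg[OF V] bosc_le_nonneg[OF Z_past_eq]
    by (auto intro!: bern_integrable[of _ "L * (2 * M * E)"] simp: norm_mult intro!: mult_mono bosc_le_norm[OF V] bosc_le_norm[OF Z_past_eq])
  have "(\<integral>w. V w * complex_of_real (X n w) \<partial>?mu) = (\<integral>w. V w * Z n w \<partial>?mu) + (\<integral>w. V w * cnj (Z n w) \<partial>?mu)"
    unfolding of_real_X distrib_left using i by (rule Bochner_Integration.integral_add)
  then have "norm (\<integral>w. V w * complex_of_real (X n w) \<partial>?mu) \<le> C * M * (2 * E * L) * r ^ d + C * M * (2 * E * L) * r ^ d"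
    using norm_triangle_mono[OF z[OF V] zc] by simp
  then show ?thesis by (simp add: d_def mult_ac)
qed

text \<open>\<open>V * X l\<close> is itself an observable of the past of time \<open>l\<close>, so
  the first moment estimate applies across the gap \<open>n - l\<close>. This is good when
  \<open>l\<close> is close to \<open>k\<close>.\<close>

lemma second_order_near:
  assumes V: "bosc_le (past_eq k) L V" and [measurable]: "V \<in> seq_meas" and kl: "k \<le> l" "l \<le> n"
  shows "norm (\<integral>w. V w * complex_of_real (X l w) * complex_of_real (X n w) \<partial>\<mu>)
     \<le> 8 * C * M * E * MX * L * r ^ (n - l)"
  using first_order[OF bosc_le_mult_X[OF bosc_le_past_eq_mono[OF V kl(1)]] _ kl(2)] by (simp add: mult_ac)

text \<open>Here \<open>X l * X n\<close> is one observable started at time \<open>l\<close>, far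
  from \<open>k\<close>. Of its four terms, \<open>Z n * Z l\<close> carries frequency 2 at time
  \<open>l\<close> and mixes to zero, while \<open>Z n * cnj (Z l)\<close> is a function of
  \<open>shift ^^ l\<close> of frequency 0 and decorrelates from \<open>V\<close>, leaving its mean
  \<open>cor (n - l)\<close>. The other two terms are conjugates of these.\<close>

lemma second_order_far:
  assumes V: "bosc_le (past_eq k) L V" and [measurable]: "V \<in> seq_meas" and kl: "k \<le> l" "l \<le> n"
  shows "norm ((\<integral>w. V w * complex_of_real (X l w) * complex_of_real (X n w) \<partial>\<mu>)
      - complex_of_real (2 * Re (cor (n - l))) * (\<integral>w. V w \<partial>\<mu>))
     \<le> 24 * C * M * M * E * E * L * r ^ (l - k)"
proof -
  let ?mu = "bernoulli_measure p"
  define d where "d = n - l"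
  define e where "e = l - k"
  have n: "n = l + d" and l: "l = k + e" using kl by (auto simp: d_def e_def)
  have L: "0 \<le> L" using V by (rule bosc_le_nonneg)
  define W where "W w = A ((shift ^^ d) w) * (cis (1 * birkhoff_sum \<beta> d w) * A w)" for w
  define H where "H w = A ((shift ^^ d) w) * (cis (1 * birkhoff_sum \<beta> d w) * cnj (A w))" for w
  define MH where "MH = 2 * M * (2 * E * M)"
  have WH: "bosc_le future_eq MH W" "bosc_le future_eq MH H"
    unfolding W_def[abs_def] H_def[abs_def] MH_def
    by (intro bosc_le_mult bosc_le_future_eq_shift A_future_eq phase_future_eq bosc_le_cnj; simp)+
  have [measurable]: "W \<in> seq_meas" "H \<in> seq_meas"
    unfolding W_def[abs_def] H_def[abs_def] by measurable
  have MH: "0 \<le> MH" using WH(1) by (rule bosc_le_nonneg)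
  have Zprod: "Z n w * Z l w = W ((shift ^^ l) w) * cis (2 * (s0 + birkhoff_sum \<beta> l w))"
    and Zcprod: "Z n w * cnj (Z l w) = H ((shift ^^ l) w)" for w
  proof -
    have "cis (1 * (s0 + birkhoff_sum \<beta> n w)) * cis (1 * (s0 + birkhoff_sum \<beta> l w))
      = cis (1 * birkhoff_sum \<beta> d ((shift ^^ l) w)) * cis (2 * (s0 + birkhoff_sum \<beta> l w))"
      unfolding n birkhoff_sum_add cis_mult by (simp add: algebra_simps)
    then show "Z n w * Z l w = W ((shift ^^ l) w) * cis (2 * (s0 + birkhoff_sum \<beta> l w))"
      unfolding Z_def W_def n add.commute[of l d] shift_add by (simp add: mult_ac)
    have "cis (1 * (s0 + birkhoff_sum \<beta> n w)) * cnj (cis (1 * (s0 + birkhoff_sum \<beta> l w)))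
      = cis (1 * birkhoff_sum \<beta> d ((shift ^^ l) w))"
      unfolding n birkhoff_sum_add cis_cnj cis_mult by (simp add: algebra_simps)
    then show "Z n w * cnj (Z l w) = H ((shift ^^ l) w)"
      unfolding Z_def H_def n add.commute[of l d] shift_add by (simp add: mult_ac)
  qed
  define x where "x V w = V w * (Z n w * Z l w)" for V w
  define y where "y H V w = H ((shift ^^ l) w) * V w" for H V :: "symb_seq \<Rightarrow> complex" and w
  have xb: "norm (\<integral>w. x V w \<partial>?mu) \<le> C * MH * (2 * E * L) * r ^ e"
    if V: "bosc_le (past_eq k) L V" and [measurable]: "V \<in> seq_meas" for V
  proof -
    let ?V = "\<lambda>w. cis (2 * (s0 + birkhoff_sum \<beta> k w)) * V w"
    have "norm (\<integral>w. W ((shift ^^ (k + e)) w) * (cis (2 * birkhoff_sum \<beta> e ((shift ^^ k) w)) * ?V w) \<partial>?mu)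
      \<le> C * MH * (2 * E * L) * r ^ e"
      by (intro mixing_phase WH bosc_le_mult phase_past_eq V) (auto, measurable)
    moreover have "W ((shift ^^ (k + e)) w) * (cis (2 * birkhoff_sum \<beta> e ((shift ^^ k) w)) * ?V w) = x V w" for w
    proof -
      have "cis (2 * (s0 + birkhoff_sum \<beta> l w))
        = cis (2 * birkhoff_sum \<beta> e ((shift ^^ k) w)) * cis (2 * (s0 + birkhoff_sum \<beta> k w))"
        unfolding l birkhoff_sum_add cis_mult by (simp add: algebra_simps)
      note phase = this
      show ?thesis unfolding x_def Zprod phase by (simp only: l mult_ac)
    qed
    ultimately show ?thesis by (simp only:)
  qed
  have xcb: "norm (\<integral>w. cnj (x (\<lambda>w. cnj (V w)) w) \<partial>?mu) \<le> C * MH * (2 * E * L) * r ^ e"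
    unfolding Bochner_Integration.integral_cnj complex_mod_cnj using bosc_le_cnj[OF V] by (intro xb) measurable
  have yb: "norm ((\<integral>w. y H V w \<partial>?mu) - (\<integral>w. H w \<partial>?mu) * (\<integral>w. V w \<partial>?mu)) \<le> C * MH * L * r ^ e"
    if "bosc_le future_eq MH H" and [measurable]: "H \<in> seq_meas" for H
    unfolding y_def l using that V by (intro mixing_shift) measurable
  have [measurable]: "x V \<in> seq_meas" "y H V \<in> seq_meas"
    if [measurable]: "V \<in> seq_meas" "H \<in> seq_meas" for V H
    unfolding x_def[abs_def] y_def[abs_def] by measurable
  have ZM: "0 \<le> 2 * M * E" using bosc_le_nonneg[OF Z_past_eq] .
  have ix: "integrable ?mu (x V)" if V: "bosc_le (past_eq k) L V" and [measurable]: "V \<in> seq_meas" for V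
  proof (rule bern_integrable)
    show "norm (x V w) \<le> L * ((2 * M * E) * (2 * M * E))" for w
      unfolding x_def norm_mult
      using L M_nonneg E_ge1 by (intro mult_mono bosc_le_norm[OF V] bosc_le_norm[OF Z_past_eq] mult_nonneg_nonneg) auto
  qed measurable
  have iy: "integrable ?mu (y H V)" if H: "bosc_le future_eq MH H" and [measurable]: "H \<in> seq_meas" for H
    by (rule bern_integrable[of _ "MH * L"])
      (use L MH in \<open>auto simp: y_def norm_mult intro!: mult_mono bosc_le_norm[OF V] bosc_le_norm[OF H]\<close>)
  let ?cH = "\<lambda>w. cnj (H w)" and ?cV = "\<lambda>w. cnj (V w)"
  have int: "integrable ?mu (x V)" "integrable ?mu (\<lambda>w. cnj (x ?cV w))" "integrable ?mu (y H V)" "integrable ?mu (y ?cH V)"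
    using V bosc_le_cnj[OF V] WH(2) bosc_le_cnj[OF WH(2)] by (auto intro!: ix iy)
  have "V w * complex_of_real (X l w) * complex_of_real (X n w) = (x V w + cnj (x ?cV w)) + (y H V w + y ?cH V w)" for w
    unfolding of_real_X x_def y_def Zcprod[symmetric] by (simp add: algebra_simps)
  then have 1: "(\<integral>w. V w * complex_of_real (X l w) * complex_of_real (X n w) \<partial>?mu)
    = ((\<integral>w. x V w \<partial>?mu) + (\<integral>w. cnj (x ?cV w) \<partial>?mu)) + ((\<integral>w. y H V w \<partial>?mu) + (\<integral>w. y ?cH V w \<partial>?mu))"
    using int by simp
  have "(\<integral>w. H w \<partial>?mu) = cor d" by (simp add: cor_def H_def mult_ac)
  then have 2: "complex_of_real (2 * Re (cor (n - l))) = (\<integral>w. H w \<partial>?mu) + (\<integral>w. ?cH w \<partial>?mu)"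
    by (simp add: d_def complex_add_cnj Bochner_Integration.integral_cnj)
  have "(\<integral>w. V w * complex_of_real (X l w) * complex_of_real (X n w) \<partial>?mu)
      - complex_of_real (2 * Re (cor (n - l))) * (\<integral>w. V w \<partial>?mu)
    = ((\<integral>w. x V w \<partial>?mu) + (\<integral>w. cnj (x ?cV w) \<partial>?mu))
     + (((\<integral>w. y H V w \<partial>?mu) - (\<integral>w. H w \<partial>?mu) * (\<integral>w. V w \<partial>?mu))
     + ((\<integral>w. y ?cH V w \<partial>?mu) - (\<integral>w. ?cH w \<partial>?mu) * (\<integral>w. V w \<partial>?mu)))"
    unfolding 1 2 by (simp add: algebra_simps)
  also have "norm \<dots> \<le> (C * MH * (2 * E * L) * r ^ e + C * MH * (2 * E * L) * r ^ e) + (C * MH * L * r ^ e + C * MH * L * r ^ e)"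
    using xb[OF V] xcb yb[OF WH(2)] yb[OF bosc_le_cnj[OF WH(2)]] by (intro norm_triangle_mono) measurable
  also have "C * MH * L * r ^ e \<le> C * MH * (E * L) * r ^ e"
    using E_ge1 C MH L r by (intro mult_left_mono mult_right_mono) (auto simp: mult_le_cancel_right1)
  finally have "norm ((\<integral>w. V w * complex_of_real (X l w) * complex_of_real (X n w) \<partial>?mu)
      - complex_of_real (2 * Re (cor (n - l))) * (\<integral>w. V w \<partial>?mu)) \<le> 6 * C * MH * E * L * r ^ e"
    by (simp add: algebra_simps)
  then show ?thesis by (simp add: MH_def e_def mult_ac)
qed

end

section \<open>The characteristic function of the normalized sums\<close>

lemma cis_taylor2: "norm (cis z - (1 + \<i> * of_real z - of_real (z\<^sup>2 / 2))) \<le> \<bar>z\<bar> ^ 3"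
proof -
  have "norm (iexp z - (\<Sum>k\<le>2. (\<i> * z) ^ k / fact k)) \<le> \<bar>z\<bar> ^ Suc 2 / fact (Suc 2)"
    by (rule iexp_approx1)
  also have "(\<Sum>k\<le>2. (\<i> * z) ^ k / fact k) = 1 + \<i> * of_real z - of_real (z\<^sup>2 / 2)"
    by (simp add: numeral_2_eq_2 power2_eq_square algebra_simps)
  also have "\<bar>z\<bar> ^ Suc 2 / fact (Suc 2) \<le> \<bar>z\<bar> ^ 3"
    using zero_le_power[OF abs_ge_zero, of z 3] by (simp add: fact_numeral)
  finally show ?thesis by (simp add: cis_conv_exp)
qed

context clt_setup
begin

definition c :: "nat \<Rightarrow> real" where "c d = 2 * Re (cor d)"

text \<open>The Green-Kubo sum cut at lag \<open>g\<close>: an expansion around time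
  \<open>n - g\<close> sees no longer lags.\<close>

definition var_upto :: "nat \<Rightarrow> real" where
  "var_upto g = c 0 + 2 * (\<Sum>d<g. c (Suc d))"

definition var_lim :: real where
  "var_lim = c 0 + 2 * (\<Sum>d. c (Suc d))"

definition Y :: "nat \<Rightarrow> symb_seq \<Rightarrow> real" where
  "Y n w = (\<Sum>j<n. X j w)"

definition \<Phi> :: "real \<Rightarrow> nat \<Rightarrow> symb_seq \<Rightarrow> complex" where
  "\<Phi> a n w = cis (a * Y n w)"

definition \<psi> :: "real \<Rightarrow> nat \<Rightarrow> complex" where
  "\<psi> a n = (\<integral>w. \<Phi> a n w \<partial>\<mu>)"

definition L\<Phi> :: "real \<Rightarrow> real" where
  "L\<Phi> a = 1 + \<bar>a\<bar> * (MX / (1 - \<kappa>))"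

definition c1 :: real where "c1 = 4 * C * M * E"
text \<open>The constants of \<open>second_order_far\<close>, \<open>second_order_near\<close> and
  \<open>c_bound\<close> added up, so that it dominates both cases of
  \<open>second_order\<close>.\<close>

definition c2 :: real where "c2 = 24 * C * M * M * E * E + 8 * C * M * E * MX + 2 * C * M * M"

lemma c_bound: "\<bar>c d\<bar> \<le> 2 * C * M * M * r ^ d"
  using abs_Re_le_cmod[of "cor d"] cor_bound[of d] by (simp add: c_def abs_mult)

lemma c_summable: "summable (\<lambda>d. c (Suc d))"
proof (rule summable_comparison_test')
  show "summable (\<lambda>d. 2 * C * M * M * r * r ^ d)" using r by (intro summable_mult summable_geometric) auto
  show "norm (c (Suc d)) \<le> 2 * C * M * M * r * r ^ d" for d using c_bound[of "Suc d"] by (simp add: mult_ac)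
qed

definition c3 :: real where "c3 = 4 * C * M * M / (1 - r)"

lemma var_diff: "\<bar>var_upto g - var_lim\<bar> \<le> c3 * r ^ g"
proof -
  have CM: "0 \<le> C * M * M" using C M_nonneg by simp
  have b: "norm (c (Suc (d + g))) \<le> 2 * C * M * M * r ^ g * r ^ d" for d
  proof -
    have "2 * C * M * M * r ^ Suc (d + g) \<le> 2 * C * M * M * r ^ (g + d)"
      using CM r by (intro mult_left_mono power_decreasing) auto
    then show ?thesis using c_bound[of "Suc (d + g)"] by (simp add: power_add mult_ac)
  qed
  have s: "summable (\<lambda>d. 2 * C * M * M * r ^ g * r ^ d)"
    using r by (intro summable_mult summable_geometric) auto
  have "(\<Sum>d. c (Suc d)) - (\<Sum>d<g. c (Suc d)) = (\<Sum>d. c (Suc (d + g)))"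
    using suminf_minus_initial_segment[OF c_summable, of g] by simp
  moreover have "norm (\<Sum>d. c (Suc (d + g))) \<le> (\<Sum>d. 2 * C * M * M * r ^ g * r ^ d)"
    by (rule norm_suminf_le[OF b s])
  moreover have "(\<Sum>d. 2 * C * M * M * r ^ g * r ^ d) = 2 * C * M * M * r ^ g * (1 / (1 - r))"
    using r by (subst suminf_mult) (auto simp: suminf_geometric intro!: summable_geometric)
  ultimately have "\<bar>(\<Sum>d. c (Suc d)) - (\<Sum>d<g. c (Suc d))\<bar> \<le> 2 * C * M * M * r ^ g * (1 / (1 - r))"
    by simp
  then have "2 * \<bar>(\<Sum>d. c (Suc d)) - (\<Sum>d<g. c (Suc d))\<bar> \<le> c3 * r ^ g"
    by (simp add: c3_def)
  moreover have "var_upto g - var_lim = - (2 * ((\<Sum>d. c (Suc d)) - (\<Sum>d<g. c (Suc d))))"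
    by (simp add: var_upto_def var_lim_def)
  ultimately show ?thesis by (simp only: abs_minus_cancel abs_mult abs_numeral)
qed

lemma Y_meas [measurable]: "Y n \<in> seq_meas"
  unfolding Y_def[abs_def] by measurable

lemma \<Phi>_meas [measurable]: "\<Phi> a n \<in> seq_meas"
  unfolding \<Phi>_def[abs_def] by measurable

lemma norm_\<Phi> [simp]: "norm (\<Phi> a n w) = 1"
  by (simp add: \<Phi>_def)

lemma norm_\<psi>: "norm (\<psi> a n) \<le> 1"
  unfolding \<psi>_def by (rule bern_integral_bound) simp

lemma \<Phi>_past_eq: "bosc_le (past_eq k) (L\<Phi> a) (\<Phi> a k)"
proof -
  have "osc_le (past_eq k) (MX / (1 - \<kappa>)) (Y k)"
    unfolding Y_def by (rule osc_le_past_eq_sum) (use X_past_eq bosc_le_osc_le MX_nonneg in auto)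
  moreover have "0 \<le> \<bar>a\<bar> * (MX / (1 - \<kappa>))" using MX_nonneg \<kappa> by simp
  ultimately show ?thesis unfolding \<Phi>_def[abs_def] L\<Phi>_def by (intro bosc_le_cis osc_le_cmult) auto
qed

lemma L\<Phi>_ge1: "1 \<le> L\<Phi> a"
  using MX_nonneg \<kappa> by (simp add: L\<Phi>_def)

lemma Y_diff: "\<bar>Y (k + g) w - Y k w\<bar> \<le> MX * g"
proof (induction g)
  case (Suc g)
  have "Y (k + Suc g) w - Y k w = (Y (k + g) w - Y k w) + X (k + g) w" by (simp add: Y_def)
  then have "\<bar>Y (k + Suc g) w - Y k w\<bar> \<le> \<bar>Y (k + g) w - Y k w\<bar> + \<bar>X (k + g) w\<bar>" by simp
  also have "\<dots> \<le> MX * g + MX" by (intro add_mono Suc X_bound)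
  finally show ?case by (simp add: algebra_simps)
qed simp

lemma \<psi>_diff: "norm (\<psi> a (k + g) - \<psi> a k) \<le> \<bar>a\<bar> * (MX * g)"
  unfolding \<psi>_def
proof (rule bern_integral_diff_bound)
  show "norm (\<Phi> a (k + g) w - \<Phi> a k w) \<le> \<bar>a\<bar> * (MX * g)" for w
  proof -
    have "norm (\<Phi> a (k + g) w - \<Phi> a k w) \<le> \<bar>a * Y (k + g) w - a * Y k w\<bar>"
      unfolding \<Phi>_def by (rule norm_cis_diff_le)
    also have "\<dots> = \<bar>a\<bar> * \<bar>Y (k + g) w - Y k w\<bar>" by (simp flip: right_diff_distrib abs_mult)
    also have "\<dots> \<le> \<bar>a\<bar> * (MX * g)" by (intro mult_left_mono Y_diff) simp
    finally show ?thesis .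
  qed
  show "norm (\<Phi> a (k + g) w) \<le> 1" for w by simp
qed measurable

text \<open>Either \<open>l - k\<close> or \<open>k + g - l\<close> is at least half of the gap. In
  the first case the far estimate applies; in the second the near estimate applies and the
  correlation \<open>c (k + g - l)\<close> is itself small.\<close>

lemma second_order:
  assumes k: "k \<le> l" "l \<le> k + g"
  shows "norm ((\<integral>w. \<Phi> a k w * complex_of_real (X l w) * complex_of_real (X (k + g) w) \<partial>\<mu>)
      - complex_of_real (c (k + g - l)) * \<psi> a k) \<le> c2 * L\<Phi> a * sqrt r ^ g"
proof -
  let ?I = "\<integral>w. \<Phi> a k w * complex_of_real (X l w) * complex_of_real (X (k + g) w) \<partial>\<mu>"
  let ?n = "k + g"
  have pos: "0 \<le> C" "0 \<le> M" "0 \<le> E" "0 \<le> MX" "0 \<le> L\<Phi> a" "1 \<le> L\<Phi> a"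
    using C M_nonneg E_ge1 MX_nonneg L\<Phi>_ge1[of a] by auto
  have pw: "r ^ j \<le> sqrt r ^ g" if "g \<le> 2 * j" for j
    using r that by (rule power_le_sqrt_power)
  show ?thesis
  proof (cases "g \<le> 2 * (l - k)")
    case True
    have "norm (?I - complex_of_real (c (?n - l)) * \<psi> a k) \<le> 24 * C * M * M * E * E * L\<Phi> a * r ^ (l - k)"
      unfolding c_def \<psi>_def by (rule second_order_far[OF \<Phi>_past_eq _ k]) measurable
    also have "\<dots> \<le> c2 * L\<Phi> a * sqrt r ^ g"
      unfolding c2_def using True pos r by (intro mult_mono pw mult_right_mono) auto
    finally show ?thesis .
  next
    case False
    have "norm ?I \<le> 8 * C * M * E * MX * L\<Phi> a * r ^ (?n - l)"
      by (rule second_order_near[OF \<Phi>_past_eq _ k]) measurable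
    moreover have "norm (complex_of_real (c (?n - l)) * \<psi> a k) \<le> (2 * C * M * M * r ^ (?n - l)) * L\<Phi> a"
      unfolding norm_mult norm_of_real using norm_\<psi>[of a k] pos(6) pos r
      by (intro mult_mono c_bound) auto
    ultimately have "norm (?I - complex_of_real (c (?n - l)) * \<psi> a k)
       \<le> 8 * C * M * E * MX * L\<Phi> a * r ^ (?n - l) + (2 * C * M * M * r ^ (?n - l)) * L\<Phi> a"
      by (intro order_trans[OF norm_triangle_ineq4] add_mono)
    also have "\<dots> = (8 * C * M * E * MX + 2 * C * M * M) * L\<Phi> a * r ^ (?n - l)" by (simp add: algebra_simps)
    also have "\<dots> \<le> c2 * L\<Phi> a * sqrt r ^ g"
      unfolding c2_def using False k pos r by (intro mult_mono pw mult_right_mono) auto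
    finally show ?thesis .
  qed
qed

text \<open>Both ends are expanded at 0 and not at \<open>y\<close>. The cross term
  \<open>y * x\<close> then appears explicitly, and it carries the correlations of the new term with
  the earlier terms of the block.\<close>

lemma cis_increment:
  fixes y x :: real
  assumes "\<bar>y\<bar> \<le> h" "\<bar>y + x\<bar> \<le> h"
  shows "norm ((cis (y + x) - cis y) - (\<i> * of_real x - of_real (y * x) - of_real (x\<^sup>2 / 2))) \<le> 2 * h ^ 3"
proof -
  let ?t = "\<lambda>z::real. 1 + \<i> * of_real z - complex_of_real (z\<^sup>2 / 2)"
  have "?t (y + x) - ?t y = \<i> * of_real x - of_real (y * x) - of_real (x\<^sup>2 / 2)"
    by (simp add: power2_eq_square field_simps)
  moreover have "(cis (y + x) - cis y) - (?t (y + x) - ?t y) = (cis (y + x) - ?t (y + x)) - (cis y - ?t y)"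
    by (simp only: diff_diff_eq diff_add_eq diff_diff_eq2 add_diff_eq add_ac)
  ultimately have "(cis (y + x) - cis y) - (\<i> * of_real x - of_real (y * x) - of_real (x\<^sup>2 / 2))
      = (cis (y + x) - ?t (y + x)) - (cis y - ?t y)" by (simp only:)
  also have "norm \<dots> \<le> \<bar>y + x\<bar> ^ 3 + \<bar>y\<bar> ^ 3"
    by (intro order_trans[OF norm_triangle_ineq4] add_mono cis_taylor2)
  also have "\<dots> \<le> h ^ 3 + h ^ 3" using assms by (intro add_mono power_mono) auto
  finally show ?thesis by simp
qed

text \<open>
  One step of the characteristic function, expanded to second order around time \<open>k = n - g\<close>:
  the increment after the gap meets \<open>\<Phi> a k\<close> only through its first two conditional moments, so
  only frequencies 1 and 2 occur, whereas mixing of all frequencies is not available.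
\<close>

lemma \<psi>_step:
  "norm (\<psi> a (Suc (k + g)) - complex_of_real (1 - a\<^sup>2 / 2 * var_upto g) * \<psi> a (k + g))
   \<le> \<bar>a\<bar> * (c1 * L\<Phi> a * r ^ g) + a\<^sup>2 * ((real g + 1) * (c2 * L\<Phi> a * sqrt r ^ g))
      + 2 * (\<bar>a\<bar> * (MX * (real g + 1))) ^ 3 + a\<^sup>2 / 2 * \<bar>var_upto g\<bar> * (\<bar>a\<bar> * (MX * g))"
proof -
  let ?mu = "bernoulli_measure p"
  define n where "n = k + g"
  define F where "F = (\<lambda>w. \<Phi> a k w * complex_of_real (X n w))"
  define G where "G l = (\<lambda>w. \<Phi> a k w * complex_of_real (X l w) * complex_of_real (X n w))" for l
  \<comment> \<open>The increment of \<open>cis_increment\<close> times \<open>\<Phi> a k\<close>,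
    with \<open>x = a * X n w\<close> and \<open>y\<close> the \<open>a\<close>-fold sum of the
    \<open>X l\<close> for \<open>k \<le> l < n\<close>: the cross term gives \<open>G l\<close>
    with weight 1, the square gives \<open>G n\<close> with weight 1/2.\<close>
  define T where "T w = (\<i> * of_real a) * F w - of_real (a\<^sup>2) * (\<Sum>l\<in>{k..<n}. G l w) - of_real (a\<^sup>2 / 2) * G n w" for w
  have [measurable]: "F \<in> seq_meas" "G l \<in> seq_meas" "T \<in> seq_meas" for l
    unfolding F_def G_def T_def[abs_def] by measurable
  have iF: "integrable ?mu F"
    by (rule bern_integrable[of _ MX]) (auto simp: F_def norm_mult X_bound)
  have iG: "integrable ?mu (G l)" for l
    by (rule bern_integrable[of _ "MX * MX"])
      (auto simp: G_def norm_mult X_bound MX_nonneg intro!: mult_mono)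
  have "(\<integral>w. T w \<partial>?mu) = (\<i> * of_real a) * (\<integral>w. F w \<partial>?mu)
     - of_real (a\<^sup>2) * (\<Sum>l\<in>{k..<n}. \<integral>w. G l w \<partial>?mu) - of_real (a\<^sup>2 / 2) * (\<integral>w. G n w \<partial>?mu)"
    unfolding T_def using iF iG
    by (simp add: Bochner_Integration.integral_diff Bochner_Integration.integral_sum)
  note iT = this
  have d1: "norm ((\<integral>w. \<Phi> a (Suc n) w - \<Phi> a n w \<partial>?mu) - (\<integral>w. T w \<partial>?mu)) \<le> 2 * (\<bar>a\<bar> * (MX * (real g + 1))) ^ 3"
  proof (rule bern_integral_diff_bound)
    show "norm (\<Phi> a (Suc n) w - \<Phi> a n w) \<le> 2" for w
      using norm_triangle_ineq4[of "\<Phi> a (Suc n) w" "\<Phi> a n w"] by simp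
    show "norm (\<Phi> a (Suc n) w - \<Phi> a n w - T w) \<le> 2 * (\<bar>a\<bar> * (MX * (real g + 1))) ^ 3" for w
    proof -
      define y where "y = a * (Y n w - Y k w)"
      define x where "x = a * X n w"
      have Yn: "Y (Suc n) w = Y n w + X n w" by (simp add: Y_def)
      have P: "\<Phi> a n w = \<Phi> a k w * cis y" "\<Phi> a (Suc n) w = \<Phi> a k w * cis (y + x)"
        unfolding \<Phi>_def y_def x_def Yn cis_mult by (simp_all add: algebra_simps)
      have Ys: "(\<Sum>l\<in>{k..<n}. X l w) = Y n w - Y k w"
        unfolding Y_def n_def using sum.atLeastLessThan_concat[of 0 k "k + g" "\<lambda>l. X l w"]
        by (simp add: atLeast0LessThan)
      have "(\<Sum>l\<in>{k..<n}. G l w)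
          = \<Phi> a k w * complex_of_real (\<Sum>l\<in>{k..<n}. X l w) * complex_of_real (X n w)"
        by (simp add: G_def sum_distrib_left sum_distrib_right)
      note Gs = this[unfolded Ys]
      have "T w = \<Phi> a k w * (\<i> * of_real x - of_real (y * x) - of_real (x\<^sup>2 / 2))"
        unfolding T_def Gs by (simp add: F_def G_def y_def x_def algebra_simps power2_eq_square)
      then have "\<Phi> a (Suc n) w - \<Phi> a n w - T w
        = \<Phi> a k w * ((cis (y + x) - cis y) - (\<i> * of_real x - of_real (y * x) - of_real (x\<^sup>2 / 2)))"
        unfolding P by (simp only: right_diff_distrib)
      moreover have "norm ((cis (y + x) - cis y) - (\<i> * of_real x - of_real (y * x) - of_real (x\<^sup>2 / 2)))
         \<le> 2 * (\<bar>a\<bar> * (MX * (real g + 1))) ^ 3"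
      proof (rule cis_increment)
        have "\<bar>Y n w - Y k w\<bar> \<le> MX * g" unfolding n_def by (rule Y_diff)
        also have "\<dots> \<le> MX * (real g + 1)" using MX_nonneg by (intro mult_left_mono) auto
        finally show "\<bar>y\<bar> \<le> \<bar>a\<bar> * (MX * (real g + 1))" unfolding y_def abs_mult by (rule mult_left_mono) simp
        have "\<bar>Y (k + Suc g) w - Y k w\<bar> \<le> MX * Suc g" by (rule Y_diff)
        then have "\<bar>a\<bar> * \<bar>Y (Suc n) w - Y k w\<bar> \<le> \<bar>a\<bar> * (MX * (real g + 1))"
          by (intro mult_left_mono) (auto simp: n_def add.commute)
        moreover have "y + x = a * (Y (Suc n) w - Y k w)" by (simp add: y_def x_def Yn algebra_simps)
        ultimately show "\<bar>y + x\<bar> \<le> \<bar>a\<bar> * (MX * (real g + 1))" by (simp only: abs_mult)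
      qed
      ultimately show ?thesis by (simp only: norm_mult norm_\<Phi> mult_1)
    qed
  qed measurable
  have "(\<integral>w. \<Phi> a (Suc n) w - \<Phi> a n w \<partial>?mu) = \<psi> a (Suc n) - \<psi> a n"
    unfolding \<psi>_def by (intro Bochner_Integration.integral_diff bern_integrable[of _ 1]) auto
  note d1 = d1[unfolded this]
  \<comment> \<open>Deviations of the second moments from their stationary values. The weights 1 and
    1/2 are those of \<open>T\<close>; with them the stationary values add up to
    \<open>var_upto g / 2\<close>.\<close>
  define S where "S = (\<Sum>l\<in>{k..<n}. (\<integral>w. G l w \<partial>?mu) - complex_of_real (c (n - l)) * \<psi> a k)
      + of_real (1 / 2) * ((\<integral>w. G n w \<partial>?mu) - complex_of_real (c (n - n)) * \<psi> a k)"
  have summand: "norm ((\<integral>w. G l w \<partial>?mu) - complex_of_real (c (n - l)) * \<psi> a k) \<le> c2 * L\<Phi> a * sqrt r ^ g"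
    if "k \<le> l" "l \<le> n" for l
    unfolding G_def n_def using that by (intro second_order) (auto simp: n_def)
  have kn: "k \<le> n" by (simp add: n_def)
  have t0: "0 \<le> c2 * L\<Phi> a * sqrt r ^ g" using summand[OF kn order_refl] norm_ge_zero order_trans by blast
  have "norm S \<le> (\<Sum>l\<in>{k..<n}. c2 * L\<Phi> a * sqrt r ^ g) + 1 * (c2 * L\<Phi> a * sqrt r ^ g)"
    unfolding S_def
  proof (intro order_trans[OF norm_triangle_ineq] add_mono sum_norm_le)
    show "norm (of_real (1 / 2) * ((\<integral>w. G n w \<partial>?mu) - complex_of_real (c (n - n)) * \<psi> a k)) \<le> 1 * (c2 * L\<Phi> a * sqrt r ^ g)"
      unfolding norm_mult norm_of_real using summand[OF kn order_refl] by (intro mult_mono) auto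
  qed (use summand in auto)
  also have "\<dots> = (real g + 1) * (c2 * L\<Phi> a * sqrt r ^ g)" by (simp add: n_def algebra_simps)
  finally have Sb: "norm S \<le> (real g + 1) * (c2 * L\<Phi> a * sqrt r ^ g)" .
  have csum: "(\<Sum>l\<in>{k..<n}. c (n - l)) = (\<Sum>d<g. c (Suc d))"
    unfolding n_def
    by (rule sum.reindex_bij_witness[of _ "\<lambda>d. k + g - Suc d" "\<lambda>l. k + g - l - 1"]) (auto simp: Suc_diff_Suc)
  have "var_upto g = 2 * ((\<Sum>l\<in>{k..<n}. c (n - l)) + c (n - n) / 2)"
    unfolding csum var_upto_def by simp
  then have vs: "complex_of_real (a\<^sup>2 / 2 * var_upto g)
      = of_real (a\<^sup>2) * ((\<Sum>l\<in>{k..<n}. complex_of_real (c (n - l))) + of_real (1 / 2) * complex_of_real (c (n - n)))"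
    by simp
  have iT': "(\<integral>w. T w \<partial>?mu) = (\<i> * of_real a) * (\<integral>w. F w \<partial>?mu) - of_real (a\<^sup>2) * S
      - complex_of_real (a\<^sup>2 / 2 * var_upto g) * \<psi> a k"
    unfolding iT S_def vs sum_subtractf sum_distrib_right[symmetric]
    by (simp add: algebra_simps)
  have F: "norm (\<integral>w. F w \<partial>?mu) \<le> c1 * L\<Phi> a * r ^ g"
  proof -
    have "norm (\<integral>w. F w \<partial>?mu) \<le> 4 * C * M * E * L\<Phi> a * r ^ (n - k)"
      unfolding F_def by (rule first_order[OF \<Phi>_past_eq _ kn]) measurable
    then show ?thesis by (simp add: c1_def n_def)
  qed
  define h where "h = complex_of_real (a\<^sup>2 / 2 * var_upto g)"
  have h: "complex_of_real (1 - a\<^sup>2 / 2 * var_upto g) = 1 - h"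
    unfolding h_def by (simp only: of_real_diff of_real_1)
  have "\<psi> a (Suc n) - complex_of_real (1 - a\<^sup>2 / 2 * var_upto g) * \<psi> a n
    = ((\<psi> a (Suc n) - \<psi> a n) - (\<integral>w. T w \<partial>?mu))
      + ((\<i> * of_real a) * (\<integral>w. F w \<partial>?mu) - of_real (a\<^sup>2) * S
      + complex_of_real (a\<^sup>2 / 2 * var_upto g) * (\<psi> a n - \<psi> a k))"
    unfolding iT' h h_def[symmetric] by (simp add: algebra_simps)
  also have "norm \<dots> \<le> 2 * (\<bar>a\<bar> * (MX * (real g + 1))) ^ 3
     + ((\<bar>a\<bar> * (c1 * L\<Phi> a * r ^ g) + a\<^sup>2 * ((real g + 1) * (c2 * L\<Phi> a * sqrt r ^ g)))
     + a\<^sup>2 / 2 * \<bar>var_upto g\<bar> * (\<bar>a\<bar> * (MX * g)))"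
  proof (intro norm_triangle_mono d1 order_trans[OF norm_triangle_ineq4] add_mono)
    show "norm ((\<i> * of_real a) * (\<integral>w. F w \<partial>?mu)) \<le> \<bar>a\<bar> * (c1 * L\<Phi> a * r ^ g)"
      using F by (auto simp: norm_mult intro!: mult_left_mono)
    show "norm (of_real (a\<^sup>2) * S) \<le> a\<^sup>2 * ((real g + 1) * (c2 * L\<Phi> a * sqrt r ^ g))"
      unfolding norm_mult norm_of_real using Sb by (auto intro!: mult_left_mono)
    show "norm (complex_of_real (a\<^sup>2 / 2 * var_upto g) * (\<psi> a n - \<psi> a k)) \<le> a\<^sup>2 / 2 * \<bar>var_upto g\<bar> * (\<bar>a\<bar> * (MX * g))"
      unfolding norm_mult norm_of_real n_def using \<psi>_diff[of a k g]
      by (auto simp: abs_mult intro!: mult_left_mono)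
  qed
  finally show ?thesis unfolding n_def by (simp only: add_ac)
qed

text \<open>The case \<open>q > 1\<close> is covered because the sign of \<open>var_lim\<close> is
  not yet known; it is obtained in \<open>var_lim_nonneg\<close> from the limit that this estimate
  helps to compute.\<close>

lemma approximate_geometric:
  fixes z :: "nat \<Rightarrow> complex" and q :: real
  assumes q: "0 < q" and step: "\<And>n. norm (z (Suc n) - of_real q * z n) \<le> e n" and z0: "z 0 = 1"
  shows "norm (z n - of_real (q ^ n)) \<le> max 1 q ^ n * (\<Sum>j<n. e j)"
proof (induction n)
  case (Suc n)
  have e: "0 \<le> e j" for j using step[of j] norm_ge_zero order_trans by blast
  have "z (Suc n) - of_real (q ^ Suc n) = (z (Suc n) - of_real q * z n) + of_real q * (z n - of_real (q ^ n))"
    by (simp add: algebra_simps)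
  then have "norm (z (Suc n) - of_real (q ^ Suc n)) \<le> norm (z (Suc n) - of_real q * z n) + norm (of_real q * (z n - of_real (q ^ n)))"
    by (metis norm_triangle_ineq)
  also have "\<dots> \<le> e n + max 1 q * (max 1 q ^ n * (\<Sum>j<n. e j))"
    unfolding norm_mult norm_of_real using q Suc by (intro add_mono step mult_mono) (auto intro: sum_nonneg e)
  also have "e n \<le> max 1 q ^ Suc n * e n"
    using e[of n] one_le_power[of "max 1 q" "Suc n"] mult_right_mono[of 1 "max 1 q ^ Suc n" "e n"] by simp
  finally show ?case by (simp add: algebra_simps)
qed (simp add: z0)

text \<open>One-step error for the times \<open>n < g\<close>, which leave no room for a gap of
  length \<open>g\<close>: a single step changes the characteristic function by at most
  \<open>\<bar>a\<bar> * MX\<close>.\<close>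

definition err1 :: "real \<Rightarrow> real" where
  "err1 a = \<bar>a\<bar> * MX + \<bar>1 - exp (- (a\<^sup>2 * var_lim / 2))\<bar>"

text \<open>The bound of \<open>\<psi>_step\<close>, enlarged by the cost of replacing
  \<open>var_upto g\<close> by \<open>var_lim\<close> and the linear factor by the
  exponential.\<close>

definition err2 :: "real \<Rightarrow> nat \<Rightarrow> real" where
  "err2 a g = \<bar>a\<bar> * (c1 * L\<Phi> a * r ^ g) + a\<^sup>2 * ((real g + 1) * (c2 * L\<Phi> a * sqrt r ^ g))
      + 2 * (\<bar>a\<bar> * (MX * (real g + 1))) ^ 3 + a\<^sup>2 / 2 * (\<bar>var_lim\<bar> + c3) * (\<bar>a\<bar> * (MX * g))
      + (a\<^sup>2 / 2 * (c3 * r ^ g) + \<bar>1 - a\<^sup>2 * var_lim / 2 - exp (- (a\<^sup>2 * var_lim / 2))\<bar>)"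

lemma c3_nonneg: "0 \<le> c3"
  using C M_nonneg r by (simp add: c3_def)

lemma \<psi>_recursion:
  "norm (\<psi> a (Suc n) - of_real (exp (- (a\<^sup>2 * var_lim / 2))) * \<psi> a n) \<le> (if n < g then err1 a else err2 a g)"
proof -
  define q where "q = exp (- (a\<^sup>2 * var_lim / 2))"
  have "norm (\<psi> a (Suc n) - of_real q * \<psi> a n) \<le> err1 a"
  proof -
    have "\<psi> a (Suc n) - of_real q * \<psi> a n = (\<psi> a (n + 1) - \<psi> a n) + of_real (1 - q) * \<psi> a n"
      by (simp add: algebra_simps)
    also have "norm \<dots> \<le> \<bar>a\<bar> * (MX * real 1) + \<bar>1 - q\<bar> * 1"
      by (intro norm_triangle_mono \<psi>_diff) (unfold norm_mult norm_of_real, intro mult_left_mono norm_\<psi> abs_ge_zero)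
    finally show ?thesis by (simp add: err1_def q_def)
  qed
  moreover have "norm (\<psi> a (Suc n) - of_real q * \<psi> a n) \<le> err2 a g" if "g \<le> n"
  proof -
    define k where "k = n - g"
    have n: "n = k + g" using that by (simp add: k_def)
    have rg: "r ^ g \<le> 1" using r by (intro power_le_one) auto
    have "c3 * r ^ g \<le> c3" using mult_left_mono[OF rg c3_nonneg] by simp
    then have v: "\<bar>var_upto g\<bar> \<le> \<bar>var_lim\<bar> + c3" using var_diff[of g] by linarith
    have "\<psi> a (Suc n) - of_real q * \<psi> a n
      = (\<psi> a (Suc (k + g)) - complex_of_real (1 - a\<^sup>2 / 2 * var_upto g) * \<psi> a (k + g))
        + of_real (1 - a\<^sup>2 / 2 * var_upto g - q) * \<psi> a n"
      unfolding n by (simp add: algebra_simps)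
    also have "norm \<dots> \<le> (\<bar>a\<bar> * (c1 * L\<Phi> a * r ^ g) + a\<^sup>2 * ((real g + 1) * (c2 * L\<Phi> a * sqrt r ^ g))
      + 2 * (\<bar>a\<bar> * (MX * (real g + 1))) ^ 3 + a\<^sup>2 / 2 * \<bar>var_upto g\<bar> * (\<bar>a\<bar> * (MX * g)))
      + \<bar>1 - a\<^sup>2 / 2 * var_upto g - q\<bar> * 1"
      by (intro norm_triangle_mono \<psi>_step) (unfold norm_mult norm_of_real, intro mult_left_mono norm_\<psi> abs_ge_zero)
    also have "\<dots> \<le> (\<bar>a\<bar> * (c1 * L\<Phi> a * r ^ g) + a\<^sup>2 * ((real g + 1) * (c2 * L\<Phi> a * sqrt r ^ g))
      + 2 * (\<bar>a\<bar> * (MX * (real g + 1))) ^ 3 + a\<^sup>2 / 2 * (\<bar>var_lim\<bar> + c3) * (\<bar>a\<bar> * (MX * g)))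
      + (a\<^sup>2 / 2 * (c3 * r ^ g) + \<bar>1 - a\<^sup>2 * var_lim / 2 - q\<bar>)"
    proof (intro add_mono order_refl mult_right_mono mult_left_mono v)
      have "1 - a\<^sup>2 / 2 * var_upto g - q = a\<^sup>2 / 2 * (var_lim - var_upto g) + (1 - a\<^sup>2 * var_lim / 2 - q)"
        by (simp add: algebra_simps)
      also have "\<bar>\<dots>\<bar> \<le> \<bar>a\<^sup>2 / 2 * (var_lim - var_upto g)\<bar> + \<bar>1 - a\<^sup>2 * var_lim / 2 - q\<bar>"
        by (rule abs_triangle_ineq)
      also have "\<bar>a\<^sup>2 / 2 * (var_lim - var_upto g)\<bar> \<le> a\<^sup>2 / 2 * (c3 * r ^ g)"
        unfolding abs_mult using var_diff[of g] by (simp add: abs_minus_commute mult_left_mono)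
      finally show "\<bar>1 - a\<^sup>2 / 2 * var_upto g - q\<bar> * 1 \<le> a\<^sup>2 / 2 * (c3 * r ^ g) + \<bar>1 - a\<^sup>2 * var_lim / 2 - q\<bar>"
        by simp
    qed (use MX_nonneg in auto)
    finally show ?thesis by (simp add: err2_def q_def)
  qed
  ultimately show ?thesis by (simp add: q_def)
qed

lemma err_nonneg: "0 \<le> err1 a" "0 \<le> err2 a g"
  using order_trans[OF norm_ge_zero \<psi>_recursion[of a 0 1]]
    order_trans[OF norm_ge_zero \<psi>_recursion[of a g g]] by simp_all

lemma \<psi>_close:
  "norm (\<psi> a N - of_real (exp (- (a\<^sup>2 * var_lim / 2)) ^ N))
    \<le> max 1 (exp (- (a\<^sup>2 * var_lim / 2))) ^ N * (real g * err1 a + real N * err2 a g)"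
proof -
  note e0 = err_nonneg[of a] err_nonneg(2)[of a g]
  have "\<psi> a 0 = 1" by (simp add: \<psi>_def \<Phi>_def Y_def bern.prob_space[simplified])
  then have "norm (\<psi> a N - of_real (exp (- (a\<^sup>2 * var_lim / 2)) ^ N))
    \<le> max 1 (exp (- (a\<^sup>2 * var_lim / 2))) ^ N * (\<Sum>j<N. if j < g then err1 a else err2 a g)"
    by (intro approximate_geometric \<psi>_recursion) auto
  also have "\<dots> \<le> max 1 (exp (- (a\<^sup>2 * var_lim / 2))) ^ N * (real g * err1 a + real N * err2 a g)"
  proof (rule mult_left_mono)
    have "(\<Sum>j<N. if j < g then err1 a else err2 a g) \<le> (\<Sum>j<N. (if j \<in> {..<g} then err1 a else 0) + err2 a g)"
      using e0 by (intro sum_mono) auto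
    also have "\<dots> = real (card ({..<N} \<inter> {..<g})) * err1 a + real N * err2 a g"
    proof -
      have "(\<Sum>j\<in>{..<N} \<inter> {..<g}. err1 a) = (\<Sum>j<N. if j \<in> {..<g} then err1 a else 0)"
        by (rule sum.inter_restrict) simp
      then show ?thesis unfolding sum.distrib by simp
    qed
    also have "\<dots> \<le> real g * err1 a + real N * err2 a g"
    proof (intro add_mono mult_right_mono e0 order_refl)
      have "card ({..<N} \<inter> {..<g}) \<le> card {..<g}" by (intro card_mono) auto
      then show "real (card ({..<N} \<inter> {..<g})) \<le> real g" by simp
    qed
    finally show "(\<Sum>j<N. if j < g then err1 a else err2 a g) \<le> real g * err1 a + real N * err2 a g" .
  qed (simp add: le_max_iff_disj)
  finally show ?thesis .
qed

text \<open>The gap has to beat \<open>ln N\<close>, so that \<open>sqrt N * r ^ g\<close> tends to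
  0, and to stay below \<open>N powr (1 / 6)\<close>, so that the Taylor error
  \<open>N * (g / sqrt N) ^ 3\<close> does; the exponent 1/8 satisfies both.\<close>

lemma error_tendsto:
  assumes g: "\<And>N. g N = nat \<lfloor>real N powr (1 / 8)\<rfloor>"
  shows "(\<lambda>N. real (g N) * err1 (t / sqrt N) + real N * err2 (t / sqrt N) (g N)) \<longlonglongrightarrow> 0"
proof -
  define \<rho> where "\<rho> = - ln r"
  have \<rho>: "0 < \<rho>" using r by (simp add: \<rho>_def)
  have rpow: "r ^ n = exp (- \<rho> * real n)" "sqrt r ^ n = exp (- (\<rho> / 2) * real n)" for n
  proof -
    have "exp (- \<rho> * real n) = exp (ln r) ^ n" by (simp add: \<rho>_def mult.commute flip: exp_of_nat_mult)
    then show "r ^ n = exp (- \<rho> * real n)" using r by simp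
    have "ln (sqrt r) = ln r / 2" using r by (simp add: ln_sqrt)
    then have "exp (- (\<rho> / 2) * real n) = exp (ln (sqrt r)) ^ n" by (simp add: \<rho>_def mult.commute flip: exp_of_nat_mult)
    then show "sqrt r ^ n = exp (- (\<rho> / 2) * real n)" using r by simp
  qed
  \<comment> \<open>The gap lies between \<open>x N - 1\<close> and \<open>x N\<close>, so the
    majorant \<open>bd\<close> can be written without rounding.\<close>
  define x where "x N = real N powr (1 / 8)" for N
  have x0: "0 \<le> x N" for N by (simp add: x_def)
  have g1: "real (g N) \<le> x N" and g2: "x N - 1 \<le> real (g N)" for N
    using x0[of N] unfolding g x_def by linarith+
  define Lt where "Lt = L\<Phi> t"
  have pos: "0 \<le> c1" "0 \<le> c2" "0 \<le> c3" "0 \<le> MX" "0 \<le> Lt"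
    using C M_nonneg E_ge1 MX_nonneg L\<Phi>_ge1[of t] c3_nonneg by (auto simp: c1_def c2_def Lt_def)
  define v where "v = t\<^sup>2 * var_lim / 2"
  define bd where "bd N = \<bar>t\<bar> * MX * (x N / sqrt N) + \<bar>x N * (1 - exp (- (v / N)))\<bar>
     + (\<bar>t\<bar> * c1 * Lt * (sqrt N * exp (- \<rho> * (x N - 1)))
     + t\<^sup>2 * c2 * Lt * ((x N + 1) * exp (- (\<rho> / 2) * (x N - 1)))
     + 2 * (\<bar>t\<bar> * MX) ^ 3 * (N * ((x N + 1) / sqrt N) ^ 3)
     + t\<^sup>2 / 2 * (\<bar>var_lim\<bar> + c3) * \<bar>t\<bar> * MX * (x N / sqrt N)
     + t\<^sup>2 / 2 * c3 * exp (- \<rho> * (x N - 1))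
     + \<bar>N * (1 - v / N - exp (- (v / N)))\<bar>)" for N :: nat
  have "bd \<longlonglongrightarrow> \<bar>t\<bar> * MX * 0 + \<bar>0\<bar> + (\<bar>t\<bar> * c1 * Lt * 0 + t\<^sup>2 * c2 * Lt * 0 + 2 * (\<bar>t\<bar> * MX) ^ 3 * 0
     + t\<^sup>2 / 2 * (\<bar>var_lim\<bar> + c3) * \<bar>t\<bar> * MX * 0 + t\<^sup>2 / 2 * c3 * 0 + \<bar>0\<bar>)"
    unfolding bd_def[abs_def] x_def
  proof (intro tendsto_add tendsto_mult_left tendsto_rabs)
    show "(\<lambda>N. real N powr (1 / 8) / sqrt (real N)) \<longlonglongrightarrow> 0" by real_asymp
    show "(\<lambda>N. real N powr (1 / 8) / sqrt (real N)) \<longlonglongrightarrow> 0" by real_asymp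
    show "(\<lambda>N. sqrt (real N) * exp (- \<rho> * (real N powr (1 / 8) - 1))) \<longlonglongrightarrow> 0"
      using \<rho> by real_asymp
    show "(\<lambda>N. (real N powr (1 / 8) + 1) * exp (- (\<rho> / 2) * (real N powr (1 / 8) - 1))) \<longlonglongrightarrow> 0"
      using \<rho> by real_asymp
    show "(\<lambda>N. real N * ((real N powr (1 / 8) + 1) / sqrt (real N)) ^ 3) \<longlonglongrightarrow> 0" by real_asymp
    show "(\<lambda>N. exp (- \<rho> * (real N powr (1 / 8) - 1))) \<longlonglongrightarrow> 0" using \<rho> by real_asymp
    consider "v < 0" | "v = 0" | "0 < v" by linarith
    then show "(\<lambda>N. real N powr (1 / 8) * (1 - exp (- (v / real N)))) \<longlonglongrightarrow> 0"
      by cases (real_asymp | simp)+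
    consider "v < 0" | "v = 0" | "0 < v" by linarith
    then show "(\<lambda>N. real N * (1 - v / real N - exp (- (v / real N)))) \<longlonglongrightarrow> 0"
      by cases (real_asymp | simp)+
  qed
  then have lim: "bd \<longlonglongrightarrow> 0" by simp
  show ?thesis
  proof (rule Lim_null_comparison[OF _ lim])
    show "\<forall>\<^sub>F N in sequentially. norm (real (g N) * err1 (t / sqrt N) + real N * err2 (t / sqrt N) (g N)) \<le> bd N"
      using eventually_gt_at_top[of 0]
    proof eventually_elim
      fix N :: nat assume N: "0 < N"
      define a where "a = t / sqrt N"
      have a: "\<bar>a\<bar> = \<bar>t\<bar> / sqrt N" "a\<^sup>2 = t\<^sup>2 / N" using N by (auto simp: a_def abs_divide power_divide)
      have av: "a\<^sup>2 * var_lim / 2 = v / N" by (simp add: a v_def)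
      have "1 \<le> sqrt N" using N by simp
      then have "\<bar>a\<bar> \<le> \<bar>t\<bar>" unfolding a by (simp add: divide_le_eq mult_le_cancel_left1)
      then have La: "L\<Phi> a \<le> Lt" "0 \<le> L\<Phi> a"
        using MX_nonneg \<kappa> L\<Phi>_ge1[of a] mult_right_mono[of "\<bar>a\<bar>" "\<bar>t\<bar>" "MX / (1 - \<kappa>)"]
        unfolding Lt_def L\<Phi>_def by auto
      have rg: "r ^ g N \<le> exp (- \<rho> * (x N - 1))" "sqrt r ^ g N \<le> exp (- (\<rho> / 2) * (x N - 1))"
        unfolding rpow using \<rho> g2[of N] by (auto intro!: mult_left_mono)
      have N': "real N = sqrt N * sqrt N" by simp
      have e1: "real (g N) * err1 a \<le> \<bar>t\<bar> * MX * (x N / sqrt N) + \<bar>x N * (1 - exp (- (v / N)))\<bar>"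
      proof -
        have "0 \<le> err1 a" using MX_nonneg by (simp add: err1_def)
        then have "real (g N) * err1 a \<le> x N * err1 a" using g1 by (intro mult_right_mono)
        also have "\<dots> = \<bar>t\<bar> * MX * (x N / sqrt N) + \<bar>x N * (1 - exp (- (v / N)))\<bar>"
        proof -
          have "\<bar>x N * (1 - exp (- (v / N)))\<bar> = x N * \<bar>1 - exp (- (v / N))\<bar>"
            using x0[of N] by (simp only: abs_mult abs_of_nonneg)
          then show ?thesis unfolding err1_def av a(1) by (simp add: distrib_left mult_ac)
        qed
        finally show ?thesis .
      qed
      have "err2 a (g N) \<le> \<bar>a\<bar> * (c1 * Lt * exp (- \<rho> * (x N - 1)))
        + a\<^sup>2 * ((x N + 1) * (c2 * Lt * exp (- (\<rho> / 2) * (x N - 1))))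
        + 2 * (\<bar>a\<bar> * (MX * (x N + 1))) ^ 3 + a\<^sup>2 / 2 * (\<bar>var_lim\<bar> + c3) * (\<bar>a\<bar> * (MX * x N))
        + (a\<^sup>2 / 2 * (c3 * exp (- \<rho> * (x N - 1))) + \<bar>1 - v / N - exp (- (v / N))\<bar>)"
        unfolding err2_def av
        using pos La rg g1[of N] r x0[of N]
        by (intro add_mono mult_mono power_mono order_refl mult_nonneg_nonneg) auto
      then have "N * err2 a (g N) \<le> N * (\<bar>a\<bar> * (c1 * Lt * exp (- \<rho> * (x N - 1)))
        + a\<^sup>2 * ((x N + 1) * (c2 * Lt * exp (- (\<rho> / 2) * (x N - 1))))
        + 2 * (\<bar>a\<bar> * (MX * (x N + 1))) ^ 3 + a\<^sup>2 / 2 * (\<bar>var_lim\<bar> + c3) * (\<bar>a\<bar> * (MX * x N))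
        + (a\<^sup>2 / 2 * (c3 * exp (- \<rho> * (x N - 1))) + \<bar>1 - v / N - exp (- (v / N))\<bar>))"
        by (intro mult_left_mono) auto
      also have "\<dots> = \<bar>t\<bar> * c1 * Lt * (sqrt N * exp (- \<rho> * (x N - 1)))
     + t\<^sup>2 * c2 * Lt * ((x N + 1) * exp (- (\<rho> / 2) * (x N - 1)))
     + 2 * (\<bar>t\<bar> * MX) ^ 3 * (N * ((x N + 1) / sqrt N) ^ 3)
     + t\<^sup>2 / 2 * (\<bar>var_lim\<bar> + c3) * \<bar>t\<bar> * MX * (x N / sqrt N)
     + t\<^sup>2 / 2 * c3 * exp (- \<rho> * (x N - 1))
     + \<bar>N * (1 - v / N - exp (- (v / N)))\<bar>"
      proof -
        have s: "real N * \<bar>a\<bar> = \<bar>t\<bar> * sqrt N" "real N * a\<^sup>2 = t\<^sup>2"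
          using N unfolding a by (auto simp: real_div_sqrt field_simps)
        have 1: "real N * (\<bar>a\<bar> * (c1 * Lt * y)) = \<bar>t\<bar> * c1 * Lt * (sqrt N * y)" for y
          using s(1) by (simp flip: mult.assoc)
        have 2: "real N * (a\<^sup>2 * y) = t\<^sup>2 * y" for y
          using s(2) by (simp flip: mult.assoc)
        have 3: "real N * (2 * (\<bar>a\<bar> * (MX * y)) ^ 3) = 2 * (\<bar>t\<bar> * MX) ^ 3 * (N * (y / sqrt N) ^ 3)" for y
          unfolding a by (simp add: power_mult_distrib power_divide)
        have 4: "real N * (a\<^sup>2 / 2 * y * (\<bar>a\<bar> * (MX * z))) = t\<^sup>2 / 2 * y * \<bar>t\<bar> * MX * (z / sqrt N)" for y z
          using 2[of "1 / 2 * y * (\<bar>a\<bar> * (MX * z))"] by (simp add: a)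
        have 5: "real N * (a\<^sup>2 / 2 * (c3 * y)) = t\<^sup>2 / 2 * c3 * y" for y
          using 2[of "1 / 2 * (c3 * y)"] by simp
        show ?thesis unfolding distrib_left[of "real N"] 1 2 3 4 5 by (simp add: abs_mult mult_ac)
      qed
      finally have e2: "N * err2 a (g N) \<le> \<bar>t\<bar> * c1 * Lt * (sqrt N * exp (- \<rho> * (x N - 1)))
     + t\<^sup>2 * c2 * Lt * ((x N + 1) * exp (- (\<rho> / 2) * (x N - 1)))
     + 2 * (\<bar>t\<bar> * MX) ^ 3 * (N * ((x N + 1) / sqrt N) ^ 3)
     + t\<^sup>2 / 2 * (\<bar>var_lim\<bar> + c3) * \<bar>t\<bar> * MX * (x N / sqrt N)
     + t\<^sup>2 / 2 * c3 * exp (- \<rho> * (x N - 1))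
     + \<bar>N * (1 - v / N - exp (- (v / N)))\<bar>" .
      have "norm (real (g N) * err1 a + real N * err2 a (g N)) = real (g N) * err1 a + real N * err2 a (g N)"
        by (simp add: err_nonneg)
      also have "\<dots> \<le> bd N" unfolding bd_def by (rule add_mono[OF e1 e2])
      finally show "norm (real (g N) * err1 (t / sqrt N) + real N * err2 (t / sqrt N) (g N)) \<le> bd N"
        by (simp only: a_def)
    qed
  qed
qed

lemma \<psi>_tendsto: "(\<lambda>N. \<psi> (t / sqrt N) N) \<longlonglongrightarrow> of_real (exp (- (t\<^sup>2 * var_lim / 2)))"
proof -
  define g where "g N = nat \<lfloor>real N powr (1 / 8)\<rfloor>" for N
  define v where "v = t\<^sup>2 * var_lim / 2"
  let ?err = "\<lambda>N. real (g N) * err1 (t / sqrt N) + real N * err2 (t / sqrt N) (g N)"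
  have "(\<lambda>N. exp \<bar>v\<bar> * ?err N) \<longlonglongrightarrow> exp \<bar>v\<bar> * 0"
    by (intro tendsto_mult_left error_tendsto) (simp add: g_def)
  then have lim: "(\<lambda>N. exp \<bar>v\<bar> * ?err N) \<longlonglongrightarrow> 0" by simp
  show ?thesis
  proof (rule LIM_zero_cancel, rule Lim_null_comparison[OF _ lim])
    show "\<forall>\<^sub>F N in sequentially. norm (\<psi> (t / sqrt N) N - of_real (exp (- (t\<^sup>2 * var_lim / 2)))) \<le> exp \<bar>v\<bar> * ?err N"
      using eventually_gt_at_top[of 0]
    proof eventually_elim
      fix N :: nat assume N: "0 < N"
      define a where "a = t / sqrt N"
      have av: "a\<^sup>2 * var_lim / 2 = v / N" using N by (simp add: a_def v_def power_divide)
      have q: "exp (- (v / N)) ^ N = exp (- v)" "exp (\<bar>v\<bar> / N) ^ N = exp \<bar>v\<bar>"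
        using N by (simp_all flip: exp_of_nat_mult)
      have e0: "0 \<le> real (g N) * err1 a + real N * err2 a (g N)" by (simp add: err_nonneg)
      have "norm (\<psi> a N - of_real (exp (- v))) \<le> max 1 (exp (- (v / N))) ^ N * (real (g N) * err1 a + real N * err2 a (g N))"
        using \<psi>_close[of a N "g N"] unfolding av q .
      also have "max 1 (exp (- (v / N))) ^ N \<le> exp (\<bar>v\<bar> / N) ^ N"
      proof (rule power_mono)
        have "- (v / N) \<le> \<bar>v\<bar> / N" unfolding minus_divide_left by (intro divide_right_mono) auto
        then show "max 1 (exp (- (v / N))) \<le> exp (\<bar>v\<bar> / N)" by simp
      qed simp
      finally show "norm (\<psi> (t / sqrt N) N - of_real (exp (- (t\<^sup>2 * var_lim / 2)))) \<le> exp \<bar>v\<bar> * ?err N"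
        using e0 unfolding a_def v_def q[unfolded v_def] by (simp add: mult_right_mono)
    qed
  qed
qed

text \<open>At \<open>t = 1\<close> the limit of characteristic functions has modulus at most 1,
  whereas a negative \<open>var_lim\<close> would make it exceed 1.\<close>

lemma var_lim_nonneg: "0 \<le> var_lim"
proof -
  have "norm (complex_of_real (exp (- (1\<^sup>2 * var_lim / 2)))) \<le> 1"
    by (rule LIMSEQ_le_const2[OF tendsto_norm[OF \<psi>_tendsto]]) (use norm_\<psi> in blast)
  then show ?thesis by simp
qed

end

section \<open>Hoelder norms and the theorem\<close>

lemma variation_le:
  assumes "\<And>w w'. (\<And>i. \<bar>i\<bar> < int N \<Longrightarrow> w i = w' i) \<Longrightarrow> norm (f w - f w') \<le> K"
  shows "variation N f \<le> ennreal K"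
  unfolding variation_def using assms by (auto intro!: SUP_least ennreal_leI)

lemma le_variation:
  assumes "\<And>i. \<bar>i\<bar> < int N \<Longrightarrow> w i = w' i"
  shows "ennreal (norm (f w - f w')) \<le> variation N f"
  unfolding variation_def
  by (rule SUP_upper2[of "(w, w')"]) (use assms in auto)

lemma hoelderI:
  assumes \<theta>: "0 < \<theta>" and bound: "\<And>w. norm (f w) \<le> M"
    and var: "\<And>N w w'. (\<And>i. \<bar>i\<bar> < int N \<Longrightarrow> w i = w' i) \<Longrightarrow> norm (f w - f w') \<le> K * \<theta> ^ N"
  shows "hoelder \<theta> f"
proof -
  have K: "0 \<le> K" using var[of 0 undefined undefined] by simp
  have "(SUP w. ennreal (norm (f w))) \<le> ennreal M"
    using bound by (auto intro!: SUP_least ennreal_leI)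
  moreover have "hoelder_seminorm \<theta> f \<le> ennreal K"
    unfolding hoelder_seminorm_def
  proof (rule SUP_least)
    fix N :: nat
    have "ennreal (inverse (\<theta> ^ N)) * variation N f \<le> ennreal (inverse (\<theta> ^ N)) * ennreal (K * \<theta> ^ N)"
      by (intro mult_left_mono variation_le var) auto
    also have "\<dots> = ennreal K"
      using \<theta> K by (simp flip: ennreal_mult')
    finally show "ennreal (inverse (\<theta> ^ N)) * variation N f \<le> ennreal K" .
  qed
  ultimately have "hoelder_norm \<theta> f \<le> ennreal M + ennreal K"
    unfolding hoelder_norm_def by (rule add_mono)
  then show ?thesis unfolding hoelder_def by (simp add: ennreal_add_less_top order.strict_trans1)
qed

lemma hoelder_norm_antimono:
  assumes "0 < \<theta>" "\<theta> \<le> \<theta>'"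
  shows "hoelder_norm \<theta>' f \<le> hoelder_norm \<theta> f"
  unfolding hoelder_norm_def hoelder_seminorm_def
  using assms
  by (intro add_mono order_refl SUP_mono') (auto intro!: mult_right_mono ennreal_leI le_imp_inverse_le power_mono)

section \<open>Finite Hoelder norms as real constants\<close>

locale hoelder_function =
  fixes \<theta> :: real and f :: "symb_seq \<Rightarrow> 'b::real_normed_vector"
  assumes \<theta>: "0 < \<theta>" "\<theta> < 1" and fin: "hoelder \<theta> f"
begin

definition H :: real where "H = enn2real (hoelder_norm \<theta> f)"

lemma norm_eq: "hoelder_norm \<theta> f = ennreal H"
  using fin unfolding H_def hoelder_def by simp

lemma H_nonneg: "0 \<le> H"
  by (simp add: H_def)

lemma bound: "norm (f w) \<le> H"
proof -
  have "ennreal (norm (f w)) \<le> (SUP w. ennreal (norm (f w)))" by (rule SUP_upper) simp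
  also have "\<dots> \<le> ennreal H" unfolding norm_eq[symmetric] hoelder_norm_def by simp
  finally show ?thesis using H_nonneg by simp
qed

text \<open>The seminorm controls \<open>N \<ge> 1\<close> with constant \<open>H\<close>; for
  \<open>N = 0\<close> the sup norm has to serve, which is where the 2 comes from.\<close>

lemma var:
  assumes eq: "\<And>i. \<bar>i\<bar> < int N \<Longrightarrow> w i = w' i"
  shows "norm (f w - f w') \<le> 2 * H * \<theta> ^ N"
proof (cases "N = 0")
  case True
  then show ?thesis using norm_triangle_ineq4[of "f w" "f w'"] bound[of w] bound[of w'] by simp
next
  case False
  have "ennreal (inverse (\<theta> ^ N) * norm (f w - f w')) = ennreal (inverse (\<theta> ^ N)) * ennreal (norm (f w - f w'))"
    using \<theta> by (intro ennreal_mult) auto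
  also have "\<dots> \<le> ennreal (inverse (\<theta> ^ N)) * variation N f"
    by (intro mult_left_mono le_variation eq) auto
  also have "\<dots> \<le> hoelder_seminorm \<theta> f"
    unfolding hoelder_seminorm_def using False by (intro SUP_upper) auto
  also have "\<dots> \<le> ennreal H" unfolding norm_eq[symmetric] hoelder_norm_def by simp
  finally have "inverse (\<theta> ^ N) * norm (f w - f w') \<le> H" using H_nonneg by simp
  then have "norm (f w - f w') \<le> H * \<theta> ^ N" using \<theta> by (simp add: field_simps)
  also have "\<dots> \<le> 2 * H * \<theta> ^ N" using H_nonneg \<theta> by simp
  finally show ?thesis .
qed

lemma meas: "f \<in> seq_meas"
  by (rule measurable_hoelder[of f "2 * H" \<theta>]) (use var \<theta> in auto)

end

text \<open>The link between the norms of the theorem, at exponent \<open>\<kappa>\<^sup>2\<close>,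
  and the working bounds at rate \<open>\<kappa>\<close>: \<open>H\<close> is the norm itself, so
  the final estimates are linear in it.\<close>

lemma (in bernoulli_shift) hoelder_bosc_le:
  assumes f: "hoelder (\<kappa>\<^sup>2) f"
  obtains H where "hoelder_norm (\<kappa>\<^sup>2) f = ennreal H" "0 \<le> H" "bosc_le future_eq (2 * H) f" "bosc_le (past_eq 0) (2 * H) f"
    "f \<in> seq_meas"
proof -
  interpret hoelder_function "\<kappa>\<^sup>2" f
    using \<kappa> f power_strict_decreasing[of 0 2 \<kappa>] by unfold_locales auto
  have H: "0 \<le> 2 * H" using H_nonneg by simp
  have pw: "2 * H * (\<kappa>\<^sup>2) ^ N \<le> 2 * H * \<kappa> ^ N" for N
    unfolding power_mult[symmetric] using H by (intro mult_left_mono \<kappa>_pow_mono) auto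
  have b2: "norm (f w) \<le> 2 * H" for w using bound[of w] H_nonneg by simp
  have "bosc_le future_eq (2 * H) f"
    by (intro bosc_leI b2 osc_leI order_trans[OF var pw]) (auto simp: future_eq_def)
  moreover have "bosc_le (past_eq 0) (2 * H) f"
    by (intro bosc_leI b2 osc_leI order_trans[OF var pw]) (auto simp: past_eq_def)
  ultimately show thesis using that norm_eq H_nonneg meas by blast
qed

lemma (in hoelder_cocycle) aperiodic_if_only_trivial:
  assumes "only_trivial_solution (\<kappa> ^ 4) \<beta> m"
  shows "aperiodic (real m)"
  unfolding aperiodic_def
proof (intro notI, elim exE conjE)
  fix \<nu> and A :: "symb_seq \<Rightarrow> complex" and K
  assume A: "\<forall>N w w'. (\<forall>i. \<bar>i\<bar> < int N \<longrightarrow> w i = w' i) \<longrightarrow> norm (A w - A w') \<le> K * (\<kappa> ^ 4) ^ N"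
    and one: "\<forall>w. norm (A w) = 1" and eq: "\<forall>w. cis (real m * \<beta> w) * A (shift w) = \<nu> * A w"
  have "hoelder (\<kappa> ^ 4) A"
    by (rule hoelderI[where M = 1 and K = K]) (use A one \<kappa>4 in auto)
  then have "A undefined = 0" using assms eq unfolding only_trivial_solution_def by blast
  then show False using one[rule_format, of undefined] by simp
qed

lemma has_fourier_coeff_Re:
  assumes "has_fourier_coeff m F A"
  shows "F (w, s) = 2 * Re (A w * cis (real m * s))"
proof -
  have "complex_of_real (F (w, s)) = A w * cis (real m * s) + cnj (A w * cis (real m * s))"
    using assms unfolding has_fourier_coeff_def by (simp add: cis_cnj)
  then have "complex_of_real (F (w, s)) = complex_of_real (2 * Re (A w * cis (real m * s)))"
    unfolding complex_add_cnj .
  then show ?thesis by (simp only: of_real_eq_iff)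
qed

lemma prob_space_haar_circle: "prob_space haar_circle"
  unfolding haar_circle_def by (rule prob_space_uniform_measure) auto

lemma integral_bernoulli_haar:
  fixes f :: "symb_seq \<Rightarrow> 'b::{banach, second_countable_topology}"
  assumes [measurable]: "f \<in> seq_meas"
  shows "(\<integral>(w, s). f w \<partial>(bernoulli_measure p \<Otimes>\<^sub>M haar_circle)) = (\<integral>w. f w \<partial>bernoulli_measure p)"
proof -
  interpret haar: prob_space haar_circle by (rule prob_space_haar_circle)
  have "(\<integral>w. f w \<partial>bernoulli_measure p)
      = (\<integral>w. f w \<partial>distr (bernoulli_measure p \<Otimes>\<^sub>M haar_circle) (bernoulli_measure p) fst)"
    by (simp add: haar.distr_pair_fst)
  also have "\<dots> = (\<integral>x. f (fst x) \<partial>(bernoulli_measure p \<Otimes>\<^sub>M haar_circle))"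
    by (rule integral_distr) measurable
  finally show ?thesis by (simp add: case_prod_beta')
qed

lemma centered_normal_char:
  assumes "0 \<le> v"
  shows "real_distribution (centered_normal v)" "char (centered_normal v) t = exp (- (t\<^sup>2 * v / 2))"
proof -
  have "real_distribution (centered_normal v) \<and> char (centered_normal v) t = exp (- (t\<^sup>2 * v / 2))"
  proof (cases "v = 0")
    case True
    have "prob_space (return borel (0::real))" by (rule prob_space_return) simp
    then have "real_distribution (return borel (0::real))"
      by (intro real_distribution.intro real_distribution_axioms.intro) auto
    then show ?thesis using True by (simp add: centered_normal_def char_def integral_return)
  next
    case False
    then have v: "0 < v" using assms by simp
    interpret N: real_distribution std_normal_distribution by (rule real_dist_normal_dist)
    have "distributed std_normal_distribution lborel (\<lambda>x. x) std_normal_density"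
      unfolding distributed_def by (auto simp: distr_id2)
    then have "distributed std_normal_distribution lborel (\<lambda>x. 0 + sqrt v * x) (normal_density (0 + sqrt v * 0) (\<bar>sqrt v\<bar> * 1))"
      using v by (intro N.normal_density_affine) auto
    then have "distr std_normal_distribution lborel (\<lambda>x. sqrt v * x) = centered_normal v"
      using v by (simp add: distributed_def centered_normal_def)
    moreover have "distr std_normal_distribution lborel (\<lambda>x. sqrt v * x) = distr std_normal_distribution borel (\<lambda>x. sqrt v * x)"
      by (rule distr_cong) auto
    ultimately have eq: "centered_normal v = distr std_normal_distribution borel (\<lambda>x. sqrt v * x)" by simp
    have "char (centered_normal v) t = char std_normal_distribution (t * sqrt v)"
      unfolding eq char_def by (subst integral_distr) (auto simp: mult.assoc)
    also have "\<dots> = exp (- (t\<^sup>2 * v / 2))"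
      using v by (simp add: char_std_normal_distribution power_mult_distrib)
    finally have "char (centered_normal v) t = exp (- (t\<^sup>2 * v / 2))" .
    moreover have "real_distribution (centered_normal v)"
      unfolding eq by (rule N.real_distribution_distr) simp
    ultimately show ?thesis by simp
  qed
  then show "real_distribution (centered_normal v)" "char (centered_normal v) t = exp (- (t\<^sup>2 * v / 2))"
    by blast+
qed

section \<open>The limit variance and weak convergence\<close>

context clt_setup
begin

lemma limit_variance_eq: "limit_variance p \<beta> A = var_lim"
proof -
  have "summable (\<lambda>n. cor (Suc n))"
  proof (rule summable_comparison_test')
    show "summable (\<lambda>d. C * M * M * r * r ^ d)" using r by (intro summable_mult summable_geometric) auto
    show "norm (cor (Suc d)) \<le> C * M * M * r * r ^ d" for d using cor_bound[of "Suc d"] by (simp add: mult_ac)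
  qed
  then have "Re (\<Sum>n. cor (Suc n)) = (\<Sum>n. Re (cor (Suc n)))" by (rule Re_suminf)
  moreover have "(\<Sum>n. c (Suc n)) = 2 * (\<Sum>n. Re (cor (Suc n)))"
    unfolding c_def using c_summable unfolding c_def by (subst suminf_mult) auto
  ultimately have s: "2 * (\<Sum>n. c (Suc n)) = 4 * Re (\<Sum>n. cor (Suc n))" by simp
  have "cor 0 = (\<integral>w. complex_of_real ((norm (A w))\<^sup>2) \<partial>bernoulli_measure p)"
    unfolding complex_norm_square by (simp add: cor_def birkhoff_sum_def)
  then have "c 0 = 2 * (\<integral>w. (norm (A w))\<^sup>2 \<partial>bernoulli_measure p)"
    unfolding c_def integral_complex_of_real by simp
  moreover have "(\<integral>(w, s). (norm (A w))\<^sup>2 \<partial>(bernoulli_measure p \<Otimes>\<^sub>M haar_circle)) = (\<integral>w. (norm (A w))\<^sup>2 \<partial>bernoulli_measure p)"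
    by (rule integral_bernoulli_haar) measurable
  moreover have "(\<integral>(w, s). A ((shift ^^ n) w) * cnj (A w) * cis (birkhoff_sum \<beta> n w)
         \<partial>(bernoulli_measure p \<Otimes>\<^sub>M haar_circle)) = cor n" for n
    unfolding cor_def by (rule integral_bernoulli_haar) measurable
  ultimately show ?thesis unfolding limit_variance_def var_lim_def s by (simp only:)
qed

lemma central_limit:
  assumes G: "has_fourier_coeff 1 G A"
  shows "weak_conv_m (\<lambda>N. distr (bernoulli_measure p) borel (normalized_sum \<beta> G s0 N)) (centered_normal var_lim)"
proof (rule levy_continuity)
  have eq: "normalized_sum \<beta> G s0 N = (\<lambda>w. 1 / sqrt N * Y N w)" for N
    unfolding normalized_sum_def Y_def X_def Z_def has_fourier_coeff_Re[OF G] angle_def by simp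
  show "real_distribution (distr (bernoulli_measure p) borel (normalized_sum \<beta> G s0 N))" for N
    unfolding eq by (rule bern.real_distribution_distr) measurable
  show "real_distribution (centered_normal var_lim)"
    by (rule centered_normal_char) (rule var_lim_nonneg)
  show "(\<lambda>N. char (distr (bernoulli_measure p) borel (normalized_sum \<beta> G s0 N)) t) \<longlonglongrightarrow> char (centered_normal var_lim) t" for t
  proof -
    have "char (distr (bernoulli_measure p) borel (normalized_sum \<beta> G s0 N)) t = \<psi> (t / sqrt N) N" for N
      unfolding eq char_def \<psi>_def \<Phi>_def
      by (subst integral_distr) (auto simp: cis_conv_exp, measurable)
    then show ?thesis
      using \<psi>_tendsto[of t] centered_normal_char(2)[OF var_lim_nonneg, of t] by simp
  qed
qed

end

theorem theorem5p4:
  fixes \<theta> p :: real and \<beta> :: "symb_seq \<Rightarrow> real"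
  assumes "0 < \<theta>" "\<theta> < 1" "0 < p" "p < 1"
    and "hoelder \<theta> \<beta>"
    and "\<forall>m\<in>{1, 2, 4}. only_trivial_solution \<theta> \<beta> m"
  shows "\<exists>r C. 0 < r \<and> r < 1 \<and> 0 < C \<and>
    (\<forall>m\<in>{1, 2}. \<forall>F\<in>observables \<theta> m. \<forall>G\<in>observables \<theta> m. \<forall>s\<^sub>0 n k. k < n \<longrightarrow>
        ennreal \<bar>\<integral>\<omega>. G ((shift ^^ n) \<omega>, angle \<beta> s\<^sub>0 n \<omega>) * F ((shift ^^ k) \<omega>, angle \<beta> s\<^sub>0 k \<omega>)
                   \<partial>bernoulli_measure p\<bar>
        \<le> ennreal C * observable_norm (sqrt \<theta>) m G * observable_norm (sqrt \<theta>) m F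
           * ennreal (r ^ (n - k))) \<and>
    (\<forall>m\<in>{1::nat, 2}. \<forall>n k. k < n \<longrightarrow>
      (\<forall>P Q :: symb_seq \<Rightarrow> complex. hoelder \<theta> P \<and> hoelder \<theta> Q \<longrightarrow>
        ennreal (norm (\<integral>\<omega>. P ((shift ^^ n) \<omega>) * cis (\<Sum>j<n. real m * \<beta> ((shift ^^ j) \<omega>))
                         * Q ((shift ^^ k) \<omega>) * cis (\<Sum>j<k. real m * \<beta> ((shift ^^ j) \<omega>))
                   \<partial>bernoulli_measure p))
        \<le> ennreal C * hoelder_norm (sqrt \<theta>) P * hoelder_norm (sqrt \<theta>) Q * ennreal (r ^ n))) \<and>
    (\<forall>G A. has_fourier_coeff 1 G A \<and> hoelder \<theta> A \<and>
        (\<forall>s\<^sub>0. (\<lambda>n. \<integral>\<omega>. G ((shift ^^ n) \<omega>, angle \<beta> s\<^sub>0 n \<omega>) \<partial>bernoulli_measure p) sums 0) \<longrightarrow>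
      0 \<le> limit_variance p \<beta> A \<and>
      (\<forall>s\<^sub>0. weak_conv_m (\<lambda>N. distr (bernoulli_measure p) borel (normalized_sum \<beta> G s\<^sub>0 N))
                 (centered_normal (limit_variance p \<beta> A))))"
proof -
  \<comment> \<open>With this choice \<open>\<kappa> ^ 4\<close> is the exponent of
    \<open>\<beta>\<close> and of the assumption, and \<open>\<kappa>\<^sup>2\<close> that of the
    norms in the estimates.\<close>
  define \<kappa> where "\<kappa> = sqrt (sqrt \<theta>)"
  have kappa2: "\<kappa>\<^sup>2 = sqrt \<theta>" using assms(1) by (simp add: \<kappa>_def)
  have "\<kappa> ^ 4 = (\<kappa>\<^sup>2)\<^sup>2" by (simp flip: power_mult)
  then have kappa4: "\<kappa> ^ 4 = \<theta>" using assms(1) by (simp add: kappa2)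
  interpret bernoulli_shift \<kappa> p
    using assms by unfold_locales (auto simp: \<kappa>_def)
  interpret beta: hoelder_function \<theta> \<beta> using assms by unfold_locales
  interpret hoelder_cocycle \<kappa> p \<beta> "2 * beta.H"
  proof
    show "\<bar>\<beta> \<omega> - \<beta> \<omega>'\<bar> \<le> 2 * beta.H * (\<kappa> ^ 4) ^ N" if "\<And>i. \<bar>i\<bar> < int N \<Longrightarrow> \<omega> i = \<omega>' i" for N \<omega> \<omega>'
      using beta.var[OF that] unfolding kappa4 by simp
  qed
  have "aperiodic m" if "m \<in> {1, 2, 4}" for m
  proof -
    have "aperiodic (real k)" if "k \<in> {1, 2, 4}" for k
      by (rule aperiodic_if_only_trivial, unfold kappa4) (rule bspec[OF assms(6) that])
    from this[of 1] this[of 2] this[of 4] show ?thesis using that by auto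
  qed
  then obtain r C where "mixing_cocycle \<kappa> p \<beta> (2 * beta.H) r C"
    using mixing_cocycle_exists by blast
  then interpret mixing_cocycle \<kappa> p \<beta> "2 * beta.H" r C .
  have sub: "hoelder (\<kappa>\<^sup>2) f" if "hoelder \<theta> f" for f :: "symb_seq \<Rightarrow> complex"
  proof -
    have "\<theta> \<le> sqrt \<theta>" using assms(1,2) by (simp add: real_le_rsqrt power2_eq_square mult_left_le)
    then show ?thesis
      using hoelder_norm_antimono[of \<theta> "sqrt \<theta>" f] that assms(1) unfolding hoelder_def kappa2 by simp
  qed
  \<comment> \<open>Here \<open>40 = 10 * 2 * 2\<close>: the constant of
    \<open>observable_correlation\<close>, for two observables that are bounded by twice their
    norms.\<close>
  define D where "D = 40 * C * E"
  have D: "0 < D" using C E_ge1 by (simp add: D_def)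
  have r': "0 < sqrt r" "sqrt r < 1" using r by auto
  have comb: "ennreal x \<le> ennreal D * ennreal K * ennreal L * ennreal (sqrt r ^ j)"
    if "x \<le> 10 * C * E * (2 * K) * (2 * L) * sqrt r ^ j" "0 \<le> K" "0 \<le> L" for x K L j
  proof -
    have "ennreal x \<le> ennreal (D * K * L * sqrt r ^ j)"
      using that(1) by (intro ennreal_leI) (simp add: D_def mult_ac)
    also have "\<dots> = ennreal D * ennreal K * ennreal L * ennreal (sqrt r ^ j)"
      using that(2,3) D r' by (simp add: ennreal_mult)
    finally show ?thesis .
  qed
  have 1: "ennreal \<bar>\<integral>\<omega>. G ((shift ^^ n) \<omega>, angle \<beta> s\<^sub>0 n \<omega>) * F ((shift ^^ k) \<omega>, angle \<beta> s\<^sub>0 k \<omega>)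
                   \<partial>bernoulli_measure p\<bar>
        \<le> ennreal D * observable_norm (sqrt \<theta>) m G * observable_norm (sqrt \<theta>) m F * ennreal (sqrt r ^ (n - k))"
    if m: "m \<in> {1, 2}" and F: "F \<in> observables \<theta> m" and G: "G \<in> observables \<theta> m" and kn: "k < n" for m F G s\<^sub>0 n k
  proof -
    obtain A where A: "has_fourier_coeff m F A" "hoelder \<theta> A" using F unfolding observables_def by blast
    obtain A' where A': "has_fourier_coeff m G A'" "hoelder \<theta> A'" using G unfolding observables_def by blast
    obtain H where H: "hoelder_norm (\<kappa>\<^sup>2) A = ennreal H" "0 \<le> H" "bosc_le future_eq (2 * H) A" "bosc_le (past_eq 0) (2 * H) A"
      "A \<in> seq_meas" using hoelder_bosc_le[OF sub[OF A(2)]] by metis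
    obtain H' where H': "hoelder_norm (\<kappa>\<^sup>2) A' = ennreal H'" "0 \<le> H'" "bosc_le future_eq (2 * H') A'" "bosc_le (past_eq 0) (2 * H') A'"
      "A' \<in> seq_meas" using hoelder_bosc_le[OF sub[OF A'(2)]] by metis
    have m': "real m \<in> {1, 2}" "m > 0" using m by auto
    have norms: "observable_norm (sqrt \<theta>) m G = ennreal H'" "observable_norm (sqrt \<theta>) m F = ennreal H"
      using fourier_coeff_eq[OF A(1) m'(2)] fourier_coeff_eq[OF A'(1) m'(2)] H(1) H'(1)
      by (simp_all add: observable_norm_def kappa2)
    show ?thesis
      unfolding norms has_fourier_coeff_Re[OF A(1)] has_fourier_coeff_Re[OF A'(1)]
      by (intro comb observable_correlation m' H'(2,3,5) H(2-5) less_imp_le kn)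
  qed
  have 2: "ennreal (norm (\<integral>\<omega>. P ((shift ^^ n) \<omega>) * cis (\<Sum>j<n. real m * \<beta> ((shift ^^ j) \<omega>))
                         * Q ((shift ^^ k) \<omega>) * cis (\<Sum>j<k. real m * \<beta> ((shift ^^ j) \<omega>))
                   \<partial>bernoulli_measure p))
        \<le> ennreal D * hoelder_norm (sqrt \<theta>) P * hoelder_norm (sqrt \<theta>) Q * ennreal (sqrt r ^ n)"
    if m: "m \<in> {1::nat, 2}" and kn: "k < n" and PQ: "hoelder \<theta> P" "hoelder \<theta> Q" for m n k and P Q :: "symb_seq \<Rightarrow> complex"
  proof -
    obtain H where H: "hoelder_norm (\<kappa>\<^sup>2) P = ennreal H" "0 \<le> H" "bosc_le future_eq (2 * H) P" "bosc_le (past_eq 0) (2 * H) P"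
      "P \<in> seq_meas" using hoelder_bosc_le[OF sub[OF PQ(1)]] by metis
    obtain H' where H': "hoelder_norm (\<kappa>\<^sup>2) Q = ennreal H'" "0 \<le> H'" "bosc_le future_eq (2 * H') Q" "bosc_le (past_eq 0) (2 * H') Q"
      "Q \<in> seq_meas" using hoelder_bosc_le[OF sub[OF PQ(2)]] by metis
    have m': "real m \<in> {1, 2}" using m by auto
    have S: "(\<Sum>j<n. real m * \<beta> ((shift ^^ j) \<omega>)) = real m * birkhoff_sum \<beta> n \<omega>" for n \<omega>
      by (simp add: birkhoff_sum_def sum_distrib_left)
    have "norm (\<integral>\<omega>. P ((shift ^^ n) \<omega>) * cis (real m * birkhoff_sum \<beta> n \<omega>)
             * Q ((shift ^^ k) \<omega>) * cis (real m * birkhoff_sum \<beta> k \<omega>) \<partial>bernoulli_measure p)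
          \<le> 4 * C * E * (2 * H) * (2 * H') * sqrt r ^ n"
      by (intro phase_correlation m' H(3,5) H'(3-5) less_imp_le kn)
    \<comment> \<open>The constant 4 is raised to 10 so that part 2 shares the constant
      \<open>D\<close> of part 1.\<close>
    also have "\<dots> \<le> 10 * C * E * (2 * H) * (2 * H') * sqrt r ^ n"
      using C E_ge1 H(2) H'(2) r' by (intro mult_right_mono) auto
    finally show ?thesis
      unfolding S kappa2[symmetric] H(1) H'(1) by (rule comb[OF _ H(2) H'(2)])
  qed
  have 3: "0 \<le> limit_variance p \<beta> A \<and>
      (\<forall>s\<^sub>0. weak_conv_m (\<lambda>N. distr (bernoulli_measure p) borel (normalized_sum \<beta> G s\<^sub>0 N))
                 (centered_normal (limit_variance p \<beta> A)))"
    if G: "has_fourier_coeff 1 G A" and A: "hoelder \<theta> A" for G A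
  proof -
    obtain H where H: "bosc_le future_eq (2 * H) A" "bosc_le (past_eq 0) (2 * H) A" "A \<in> seq_meas"
      using hoelder_bosc_le[OF sub[OF A]] by metis
    have S: "clt_setup \<kappa> p \<beta> (2 * beta.H) r C A (2 * H)"
      using H by unfold_locales
    show ?thesis
      using clt_setup.var_lim_nonneg[OF S] clt_setup.limit_variance_eq[OF S] clt_setup.central_limit[OF S G] by simp
  qed
  show ?thesis
    by (rule exI[of _ "sqrt r"], rule exI[of _ D], intro conjI ballI allI impI)
      (rule r' D, rule r' D, rule r' D, (rule 1; assumption), (elim conjE, (rule 2; assumption)),
        (elim conjE, (rule 3[THEN conjunct1]; assumption)),
        (elim conjE, (rule spec[OF 3[THEN conjunct2]]; assumption)))
qed

end
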